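(* Let $A$ be an arbitrary Hopf algebra over $k$, with Hopf cocenter $A\to\mathcal{HC}(A)$. Then the cocenter fits into an exact sequence of Hopf algebras $$k\to C\to A\to\mathcal{HC}(A)\to k ,$$ i.e. there exist a Hopf algebra $C$ and a Hopf algebra morphism $C\to A$ such that this sequence, with $A\to\mathcal{HC}(A)$ the canonical quotient map, is exact.
   Context: $k$ is an algebraically closed field; Hopf algebras are over $k$ and antipodes are not assumed bijective. $\Delta$, $\varepsilon$ denote comultiplication and counit, and $\Delta^{\mathrm{op}}(x)=x_{(2)}\otimes x_{(1)}$. A Hopf algebra morphism $\pi:A\to B$ is cocentral if $(\mathrm{id}\otimes\pi)\circ\Delta=(\mathrm{id}\otimes\pi)\circ\Delta^{\mathrm{op}}$. The (Hopf) cocenter $A\to\mathcal{HC}(A)$ is the quotient Hopf algebra of $A$ that is universal among cocentral quotients: the quotient map is cocentral and every cocentral morphism from $A$ factors uniquely through it (it exists for every Hopf algebra). A sequence of Hopf algebra morphisms $k\to H\xrightarrow{\iota}L\xrightarrow{\pi}Q\to k$ is called exact if: (1) $\iota$ is injective; (2) $\pi$ is surjective; (3) $\ker\pi=L\,\iota(H)^+$, where $\iota(H)^+=\iota(H)\cap\ker\varepsilon$; (4) $\iota(H)=\{x\in L:(\pi\otimes\mathrm{id})\Delta(x)=1\otimes x\}$. *)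

theory Defs
  imports "HOL-Algebra.Module" "HOL-Algebra.Algebraic_Closure" "HOL-Algebra.Ideal_Product"
begin

text \<open>
  Everything is relative to carriers, in the style of HOL-Algebra: the ground field is a ring
  record \<open>K\<close>, vector spaces over it are \<open>module\<close> records.  A record of this type also has
  \<open>mult\<close> and \<open>one\<close> fields, which are junk where only a module is built.
\<close>

section \<open>Linear maps, free modules, quotient modules\<close>

definition linear_maps ::
    "('k, 'x) ring_scheme \<Rightarrow> ('k, 'a, 'm) module_scheme \<Rightarrow> ('k, 'b, 'n) module_scheme \<Rightarrow> ('a \<Rightarrow> 'b) set"
  where "linear_maps K M N =
    {f \<in> carrier M \<rightarrow> carrier N.
      (\<forall>x \<in> carrier M. \<forall>y \<in> carrier M. f (x \<oplus>\<^bsub>M\<^esub> y) = f x \<oplus>\<^bsub>N\<^esub> f y) \<and>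
      (\<forall>c \<in> carrier K. \<forall>x \<in> carrier M. f (c \<odot>\<^bsub>M\<^esub> x) = c \<odot>\<^bsub>N\<^esub> f x)}"

definition free_module :: "('k, 'x) ring_scheme \<Rightarrow> 'i set \<Rightarrow> ('k, 'i \<Rightarrow> 'k) module"
  where "free_module K I =
    \<lparr>carrier = {f. (\<forall>i. f i \<in> carrier K) \<and> finite {i. f i \<noteq> \<zero>\<^bsub>K\<^esub>} \<and> {i. f i \<noteq> \<zero>\<^bsub>K\<^esub>} \<subseteq> I},
      monoid.mult = undefined, one = undefined,
      zero = (\<lambda>i. \<zero>\<^bsub>K\<^esub>), add = (\<lambda>f g i. f i \<oplus>\<^bsub>K\<^esub> g i), smult = (\<lambda>c f i. c \<otimes>\<^bsub>K\<^esub> f i)\<rparr>"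

definition free_gen :: "('k, 'x) ring_scheme \<Rightarrow> 'i \<Rightarrow> ('i \<Rightarrow> 'k)"
  where "free_gen K i = (\<lambda>j. if j = i then \<one>\<^bsub>K\<^esub> else \<zero>\<^bsub>K\<^esub>)"

definition quot_module :: "('k, 'a, 'm) module_scheme \<Rightarrow> 'a set \<Rightarrow> ('k, 'a set) module"
  where "quot_module M H =
    \<lparr>carrier = a_rcosets\<^bsub>M\<^esub> H, monoid.mult = undefined, one = undefined,
      zero = H, add = set_add M, smult = (\<lambda>c C. \<Union>x\<in>C. H +>\<^bsub>M\<^esub> (c \<odot>\<^bsub>M\<^esub> x))\<rparr>"


lemma (in cring) free_module_is_module:
  fixes I :: "'i set"
  shows "module R (free_module R I)"
proof -
  have fin: "finite {i. h i \<noteq> \<zero>} \<and> {i. h i \<noteq> \<zero>} \<subseteq> I"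
    if "{i. h i \<noteq> \<zero>} \<subseteq> {i. f i \<noteq> \<zero>} \<union> {i. g i \<noteq> \<zero>}"
      "finite {i. f i \<noteq> \<zero>}" "{i. f i \<noteq> \<zero>} \<subseteq> I" "finite {i. g i \<noteq> \<zero>}" "{i. g i \<noteq> \<zero>} \<subseteq> I"
    for f g h :: "'i \<Rightarrow> 'a"
    using that finite_subset[OF that(1)] by auto
  show ?thesis
  proof (rule moduleI, rule is_cring, rule abelian_groupI)
    fix f g assume "f \<in> carrier (free_module R I)" "g \<in> carrier (free_module R I)"
    moreover from this have "{i. f i \<oplus> g i \<noteq> \<zero>} \<subseteq> {i. f i \<noteq> \<zero>} \<union> {i. g i \<noteq> \<zero>}"
      by (auto simp: free_module_def)
    ultimately show "f \<oplus>\<^bsub>free_module R I\<^esub> g \<in> carrier (free_module R I)"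
      using fin[of "\<lambda>i. f i \<oplus> g i" f g] by (simp add: free_module_def)
  next
    fix f assume f: "f \<in> carrier (free_module R I)"
    have "(\<lambda>i. \<ominus> f i) \<in> carrier (free_module R I)"
      using f fin[of "\<lambda>i. \<ominus> f i" f f] by (fastforce simp: free_module_def)
    moreover have "(\<lambda>i. \<ominus> f i) \<oplus>\<^bsub>free_module R I\<^esub> f = \<zero>\<^bsub>free_module R I\<^esub>"
      using f by (auto simp: free_module_def l_neg)
    ultimately show "\<exists>g\<in>carrier (free_module R I). g \<oplus>\<^bsub>free_module R I\<^esub> f = \<zero>\<^bsub>free_module R I\<^esub>"
      by blast
  next
    fix c f assume "c \<in> carrier R" "f \<in> carrier (free_module R I)"
    moreover from this have "{i. c \<otimes> f i \<noteq> \<zero>} \<subseteq> {i. f i \<noteq> \<zero>} \<union> {i. f i \<noteq> \<zero>}"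
      by (auto simp: free_module_def)
    ultimately show "c \<odot>\<^bsub>free_module R I\<^esub> f \<in> carrier (free_module R I)"
      using fin[of "\<lambda>i. c \<otimes> f i" f f] by (simp add: free_module_def)
  qed (auto simp: free_module_def a_ac l_distr r_distr m_assoc)
qed

lemma (in cring) free_gen_closed: "i \<in> I \<Longrightarrow> free_gen R i \<in> carrier (free_module R I)"
  by (auto simp: free_gen_def free_module_def)

lemma quot_module_simps:
  "carrier (quot_module M H) = a_rcosets\<^bsub>M\<^esub> H" "zero (quot_module M H) = H"
  "add (quot_module M H) = set_add M"
  "smult (quot_module M H) c C = (\<Union>x\<in>C. H +>\<^bsub>M\<^esub> (c \<odot>\<^bsub>M\<^esub> x))"
  by (simp_all add: quot_module_def)

context module begin

lemma submodule_abelian_subgroup: "submodule H R M \<Longrightarrow> abelian_subgroup H M"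
  by (rule abelian_subgroupI3) (simp_all add: additive_subgroup_def submodule.axioms(1) M.abelian_group_axioms)

lemma quot_module_carrierE:
  assumes "C \<in> carrier (quot_module M H)"
  obtains x where "x \<in> carrier M" "C = H +>\<^bsub>M\<^esub> x"
  using assms by (auto simp: quot_module_simps A_RCOSETS_def' a_r_coset_def')

lemma quot_module_coset_closed:
  "submodule H R M \<Longrightarrow> x \<in> carrier M \<Longrightarrow> H +>\<^bsub>M\<^esub> x \<in> carrier (quot_module M H)"
  by (simp add: quot_module_simps M.a_rcosetsI submoduleE)

lemma quot_module_coset_add:
  assumes H: "submodule H R M" and x: "x \<in> carrier M" and y: "y \<in> carrier M"
  shows "(H +>\<^bsub>M\<^esub> x) \<oplus>\<^bsub>quot_module M H\<^esub> (H +>\<^bsub>M\<^esub> y) = H +>\<^bsub>M\<^esub> (x \<oplus>\<^bsub>M\<^esub> y)"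
  using abelian_subgroup.a_rcos_sum[OF submodule_abelian_subgroup[OF H] x y]
  by (simp add: quot_module_simps)

lemma quot_module_coset_eq_iff:
  assumes H: "submodule H R M" and x: "x \<in> carrier M" and y: "y \<in> carrier M"
  shows "H +>\<^bsub>M\<^esub> x = H +>\<^bsub>M\<^esub> y \<longleftrightarrow> x \<ominus>\<^bsub>M\<^esub> y \<in> H"
proof -
  interpret H: abelian_subgroup H M by (rule submodule_abelian_subgroup[OF H])
  show ?thesis
    using H.a_rcos_module[OF y x] H.a_rcos_self[OF x] H.a_repr_independence'[of x y] x y
    by (auto simp: a_minus_def)
qed

lemma quot_module_coset_smult:
  assumes H: "submodule H R M" and c: "c \<in> carrier R" and x: "x \<in> carrier M"
  shows "c \<odot>\<^bsub>quot_module M H\<^esub> (H +>\<^bsub>M\<^esub> x) = H +>\<^bsub>M\<^esub> (c \<odot>\<^bsub>M\<^esub> x)"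
proof -
  interpret H: abelian_subgroup H M by (rule submodule_abelian_subgroup[OF H])
  have "H +>\<^bsub>M\<^esub> (c \<odot>\<^bsub>M\<^esub> y) = H +>\<^bsub>M\<^esub> (c \<odot>\<^bsub>M\<^esub> x)" if y: "y \<in> H +>\<^bsub>M\<^esub> x" for y
  proof -
    obtain h where h: "h \<in> H" "y = h \<oplus>\<^bsub>M\<^esub> x"
      using y by (auto simp: a_r_coset_def')
    have [simp]: "h \<in> carrier M" using h by simp
    have "c \<odot>\<^bsub>M\<^esub> y \<ominus>\<^bsub>M\<^esub> c \<odot>\<^bsub>M\<^esub> x = c \<odot>\<^bsub>M\<^esub> h"
      using h c x by (simp add: smult_r_distr a_minus_def M.a_assoc M.r_neg)
    then show ?thesis
      using quot_module_coset_eq_iff[OF H] h c x submoduleE(4)[OF H c h(1)] by simp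
  qed
  then have "(\<Union>y\<in>H +>\<^bsub>M\<^esub> x. H +>\<^bsub>M\<^esub> (c \<odot>\<^bsub>M\<^esub> y)) = (\<Union>y\<in>H +>\<^bsub>M\<^esub> x. H +>\<^bsub>M\<^esub> (c \<odot>\<^bsub>M\<^esub> x))"
    by (intro SUP_cong) simp_all
  also have "\<dots> = H +>\<^bsub>M\<^esub> (c \<odot>\<^bsub>M\<^esub> x)"
    using H.a_rcos_self[OF x] by blast
  finally show ?thesis
    by (simp only: quot_module_simps)
qed

lemma quot_module_is_module:
  assumes H: "submodule H R M"
  shows "module R (quot_module M H)"
proof -
  interpret H: abelian_subgroup H M by (rule submodule_abelian_subgroup[OF H])
  note [simp] = quot_module_coset_add[OF H] quot_module_coset_smult[OF H]
    quot_module_coset_closed[OF H]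
  have z: "\<zero>\<^bsub>quot_module M H\<^esub> = H +>\<^bsub>M\<^esub> \<zero>\<^bsub>M\<^esub>"
    using H.a_subset by (simp add: quot_module_simps)
  show ?thesis
  proof (rule moduleI, rule R.is_cring, rule abelian_groupI)
    fix C assume "C \<in> carrier (quot_module M H)"
    then obtain x where x: "x \<in> carrier M" "C = H +>\<^bsub>M\<^esub> x" by (rule quot_module_carrierE)
    then show "\<exists>D\<in>carrier (quot_module M H). D \<oplus>\<^bsub>quot_module M H\<^esub> C = \<zero>\<^bsub>quot_module M H\<^esub>"
      by (intro bexI[of _ "H +>\<^bsub>M\<^esub> (\<ominus>\<^bsub>M\<^esub> x)"]) (simp_all add: z M.l_neg)
  next
    fix C D assume "C \<in> carrier (quot_module M H)" "D \<in> carrier (quot_module M H)"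
    then show "C \<oplus>\<^bsub>quot_module M H\<^esub> D \<in> carrier (quot_module M H)"
      by (elim quot_module_carrierE) simp
  next
    fix C D assume "C \<in> carrier (quot_module M H)" "D \<in> carrier (quot_module M H)"
    then show "C \<oplus>\<^bsub>quot_module M H\<^esub> D = D \<oplus>\<^bsub>quot_module M H\<^esub> C"
      by (elim quot_module_carrierE) (simp add: M.a_comm)
  next
    fix C D E
    assume "C \<in> carrier (quot_module M H)" "D \<in> carrier (quot_module M H)" "E \<in> carrier (quot_module M H)"
    then show "C \<oplus>\<^bsub>quot_module M H\<^esub> D \<oplus>\<^bsub>quot_module M H\<^esub> E =
        C \<oplus>\<^bsub>quot_module M H\<^esub> (D \<oplus>\<^bsub>quot_module M H\<^esub> E)"
      by (elim quot_module_carrierE) (simp add: M.a_assoc)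
  next
    show "\<zero>\<^bsub>quot_module M H\<^esub> \<in> carrier (quot_module M H)"
      by (simp add: z)
  next
    fix C assume "C \<in> carrier (quot_module M H)"
    then show "\<zero>\<^bsub>quot_module M H\<^esub> \<oplus>\<^bsub>quot_module M H\<^esub> C = C"
      by (elim quot_module_carrierE) (simp add: z)
  next
    fix c C assume "c \<in> carrier R" "C \<in> carrier (quot_module M H)"
    then show "c \<odot>\<^bsub>quot_module M H\<^esub> C \<in> carrier (quot_module M H)"
      by (elim quot_module_carrierE) simp
  next
    fix c d C assume "c \<in> carrier R" "d \<in> carrier R" "C \<in> carrier (quot_module M H)"
    then show "(c \<oplus> d) \<odot>\<^bsub>quot_module M H\<^esub> C =
        c \<odot>\<^bsub>quot_module M H\<^esub> C \<oplus>\<^bsub>quot_module M H\<^esub> d \<odot>\<^bsub>quot_module M H\<^esub> C"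
      by (elim quot_module_carrierE) (simp add: smult_l_distr)
  next
    fix c C D
    assume "c \<in> carrier R" "C \<in> carrier (quot_module M H)" "D \<in> carrier (quot_module M H)"
    then show "c \<odot>\<^bsub>quot_module M H\<^esub> (C \<oplus>\<^bsub>quot_module M H\<^esub> D) =
        c \<odot>\<^bsub>quot_module M H\<^esub> C \<oplus>\<^bsub>quot_module M H\<^esub> c \<odot>\<^bsub>quot_module M H\<^esub> D"
      by (elim quot_module_carrierE) (simp add: smult_r_distr)
  next
    fix c d C assume "c \<in> carrier R" "d \<in> carrier R" "C \<in> carrier (quot_module M H)"
    then show "(c \<otimes> d) \<odot>\<^bsub>quot_module M H\<^esub> C =
        c \<odot>\<^bsub>quot_module M H\<^esub> (d \<odot>\<^bsub>quot_module M H\<^esub> C)"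
      by (elim quot_module_carrierE) (simp add: smult_assoc1)
  next
    fix C assume "C \<in> carrier (quot_module M H)"
    then show "\<one> \<odot>\<^bsub>quot_module M H\<^esub> C = C"
      by (elim quot_module_carrierE) simp
  qed
qed

lemma submodule_hull:
  assumes "S \<subseteq> carrier M"
  shows "submodule ((\<lambda>H. submodule H R M) hull S) R M"
proof -
  have c: "submodule (carrier M) R M \<and> S \<subseteq> carrier M"
    using carrier_is_submodule assms by simp
  show ?thesis
  proof (rule submoduleI)
    show "(\<lambda>H. submodule H R M) hull S \<subseteq> carrier M"
      using c by (auto simp: hull_def)
    show "\<zero>\<^bsub>M\<^esub> \<in> (\<lambda>H. submodule H R M) hull S"
      unfolding hull_def
      by (blast intro: additive_subgroup.zero_closed abelian_subgroup.axioms(1) submodule_abelian_subgroup)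
  next
    fix a assume "a \<in> (\<lambda>H. submodule H R M) hull S"
    then show "\<ominus>\<^bsub>M\<^esub> a \<in> (\<lambda>H. submodule H R M) hull S"
      unfolding hull_def by (blast intro: submoduleE(3))
  next
    fix a b assume "a \<in> (\<lambda>H. submodule H R M) hull S" "b \<in> (\<lambda>H. submodule H R M) hull S"
    then show "a \<oplus>\<^bsub>M\<^esub> b \<in> (\<lambda>H. submodule H R M) hull S"
      unfolding hull_def by (blast intro: submoduleE(5))
  next
    fix c a assume "c \<in> carrier R" "a \<in> (\<lambda>H. submodule H R M) hull S"
    then show "c \<odot>\<^bsub>M\<^esub> a \<in> (\<lambda>H. submodule H R M) hull S"
      unfolding hull_def by (blast intro: submoduleE(4))
  qed
qed

end

lemma free_module_simps:
  "f \<in> carrier (free_module K I) \<longleftrightarrow>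
    (\<forall>i. f i \<in> carrier K) \<and> finite {i. f i \<noteq> \<zero>\<^bsub>K\<^esub>} \<and> {i. f i \<noteq> \<zero>\<^bsub>K\<^esub>} \<subseteq> I"
  "\<zero>\<^bsub>free_module K I\<^esub> = (\<lambda>i. \<zero>\<^bsub>K\<^esub>)"
  "f \<oplus>\<^bsub>free_module K I\<^esub> g = (\<lambda>i. f i \<oplus>\<^bsub>K\<^esub> g i)"
  "c \<odot>\<^bsub>free_module K I\<^esub> f = (\<lambda>i. c \<otimes>\<^bsub>K\<^esub> f i)"
  by (simp_all add: free_module_def)

lemma linear_mapsI:
  assumes "\<And>x. x \<in> carrier M \<Longrightarrow> f x \<in> carrier N"
    and "\<And>x y. x \<in> carrier M \<Longrightarrow> y \<in> carrier M \<Longrightarrow> f (x \<oplus>\<^bsub>M\<^esub> y) = f x \<oplus>\<^bsub>N\<^esub> f y"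
    and "\<And>c x. c \<in> carrier K \<Longrightarrow> x \<in> carrier M \<Longrightarrow> f (c \<odot>\<^bsub>M\<^esub> x) = c \<odot>\<^bsub>N\<^esub> f x"
  shows "f \<in> linear_maps K M N"
  using assms by (auto simp: linear_maps_def)

lemma linear_mapsD:
  assumes "f \<in> linear_maps K M N"
  shows "x \<in> carrier M \<Longrightarrow> f x \<in> carrier N"
    and "x \<in> carrier M \<Longrightarrow> y \<in> carrier M \<Longrightarrow> f (x \<oplus>\<^bsub>M\<^esub> y) = f x \<oplus>\<^bsub>N\<^esub> f y"
    and "c \<in> carrier K \<Longrightarrow> x \<in> carrier M \<Longrightarrow> f (c \<odot>\<^bsub>M\<^esub> x) = c \<odot>\<^bsub>N\<^esub> f x"
  using assms by (auto simp: linear_maps_def)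

lemma linear_map_ker_submodule:
  assumes "module K M" "module K N" and f: "f \<in> linear_maps K M N"
  shows "submodule {x \<in> carrier M. f x = \<zero>\<^bsub>N\<^esub>} K M"
proof -
  interpret M: module K M by fact
  interpret N: module K N by fact
  note f' = linear_mapsD[OF f]
  have z: "f \<zero>\<^bsub>M\<^esub> = \<zero>\<^bsub>N\<^esub>"
    using f'(2)[of "\<zero>\<^bsub>M\<^esub>" "\<zero>\<^bsub>M\<^esub>"] f'(1)[of "\<zero>\<^bsub>M\<^esub>"] by simp
  show ?thesis
  proof (rule M.submoduleI)
    fix a assume a: "a \<in> {x \<in> carrier M. f x = \<zero>\<^bsub>N\<^esub>}"
    have "f (\<ominus>\<^bsub>M\<^esub> a \<oplus>\<^bsub>M\<^esub> a) = f (\<ominus>\<^bsub>M\<^esub> a) \<oplus>\<^bsub>N\<^esub> f a"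
      using a by (intro f') auto
    then show "\<ominus>\<^bsub>M\<^esub> a \<in> {x \<in> carrier M. f x = \<zero>\<^bsub>N\<^esub>}"
      using a z f'(1)[of "\<ominus>\<^bsub>M\<^esub> a"] by (simp add: M.M.l_neg)
  qed (auto simp: f' z)
qed

lemma linear_map_minus:
  assumes "module K M" "module K N" and f: "f \<in> linear_maps K M N"
    and x: "x \<in> carrier M" and y: "y \<in> carrier M"
  shows "f (x \<ominus>\<^bsub>M\<^esub> y) = f x \<ominus>\<^bsub>N\<^esub> f y"
proof -
  interpret M: module K M by fact
  interpret N: module K N by fact
  note f' = linear_mapsD[OF f]
  have "f ((x \<ominus>\<^bsub>M\<^esub> y) \<oplus>\<^bsub>M\<^esub> y) = f (x \<ominus>\<^bsub>M\<^esub> y) \<oplus>\<^bsub>N\<^esub> f y"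
    using x y by (intro f') auto
  moreover have "(x \<ominus>\<^bsub>M\<^esub> y) \<oplus>\<^bsub>M\<^esub> y = x"
    using x y by (simp add: a_minus_def M.M.a_assoc M.M.l_neg)
  ultimately have "f x \<ominus>\<^bsub>N\<^esub> f y = f (x \<ominus>\<^bsub>M\<^esub> y) \<oplus>\<^bsub>N\<^esub> f y \<ominus>\<^bsub>N\<^esub> f y"
    by simp
  also have "\<dots> = f (x \<ominus>\<^bsub>M\<^esub> y)"
    using f'(1)[of "x \<ominus>\<^bsub>M\<^esub> y"] f'(1)[of y] x y by (simp add: a_minus_def N.M.a_assoc N.M.r_neg)
  finally show ?thesis by simp
qed

section \<open>Tensor products over the ground field\<close>

text \<open>
  The tensor product of \<open>M\<close> and \<open>N\<close> is the free module on \<open>carrier M \<times> carrier N\<close> modulo the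
  submodule generated by the bilinearity relations.
\<close>

type_synonym ('k, 'a, 'b) tensor = "('a \<times> 'b \<Rightarrow> 'k) set"

definition bilinear_rels ::
    "('k, 'x) ring_scheme \<Rightarrow> ('k, 'a, 'm) module_scheme \<Rightarrow> ('k, 'b, 'n) module_scheme \<Rightarrow> ('a \<times> 'b \<Rightarrow> 'k) set"
  where "bilinear_rels K M N = (let F = free_module K (carrier M \<times> carrier N); g = free_gen K in
      {g (x \<oplus>\<^bsub>M\<^esub> x', y) \<ominus>\<^bsub>F\<^esub> (g (x, y) \<oplus>\<^bsub>F\<^esub> g (x', y)) | x x' y.
          x \<in> carrier M \<and> x' \<in> carrier M \<and> y \<in> carrier N}
    \<union> {g (x, y \<oplus>\<^bsub>N\<^esub> y') \<ominus>\<^bsub>F\<^esub> (g (x, y) \<oplus>\<^bsub>F\<^esub> g (x, y')) | x y y'.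
          x \<in> carrier M \<and> y \<in> carrier N \<and> y' \<in> carrier N}
    \<union> {g (c \<odot>\<^bsub>M\<^esub> x, y) \<ominus>\<^bsub>F\<^esub> (c \<odot>\<^bsub>F\<^esub> g (x, y)) | c x y.
          c \<in> carrier K \<and> x \<in> carrier M \<and> y \<in> carrier N}
    \<union> {g (x, c \<odot>\<^bsub>N\<^esub> y) \<ominus>\<^bsub>F\<^esub> (c \<odot>\<^bsub>F\<^esub> g (x, y)) | c x y.
          c \<in> carrier K \<and> x \<in> carrier M \<and> y \<in> carrier N})"

definition tensor_rel ::
    "('k, 'x) ring_scheme \<Rightarrow> ('k, 'a, 'm) module_scheme \<Rightarrow> ('k, 'b, 'n) module_scheme \<Rightarrow> ('a \<times> 'b \<Rightarrow> 'k) set"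
  where "tensor_rel K M N =
    (\<lambda>H. submodule H K (free_module K (carrier M \<times> carrier N))) hull bilinear_rels K M N"

definition tensor_mod ::
    "('k, 'x) ring_scheme \<Rightarrow> ('k, 'a, 'm) module_scheme \<Rightarrow> ('k, 'b, 'n) module_scheme
      \<Rightarrow> ('k, ('k, 'a, 'b) tensor) module"
  where "tensor_mod K M N =
    quot_module (free_module K (carrier M \<times> carrier N)) (tensor_rel K M N)"

definition pure_tensor ::
    "('k, 'x) ring_scheme \<Rightarrow> ('k, 'a, 'm) module_scheme \<Rightarrow> ('k, 'b, 'n) module_scheme
      \<Rightarrow> 'a \<Rightarrow> 'b \<Rightarrow> ('k, 'a, 'b) tensor"
  where "pure_tensor K M N x y =
    tensor_rel K M N +>\<^bsub>free_module K (carrier M \<times> carrier N)\<^esub> free_gen K (x, y)"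

text \<open>
  \<open>tensor_lift K P \<beta>\<close> is the linear map from a tensor product to \<open>P\<close> induced by \<open>\<beta>\<close>, evaluated on an
  arbitrary representative.  It is only meaningful for bilinear \<open>\<beta>\<close>; the value is then independent of
  the representative (lemma \<open>module_pair.tensor_lift_coset\<close>).
\<close>

definition tensor_lift ::
    "('k, 'x) ring_scheme \<Rightarrow> ('k, 'c, 'p) module_scheme \<Rightarrow> ('a \<Rightarrow> 'b \<Rightarrow> 'c) \<Rightarrow> ('k, 'a, 'b) tensor \<Rightarrow> 'c"
  where "tensor_lift K P \<beta> t = (let f = (SOME f. f \<in> t) in
    (\<Oplus>\<^bsub>P\<^esub>p \<in> {p. f p \<noteq> \<zero>\<^bsub>K\<^esub>}. f p \<odot>\<^bsub>P\<^esub> \<beta> (fst p) (snd p)))"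

definition bilinear_maps ::
    "('k, 'x) ring_scheme \<Rightarrow> ('k, 'a, 'm) module_scheme \<Rightarrow> ('k, 'b, 'n) module_scheme
      \<Rightarrow> ('k, 'c, 'p) module_scheme \<Rightarrow> ('a \<Rightarrow> 'b \<Rightarrow> 'c) set"
  where "bilinear_maps K M N P =
    {\<beta>. (\<forall>x \<in> carrier M. \<beta> x \<in> linear_maps K N P) \<and>
        (\<forall>y \<in> carrier N. (\<lambda>x. \<beta> x y) \<in> linear_maps K M P)}"

locale module_pair = M: module K M + N: module K N
  for K (structure) and M (structure) and N (structure)
begin

abbreviation "F \<equiv> free_module K (carrier M \<times> carrier N)"

sublocale F: module K F
  by (rule M.R.free_module_is_module)

lemma bilinear_rels_subset: "bilinear_rels K M N \<subseteq> carrier F"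
  unfolding bilinear_rels_def Let_def
  by (auto intro!: F.M.minus_closed F.M.a_closed F.smult_closed M.R.free_gen_closed)

lemma tensor_rel_submodule: "submodule (tensor_rel K M N) K F"
  unfolding tensor_rel_def by (rule F.submodule_hull[OF bilinear_rels_subset])

lemma tensor_mod_is_module: "module K (tensor_mod K M N)"
  unfolding tensor_mod_def by (rule F.quot_module_is_module[OF tensor_rel_submodule])

lemma pure_tensor_closed:
  "x \<in> carrier M \<Longrightarrow> y \<in> carrier N \<Longrightarrow> pure_tensor K M N x y \<in> carrier (tensor_mod K M N)"
  unfolding tensor_mod_def pure_tensor_def
  by (rule F.quot_module_coset_closed[OF tensor_rel_submodule]) (simp add: M.R.free_gen_closed)

lemma pure_tensor_bilinear:
  "pure_tensor K M N \<in> bilinear_maps K M N (tensor_mod K M N)"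
proof -
  let ?g = "\<lambda>x y. free_gen K (x, y)"
  note sub = tensor_rel_submodule
  have rel: "r \<in> bilinear_rels K M N \<Longrightarrow> r \<in> tensor_rel K M N" for r
    unfolding tensor_rel_def by (rule hull_inc)
  have g: "?g x y \<in> carrier F" if "x \<in> carrier M" "y \<in> carrier N" for x y
    using that by (simp add: M.R.free_gen_closed)
  have add: "tensor_rel K M N +>\<^bsub>F\<^esub> u = (tensor_rel K M N +>\<^bsub>F\<^esub> v) \<oplus>\<^bsub>tensor_mod K M N\<^esub> (tensor_rel K M N +>\<^bsub>F\<^esub> w)"
    if "u \<in> carrier F" "v \<in> carrier F" "w \<in> carrier F"
      "u \<ominus>\<^bsub>F\<^esub> (v \<oplus>\<^bsub>F\<^esub> w) \<in> bilinear_rels K M N" for u v w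
    unfolding tensor_mod_def F.quot_module_coset_add[OF sub that(2,3)]
    by (subst F.quot_module_coset_eq_iff[OF sub]) (use that rel in auto)
  have smult: "tensor_rel K M N +>\<^bsub>F\<^esub> u = c \<odot>\<^bsub>tensor_mod K M N\<^esub> (tensor_rel K M N +>\<^bsub>F\<^esub> v)"
    if "c \<in> carrier K" "u \<in> carrier F" "v \<in> carrier F"
      "u \<ominus>\<^bsub>F\<^esub> (c \<odot>\<^bsub>F\<^esub> v) \<in> bilinear_rels K M N" for u v c
    unfolding tensor_mod_def F.quot_module_coset_smult[OF sub that(1,3)]
    by (subst F.quot_module_coset_eq_iff[OF sub]) (use that rel in auto)
  show ?thesis
    unfolding bilinear_maps_def
  proof (intro CollectI conjI ballI linear_mapsI pure_tensor_closed)
    fix x y z assume *: "x \<in> carrier M" "y \<in> carrier N" "z \<in> carrier N"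
    then show "pure_tensor K M N x (y \<oplus>\<^bsub>N\<^esub> z) =
        pure_tensor K M N x y \<oplus>\<^bsub>tensor_mod K M N\<^esub> pure_tensor K M N x z"
      unfolding pure_tensor_def by (intro add g) (auto simp: bilinear_rels_def Let_def)
  next
    fix x z y assume *: "y \<in> carrier N" "x \<in> carrier M" "z \<in> carrier M"
    then show "pure_tensor K M N (x \<oplus>\<^bsub>M\<^esub> z) y =
        pure_tensor K M N x y \<oplus>\<^bsub>tensor_mod K M N\<^esub> pure_tensor K M N z y"
      unfolding pure_tensor_def by (intro add g) (auto simp: bilinear_rels_def Let_def)
  next
    fix x c y assume *: "x \<in> carrier M" "c \<in> carrier K" "y \<in> carrier N"
    then show "pure_tensor K M N x (c \<odot>\<^bsub>N\<^esub> y) =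
        c \<odot>\<^bsub>tensor_mod K M N\<^esub> pure_tensor K M N x y"
      unfolding pure_tensor_def by (intro smult g) (auto simp: bilinear_rels_def Let_def)
  next
    fix y c x assume *: "y \<in> carrier N" "c \<in> carrier K" "x \<in> carrier M"
    then show "pure_tensor K M N (c \<odot>\<^bsub>M\<^esub> x) y =
        c \<odot>\<^bsub>tensor_mod K M N\<^esub> pure_tensor K M N x y"
      unfolding pure_tensor_def by (intro smult g) (auto simp: bilinear_rels_def Let_def)
  qed
qed

context
  fixes P (structure) and \<beta>
  assumes P: "module K P" and \<beta>: "\<beta> \<in> bilinear_maps K M N P"
begin

interpretation P: module K P by (rule P)

definition ev where "ev f = (\<Oplus>\<^bsub>P\<^esub>p \<in> {p. f p \<noteq> \<zero>\<^bsub>K\<^esub>}. f p \<odot>\<^bsub>P\<^esub> \<beta> (fst p) (snd p))"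

lemma \<beta>_closed: "x \<in> carrier M \<Longrightarrow> y \<in> carrier N \<Longrightarrow> \<beta> x y \<in> carrier P"
  using \<beta> by (auto simp: bilinear_maps_def linear_maps_def)

lemma ev_superset:
  assumes f: "f \<in> carrier F" and A: "finite A" "{p. f p \<noteq> \<zero>\<^bsub>K\<^esub>} \<subseteq> A" "A \<subseteq> carrier M \<times> carrier N"
  shows "ev f = (\<Oplus>\<^bsub>P\<^esub>p \<in> A. f p \<odot>\<^bsub>P\<^esub> \<beta> (fst p) (snd p))"
  unfolding ev_def
  by (rule P.M.add.finprod_mono_neutral_cong_left)
     (use f A in \<open>auto simp: free_module_simps \<beta>_closed\<close>)

lemma ev_linear: "ev \<in> linear_maps K F P"
proof (rule linear_mapsI)
  fix f assume "f \<in> carrier F"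
  then show "ev f \<in> carrier P"
    unfolding ev_def by (intro P.M.finsum_closed) (auto simp: free_module_simps \<beta>_closed)
next
  fix f g assume fg: "f \<in> carrier F" "g \<in> carrier F"
  define A where "A = {p. f p \<noteq> \<zero>\<^bsub>K\<^esub>} \<union> {p. g p \<noteq> \<zero>\<^bsub>K\<^esub>}"
  have A: "finite A" "A \<subseteq> carrier M \<times> carrier N"
    using fg by (auto simp: A_def free_module_simps)
  have "ev (f \<oplus>\<^bsub>F\<^esub> g) = (\<Oplus>\<^bsub>P\<^esub>p \<in> A. (f \<oplus>\<^bsub>F\<^esub> g) p \<odot>\<^bsub>P\<^esub> \<beta> (fst p) (snd p))"
    using fg F.M.a_closed[OF fg] by (intro ev_superset A) (auto simp: A_def free_module_simps(2-))
  also have "\<dots> = (\<Oplus>\<^bsub>P\<^esub>p \<in> A. f p \<odot>\<^bsub>P\<^esub> \<beta> (fst p) (snd p) \<oplus>\<^bsub>P\<^esub> g p \<odot>\<^bsub>P\<^esub> \<beta> (fst p) (snd p))"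
    by (intro P.M.finsum_cong')
       (use fg A in \<open>auto simp: free_module_simps \<beta>_closed P.smult_l_distr\<close>)
  also have "\<dots> = (\<Oplus>\<^bsub>P\<^esub>p \<in> A. f p \<odot>\<^bsub>P\<^esub> \<beta> (fst p) (snd p)) \<oplus>\<^bsub>P\<^esub> (\<Oplus>\<^bsub>P\<^esub>p \<in> A. g p \<odot>\<^bsub>P\<^esub> \<beta> (fst p) (snd p))"
    by (intro P.M.finsum_addf) (use fg A in \<open>auto simp: free_module_simps \<beta>_closed\<close>)
  also have "\<dots> = ev f \<oplus>\<^bsub>P\<^esub> ev g"
    using fg A by (simp add: ev_superset[of _ A] A_def)
  finally show "ev (f \<oplus>\<^bsub>F\<^esub> g) = ev f \<oplus>\<^bsub>P\<^esub> ev g" .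
next
  fix c f assume cf: "c \<in> carrier K" "f \<in> carrier F"
  define A where "A = {p. f p \<noteq> \<zero>\<^bsub>K\<^esub>}"
  have A: "finite A" "A \<subseteq> carrier M \<times> carrier N"
    using cf by (auto simp: A_def free_module_simps)
  have "ev (c \<odot>\<^bsub>F\<^esub> f) = (\<Oplus>\<^bsub>P\<^esub>p \<in> A. (c \<odot>\<^bsub>F\<^esub> f) p \<odot>\<^bsub>P\<^esub> \<beta> (fst p) (snd p))"
    using cf F.smult_closed[OF cf] by (intro ev_superset A) (auto simp: A_def free_module_simps(2-))
  also have "\<dots> = (\<Oplus>\<^bsub>P\<^esub>p \<in> A. c \<odot>\<^bsub>P\<^esub> (f p \<odot>\<^bsub>P\<^esub> \<beta> (fst p) (snd p)))"
    by (intro P.M.finsum_cong')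
       (use cf A in \<open>auto simp: free_module_simps \<beta>_closed P.smult_assoc1\<close>)
  also have "\<dots> = c \<odot>\<^bsub>P\<^esub> ev f"
    unfolding ev_def A_def[symmetric]
    by (intro P.finsum_smult_ldistr[symmetric])
       (use cf A in \<open>auto simp: free_module_simps \<beta>_closed\<close>)
  finally show "ev (c \<odot>\<^bsub>F\<^esub> f) = c \<odot>\<^bsub>P\<^esub> ev f" .
qed

lemma ev_gen: "x \<in> carrier M \<Longrightarrow> y \<in> carrier N \<Longrightarrow> ev (free_gen K (x, y)) = \<beta> x y"
proof -
  assume xy: "x \<in> carrier M" "y \<in> carrier N"
  have "{p. free_gen K (x, y) p \<noteq> \<zero>\<^bsub>K\<^esub>} \<subseteq> {(x, y)}"
    by (auto simp: free_gen_def split: if_splits)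
  then have "ev (free_gen K (x, y)) =
      (\<Oplus>\<^bsub>P\<^esub>p \<in> {(x, y)}. free_gen K (x, y) p \<odot>\<^bsub>P\<^esub> \<beta> (fst p) (snd p))"
    using xy by (intro ev_superset) (auto simp: M.R.free_gen_closed)
  also have "\<dots> = \<beta> x y"
    using xy by (simp add: free_gen_def \<beta>_closed)
  finally show ?thesis .
qed

lemma ev_tensor_rel: "r \<in> tensor_rel K M N \<Longrightarrow> ev r = \<zero>\<^bsub>P\<^esub>"
proof -
  have g: "free_gen K (x, y) \<in> carrier F" if "x \<in> carrier M" "y \<in> carrier N" for x y
    using that by (simp add: M.R.free_gen_closed)
  note e = linear_mapsD[OF ev_linear]
  note m = linear_map_minus[OF F.module_axioms P ev_linear]
  have lin: "x \<in> carrier M \<Longrightarrow> \<beta> x \<in> linear_maps K N P"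
    "y \<in> carrier N \<Longrightarrow> (\<lambda>x. \<beta> x y) \<in> linear_maps K M P" for x y
    using \<beta> by (auto simp: bilinear_maps_def)
  have minus: "u \<ominus>\<^bsub>P\<^esub> u = \<zero>\<^bsub>P\<^esub>" if "u \<in> carrier P" for u
    using that by (simp add: a_minus_def P.M.r_neg)
  have "ev r = \<zero>\<^bsub>P\<^esub>" if "r \<in> bilinear_rels K M N" for r
    using that
    by (auto simp: bilinear_rels_def Let_def m e g ev_gen linear_mapsD[OF lin(1)]
        linear_mapsD[OF lin(2)] \<beta>_closed minus)
  then have "bilinear_rels K M N \<subseteq> {f \<in> carrier F. ev f = \<zero>\<^bsub>P\<^esub>}"
    using bilinear_rels_subset by auto
  then have "tensor_rel K M N \<subseteq> {f \<in> carrier F. ev f = \<zero>\<^bsub>P\<^esub>}"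
    unfolding tensor_rel_def
    by (intro hull_minimal linear_map_ker_submodule F.module_axioms P ev_linear)
  then show "r \<in> tensor_rel K M N \<Longrightarrow> ev r = \<zero>\<^bsub>P\<^esub>" by auto
qed

lemma tensor_lift_coset:
  assumes f: "f \<in> carrier F"
  shows "tensor_lift K P \<beta> (tensor_rel K M N +>\<^bsub>F\<^esub> f) =
    (\<Oplus>\<^bsub>P\<^esub>p \<in> {p. f p \<noteq> \<zero>\<^bsub>K\<^esub>}. f p \<odot>\<^bsub>P\<^esub> \<beta> (fst p) (snd p))"
proof -
  interpret T: abelian_subgroup "tensor_rel K M N" F
    by (rule F.submodule_abelian_subgroup[OF tensor_rel_submodule])
  define g where "g = (SOME g. g \<in> tensor_rel K M N +>\<^bsub>F\<^esub> f)"
  have "g \<in> tensor_rel K M N +>\<^bsub>F\<^esub> f"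
    unfolding g_def by (metis (full_types) T.a_rcos_self[OF f] someI_ex)
  then obtain r where r: "r \<in> tensor_rel K M N" "g = r \<oplus>\<^bsub>F\<^esub> f"
    by (auto simp: a_r_coset_def')
  then have "ev g = ev r \<oplus>\<^bsub>P\<^esub> ev f"
    using f by (simp add: linear_mapsD[OF ev_linear])
  also have "\<dots> = ev f"
    using f r by (simp add: ev_tensor_rel linear_mapsD[OF ev_linear])
  finally show ?thesis
    by (simp add: tensor_lift_def Let_def g_def[symmetric] ev_def)
qed

lemma tensor_lift_pure:
  "x \<in> carrier M \<Longrightarrow> y \<in> carrier N \<Longrightarrow> tensor_lift K P \<beta> (pure_tensor K M N x y) = \<beta> x y"
  unfolding pure_tensor_def
  by (subst tensor_lift_coset) (simp_all add: M.R.free_gen_closed ev_gen[unfolded ev_def])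

lemma tensor_lift_linear: "tensor_lift K P \<beta> \<in> linear_maps K (tensor_mod K M N) P"
proof -
  note sub = tensor_rel_submodule
  have *: "tensor_lift K P \<beta> (tensor_rel K M N +>\<^bsub>F\<^esub> f) = ev f" if "f \<in> carrier F" for f
    using tensor_lift_coset[OF that] by (simp add: ev_def)
  show ?thesis
    unfolding tensor_mod_def
    by (rule linear_mapsI; (elim F.quot_module_carrierE)?)
       (auto simp: F.quot_module_coset_add[OF sub] F.quot_module_coset_smult[OF sub] *
         linear_mapsD[OF ev_linear] elim!: F.quot_module_carrierE)
qed

end

end

text \<open>
  The tensor product with its componentwise multiplication \<open>(x \<otimes> y) (x' \<otimes> y') = x x' \<otimes> y y'\<close>.
\<close>

definition tensor ::
    "('k, 'x) ring_scheme \<Rightarrow> ('k, 'a, 'm) module_scheme \<Rightarrow> ('k, 'b, 'n) module_scheme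
      \<Rightarrow> ('k, ('k, 'a, 'b) tensor) module"
  where "tensor K A B = (tensor_mod K A B)
    \<lparr>monoid.mult := (\<lambda>s t. tensor_lift K (tensor_mod K A B) (\<lambda>x y.
                     tensor_lift K (tensor_mod K A B) (\<lambda>x' y'.
                       pure_tensor K A B (x \<otimes>\<^bsub>A\<^esub> x') (y \<otimes>\<^bsub>B\<^esub> y')) t) s),
     one := pure_tensor K A B \<one>\<^bsub>A\<^esub> \<one>\<^bsub>B\<^esub>\<rparr>"

text \<open>\<open>tensor_map K M' N' f g\<close> is \<open>f \<otimes> g\<close>, where \<open>M'\<close> and \<open>N'\<close> are the targets of \<open>f\<close> and \<open>g\<close>.\<close>

definition tensor_map ::
    "('k, 'x) ring_scheme \<Rightarrow> ('k, 'c, 'm) module_scheme \<Rightarrow> ('k, 'd, 'n) module_scheme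
      \<Rightarrow> ('a \<Rightarrow> 'c) \<Rightarrow> ('b \<Rightarrow> 'd) \<Rightarrow> ('k, 'a, 'b) tensor \<Rightarrow> ('k, 'c, 'd) tensor"
  where "tensor_map K M' N' f g =
    tensor_lift K (tensor K M' N') (\<lambda>x y. pure_tensor K M' N' (f x) (g y))"

definition tensor_swap ::
    "('k, 'x) ring_scheme \<Rightarrow> ('k, 'a, 'm) module_scheme \<Rightarrow> ('k, 'b, 'n) module_scheme
      \<Rightarrow> ('k, 'a, 'b) tensor \<Rightarrow> ('k, 'b, 'a) tensor"
  where "tensor_swap K M N =
    tensor_lift K (tensor K N M) (\<lambda>x y. pure_tensor K N M y x)"

text \<open>The associator \<open>(L \<otimes> M) \<otimes> N \<rightarrow> L \<otimes> (M \<otimes> N)\<close>.\<close>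

definition tensor_assoc ::
    "('k, 'x) ring_scheme \<Rightarrow> ('k, 'a, 'l) module_scheme \<Rightarrow> ('k, 'b, 'm) module_scheme
      \<Rightarrow> ('k, 'c, 'n) module_scheme
      \<Rightarrow> ('k, ('k, 'a, 'b) tensor, 'c) tensor \<Rightarrow> ('k, 'a, ('k, 'b, 'c) tensor) tensor"
  where "tensor_assoc K L M N =
    tensor_lift K (tensor K L (tensor K M N)) (\<lambda>u z.
      tensor_lift K (tensor K L (tensor K M N)) (\<lambda>x y.
        pure_tensor K L (tensor K M N) x (pure_tensor K M N y z)) u)"


section \<open>Hopf algebras\<close>

text \<open>The locale \<open>algebra\<close> of HOL-Algebra is restricted to commutative algebras.\<close>

locale assoc_algebra = module K A + A?: ring A for K (structure) and A (structure) +
  assumes smult_mult_left: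
      "\<lbrakk>c \<in> carrier K; x \<in> carrier A; y \<in> carrier A\<rbrakk> \<Longrightarrow>
        (c \<odot>\<^bsub>A\<^esub> x) \<otimes>\<^bsub>A\<^esub> y = c \<odot>\<^bsub>A\<^esub> (x \<otimes>\<^bsub>A\<^esub> y)"
    and smult_mult_right:
      "\<lbrakk>c \<in> carrier K; x \<in> carrier A; y \<in> carrier A\<rbrakk> \<Longrightarrow>
        x \<otimes>\<^bsub>A\<^esub> (c \<odot>\<^bsub>A\<^esub> y) = c \<odot>\<^bsub>A\<^esub> (x \<otimes>\<^bsub>A\<^esub> y)"

record ('k, 'a) hopf = "('k, 'a) module" +
  comult :: "'a \<Rightarrow> ('k, 'a, 'a) tensor"
  counit :: "'a \<Rightarrow> 'k"
  antipode :: "'a \<Rightarrow> 'a"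

locale hopf_algebra = field K + assoc_algebra K A
  for K :: "('k, 'x) ring_scheme" (structure) and A :: "('k, 'a) hopf" (structure) +
  assumes comult_ring_hom: "comult A \<in> ring_hom A (tensor K A A)"
    and comult_linear: "comult A \<in> linear_maps K A (tensor K A A)"
    and counit_ring_hom: "counit A \<in> ring_hom A K"
    and counit_smult:
      "\<lbrakk>c \<in> carrier K; x \<in> carrier A\<rbrakk> \<Longrightarrow> counit A (c \<odot>\<^bsub>A\<^esub> x) = c \<otimes>\<^bsub>K\<^esub> counit A x"
    and antipode_linear: "antipode A \<in> linear_maps K A A"
    and coassoc:
      "x \<in> carrier A \<Longrightarrow>
        tensor_assoc K A A A (tensor_map K (tensor K A A) A (comult A) (\<lambda>y. y) (comult A x)) =
        tensor_map K A (tensor K A A) (\<lambda>y. y) (comult A) (comult A x)"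
    and counit_left:
      "x \<in> carrier A \<Longrightarrow> tensor_lift K A (\<lambda>y z. counit A y \<odot>\<^bsub>A\<^esub> z) (comult A x) = x"
    and counit_right:
      "x \<in> carrier A \<Longrightarrow> tensor_lift K A (\<lambda>y z. counit A z \<odot>\<^bsub>A\<^esub> y) (comult A x) = x"
    and antipode_left:
      "x \<in> carrier A \<Longrightarrow>
        tensor_lift K A (\<lambda>y z. antipode A y \<otimes>\<^bsub>A\<^esub> z) (comult A x) = counit A x \<odot>\<^bsub>A\<^esub> \<one>\<^bsub>A\<^esub>"
    and antipode_right:
      "x \<in> carrier A \<Longrightarrow>
        tensor_lift K A (\<lambda>y z. y \<otimes>\<^bsub>A\<^esub> antipode A z) (comult A x) = counit A x \<odot>\<^bsub>A\<^esub> \<one>\<^bsub>A\<^esub>"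

definition hopf_hom ::
    "('k, 'x) ring_scheme \<Rightarrow> ('k, 'a) hopf \<Rightarrow> ('k, 'b) hopf \<Rightarrow> ('a \<Rightarrow> 'b) set"
  where "hopf_hom K A B =
    {f \<in> ring_hom A B \<inter> linear_maps K A B.
      (\<forall>x \<in> carrier A. comult B (f x) = tensor_map K B B f f (comult A x)) \<and>
      (\<forall>x \<in> carrier A. counit B (f x) = counit A x) \<and>
      (\<forall>x \<in> carrier A. antipode B (f x) = f (antipode A x))}"


section \<open>Cocentral morphisms, the Hopf cocenter, exact sequences\<close>

definition cocentral ::
    "('k, 'x) ring_scheme \<Rightarrow> ('k, 'a) hopf \<Rightarrow> ('k, 'b) hopf \<Rightarrow> ('a \<Rightarrow> 'b) \<Rightarrow> bool"
  where "cocentral K A B \<pi> \<longleftrightarrow>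
    (\<forall>x \<in> carrier A. tensor_map K A B (\<lambda>y. y) \<pi> (comult A x) =
                     tensor_map K A B (\<lambda>y. y) \<pi> (tensor_swap K A A (comult A x)))"

text \<open>
  HOL cannot quantify over the type of the test objects \<open>B\<close>.  The universal property is required for
  all \<open>B\<close> with elements of type \<open>'a set\<close>, where \<open>'a\<close> is the type of elements of \<open>A\<close>.  This is the full
  universal property: a cocentral morphism factors through its image, a quotient of \<open>A\<close>, which has
  an isomorphic copy consisting of cosets in \<open>A\<close>; uniqueness follows from surjectivity of \<open>q\<close>.
  Factorizations are taken in \<open>\<rightarrow>\<^sub>E\<close> because their values outside the carrier are irrelevant.
\<close>

definition hopf_cocenter ::
    "('k, 'x) ring_scheme \<Rightarrow> ('k, 'a) hopf \<Rightarrow> ('k, 'h) hopf \<Rightarrow> ('a \<Rightarrow> 'h) \<Rightarrow> bool"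
  where "hopf_cocenter K A H q \<longleftrightarrow>
    hopf_algebra K H \<and> q \<in> hopf_hom K A H \<and> q ` carrier A = carrier H \<and> cocentral K A H q \<and>
    (\<forall>(B :: ('k, 'a set) hopf) f.
      hopf_algebra K B \<and> f \<in> hopf_hom K A B \<and> cocentral K A B f \<longrightarrow>
      (\<exists>!g. g \<in> (carrier H \<rightarrow>\<^sub>E carrier B) \<inter> hopf_hom K H B \<and> (\<forall>x \<in> carrier A. g (q x) = f x)))"

text \<open>
  \<open>L \<cdot>\<^bsub>L\<^esub> S\<close> is the set of finite sums of products \<open>l s\<close>, i.e. the left ideal \<open>L S\<close>.
\<close>

definition hopf_exact ::
    "('k, 'x) ring_scheme \<Rightarrow> ('k, 'c) hopf \<Rightarrow> ('k, 'a) hopf \<Rightarrow> ('k, 'b) hopf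
      \<Rightarrow> ('c \<Rightarrow> 'a) \<Rightarrow> ('a \<Rightarrow> 'b) \<Rightarrow> bool"
  where "hopf_exact K H L Q \<iota> \<pi> \<longleftrightarrow>
    hopf_algebra K H \<and> hopf_algebra K L \<and> hopf_algebra K Q \<and>
    \<iota> \<in> hopf_hom K H L \<and> \<pi> \<in> hopf_hom K L Q \<and>
    inj_on \<iota> (carrier H) \<and>
    \<pi> ` carrier L = carrier Q \<and>
    a_kernel L Q \<pi> = carrier L \<cdot>\<^bsub>L\<^esub> (\<iota> ` carrier H \<inter> {x \<in> carrier L. counit L x = \<zero>\<^bsub>K\<^esub>}) \<and>
    \<iota> ` carrier H =
      {x \<in> carrier L. tensor_map K Q L \<pi> (\<lambda>y. y) (comult L x) = pure_tensor K Q L \<one>\<^bsub>Q\<^esub> x}"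

end

theory Submission
  imports Defs
begin

text \<open>
  Let \<open>\<pi> : A \<rightarrow> Q\<close> be cocentral and let \<open>C\<close> be its coinvariants.  Left and right coinvariants agree, so \<open>C\<close>
  is a Hopf subalgebra, and it is stable under the adjoint action \<open>S x\<^sub>1 c x\<^sub>2\<close>; hence \<open>J = A C\<^sup>+\<close> is
  a Hopf ideal.  It is contained in the kernel of \<open>\<pi>\<close>.  Conversely, \<open>x\<^sub>2 \<otimes> S x\<^sub>1 x\<^sub>3\<close> lies in \<open>A \<otimes> C\<close> by
  cocentrality, and multiplying its second leg by \<open>x\<^sub>1\<close> on the left shows that
  \<open>x\<^sub>1 \<otimes> x\<^sub>2 - x\<^sub>2 \<otimes> x\<^sub>1\<close> lies in \<open>A \<otimes> J\<close>.  So \<open>A \<rightarrow> A / J\<close> is cocentral; if \<open>\<pi>\<close> is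
  universal, this quotient map factors through \<open>\<pi>\<close>, which gives \<open>ker \<pi> \<subseteq> J\<close>.
\<close>

section \<open>Linear maps and tensor products\<close>

text \<open>The difficulty is to give meaning to a tensor lying in A \<otimes> C: tensors are cosets
  of formal sums, so A \<otimes> C is not a subset of A \<otimes> A. Over a field the kernel C of a
  linear map is the image of a linear projection \<open>pr\<close>, and a tensor counts as lying in
  A \<otimes> C when id \<otimes> \<open>pr\<close> fixes it. A generalized inverse of
  \<open>coact\<close> gives \<open>pr\<close> the form identity minus
  \<open>coact_inv \<circ> coact\<close>, so it suffices that id \<otimes> \<open>coact\<close>
  annihilates the tensor. This is the exactness of A \<otimes> - in usable form; the annihilation
  itself is checked with Sweedler sums.

  Identities in tensor powers are tested by multilinear maps into an arbitrary module, which turns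
  them into identities between iterated Sweedler sums. That the antipode reverses products and
  coproducts is not an axiom here, yet the normality of C and the stability of J under
  \<open>S\<close> rest on it, so it is derived. Universality is applied to a single test object, A
  / J, whose elements are cosets and thus have the type \<open>'a set\<close> over which
  \<open>hopf_cocenter\<close> quantifies.\<close>

named_theorems lin_intros

lemma linear_maps_id [lin_intros]: "(\<lambda>x. x) \<in> linear_maps K M M"
  by (auto intro: linear_mapsI)

lemma linear_maps_comp:
  "f \<in> linear_maps K M N \<Longrightarrow> g \<in> linear_maps K N P \<Longrightarrow> (\<lambda>x. g (f x)) \<in> linear_maps K M P"
  by (auto simp: linear_maps_def Pi_def)

lemma (in module) linear_maps_cong:
  assumes "\<And>x. x \<in> carrier M \<Longrightarrow> f x = g x"
  shows "f \<in> linear_maps R M N \<longleftrightarrow> g \<in> linear_maps R M N"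
  using assms by (auto simp: linear_maps_def Pi_def)

lemma linear_map_zero:
  assumes "module K M" "module K N" "f \<in> linear_maps K M N"
  shows "f \<zero>\<^bsub>M\<^esub> = \<zero>\<^bsub>N\<^esub>"
proof -
  interpret M: module K M by fact
  interpret N: module K N by fact
  show ?thesis
    using linear_mapsD(3)[OF assms(3), of "\<zero>\<^bsub>K\<^esub>" "\<zero>\<^bsub>M\<^esub>"] linear_mapsD(1)[OF assms(3), of "\<zero>\<^bsub>M\<^esub>"] by simp
qed

text \<open>The \<open>lin_intros\<close> rules are directed by syntax: multilinearity splits into
  linearity in each slot, stated for lambda terms, and the remaining rules peel off one operation at
  a time until a bare variable is reached.\<close>

lemma bilinear_mapsI [lin_intros]:
  assumes "\<And>x. x \<in> carrier M \<Longrightarrow> (\<lambda>y. \<beta> x y) \<in> linear_maps K N P"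
    and "\<And>y. y \<in> carrier N \<Longrightarrow> (\<lambda>x. \<beta> x y) \<in> linear_maps K M P"
  shows "\<beta> \<in> bilinear_maps K M N P"
  using assms by (simp add: bilinear_maps_def)

lemma bilinear_mapsD:
  assumes "\<beta> \<in> bilinear_maps K M N P"
  shows "x \<in> carrier M \<Longrightarrow> (\<lambda>y. \<beta> x y) \<in> linear_maps K N P"
    and "y \<in> carrier N \<Longrightarrow> (\<lambda>x. \<beta> x y) \<in> linear_maps K M P"
    and "x \<in> carrier M \<Longrightarrow> y \<in> carrier N \<Longrightarrow> \<beta> x y \<in> carrier P"
  using assms by (auto simp: bilinear_maps_def linear_maps_def)

lemma bilinear_maps_lin:
  assumes "\<beta> \<in> bilinear_maps K M N P"
  shows "f \<in> linear_maps K Z M \<Longrightarrow> y \<in> carrier N \<Longrightarrow> (\<lambda>x. \<beta> (f x) y) \<in> linear_maps K Z P"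
    and "x \<in> carrier M \<Longrightarrow> g \<in> linear_maps K Z N \<Longrightarrow> (\<lambda>y. \<beta> x (g y)) \<in> linear_maps K Z P"
  using assms by (auto simp: bilinear_maps_def linear_maps_def Pi_def)

lemma bilinear_maps_comp:
  "\<beta> \<in> bilinear_maps K M N P \<Longrightarrow> f \<in> linear_maps K P R \<Longrightarrow> (\<lambda>x y. f (\<beta> x y)) \<in> bilinear_maps K M N R"
  by (auto simp: bilinear_maps_def intro: linear_maps_comp)

lemma (in module) smult_lin [lin_intros]:
  "c \<in> carrier R \<Longrightarrow> f \<in> linear_maps R Z M \<Longrightarrow> (\<lambda>x. c \<odot>\<^bsub>M\<^esub> f x) \<in> linear_maps R Z M"
  by (auto simp: linear_maps_def Pi_def smult_r_distr smult_assoc1[symmetric] R.m_comm)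

lemma (in module) add_lin [lin_intros]:
  "f \<in> linear_maps R Z M \<Longrightarrow> g \<in> linear_maps R Z M \<Longrightarrow> (\<lambda>x. f x \<oplus>\<^bsub>M\<^esub> g x) \<in> linear_maps R Z M"
  by (auto simp: linear_maps_def Pi_def smult_r_distr M.a_ac)

lemma (in module) minus_lin [lin_intros]:
  assumes f: "f \<in> linear_maps R Z M" and g: "g \<in> linear_maps R Z M"
  shows "(\<lambda>x. f x \<ominus>\<^bsub>M\<^esub> g x) \<in> linear_maps R Z M"
  by (rule linear_mapsI)
    (simp_all add: linear_mapsD[OF f] linear_mapsD[OF g] a_minus_def smult_r_distr M.a_ac M.minus_add
      smult_r_minus)

lemma (in module) zero_lin [lin_intros]: "(\<lambda>x. \<zero>\<^bsub>M\<^esub>) \<in> linear_maps R Z M"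
  by (auto simp: linear_maps_def)

text \<open>The finite set \<open>S\<close> may exceed the support, so that induction can strip one
  generator at a time. Together with the description of tensors as cosets this is the source of all
  extensionality for linear maps on tensor products.\<close>

lemma free_module_span:
  assumes P: "module K P" and g: "g \<in> linear_maps K (free_module K I) P"
    and S: "finite S" "S \<subseteq> I"
    and h: "h \<in> carrier (free_module K I)" "{i. h i \<noteq> \<zero>\<^bsub>K\<^esub>} \<subseteq> S"
  shows "g h = (\<Oplus>\<^bsub>P\<^esub>p \<in> S. h p \<odot>\<^bsub>P\<^esub> g (free_gen K p))"
proof -
  interpret P: module K P by fact
  interpret F: module K "free_module K I" by (rule P.R.free_module_is_module)
  note g' = linear_mapsD[OF g]
  show ?thesis
    using S h
  proof (induction S arbitrary: h)
    case empty
    then have "h = \<zero>\<^bsub>free_module K I\<^esub>" by (auto simp: free_module_simps)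
    then show ?case using linear_map_zero[OF F.module_axioms P g] by simp
  next
    case (insert p S)
    define h' where "h' = h(p := \<zero>\<^bsub>K\<^esub>)"
    have p: "p \<in> I" and gp: "free_gen K p \<in> carrier (free_module K I)"
      using insert by (auto intro: P.R.free_gen_closed)
    have hc: "h i \<in> carrier K" for i using insert by (auto simp: free_module_simps)
    have "{i. h' i \<noteq> \<zero>\<^bsub>K\<^esub>} \<subseteq> {i. h i \<noteq> \<zero>\<^bsub>K\<^esub>}" by (auto simp: h'_def)
    then have h': "h' \<in> carrier (free_module K I)" "{i. h' i \<noteq> \<zero>\<^bsub>K\<^esub>} \<subseteq> S"
      using insert by (auto simp: free_module_simps h'_def intro: finite_subset)
    have "h = h' \<oplus>\<^bsub>free_module K I\<^esub> (h p \<odot>\<^bsub>free_module K I\<^esub> free_gen K p)"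
      using hc by (auto simp: free_module_simps h'_def free_gen_def)
    then have "g h = g h' \<oplus>\<^bsub>P\<^esub> h p \<odot>\<^bsub>P\<^esub> g (free_gen K p)"
      using h' gp hc g' by (metis F.smult_closed)
    also have "g h' = (\<Oplus>\<^bsub>P\<^esub>q \<in> S. h' q \<odot>\<^bsub>P\<^esub> g (free_gen K q))"
      by (rule insert.IH) (use insert h' in auto)
    also have "\<dots> = (\<Oplus>\<^bsub>P\<^esub>q \<in> S. h q \<odot>\<^bsub>P\<^esub> g (free_gen K q))"
      using insert hc
      by (intro P.M.finsum_cong') (auto simp: h'_def g' P.R.free_gen_closed)
    finally show ?case
      using insert hc gp
      by (subst P.M.finsum_insert) (auto simp: g' P.R.free_gen_closed subset_iff P.M.a_comm)
  qed
qed

text \<open>Needed because \<open>tensor\<close> and \<open>tensor_mod\<close>, and likewise a Hopf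
  record and its underlying module, differ only in fields that the module axioms do not
  read.\<close>

lemma module_cong:
  assumes "module K M"
    and "carrier N = carrier M" "add N = add M" "zero N = zero M" "smult N = smult M"
  shows "module K N"
proof -
  interpret module K M by fact
  show ?thesis
    by (rule moduleI, rule R.is_cring, rule abelian_groupI)
      (use M.add.l_inv_ex in \<open>auto simp: assms(2-) smult_l_distr smult_r_distr smult_assoc1 M.a_ac\<close>)
qed

lemma linear_maps_record_cong:
  assumes "carrier N = carrier N'" "add N = add N'" "smult N = smult N'"
  shows "linear_maps K M N = linear_maps K M N'" "linear_maps K N M = linear_maps K N' M"
  using assms by (simp_all add: linear_maps_def)

lemma tensor_lift_record_cong:
  fixes N N' :: "('k, 'p, 'm) module_scheme"
  assumes "carrier N = carrier N'" "add N = add N'" "zero N = zero N'" "smult N = smult N'"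
  shows "tensor_lift K N \<beta> t = tensor_lift K N' \<beta> t"
  using assms by (simp add: tensor_lift_def finsum_def)

lemma tensor_mod_fields:
  "carrier (tensor_mod K M N) = carrier (tensor K M N)"
  "add (tensor_mod K M N) = add (tensor K M N)"
  "zero (tensor_mod K M N) = zero (tensor K M N)"
  "smult (tensor_mod K M N) = smult (tensor K M N)"
  by (simp_all add: tensor_def)

lemma tensor_lift_tensor_mod: "tensor_lift K (tensor_mod K M N) = tensor_lift K (tensor K M N)"
  by (intro ext tensor_lift_record_cong tensor_mod_fields)

lemma linear_maps_tensor_mod:
  "linear_maps K Z (tensor_mod K M N) = linear_maps K Z (tensor K M N)"
  "linear_maps K (tensor_mod K M N) Z = linear_maps K (tensor K M N) Z"
  by (simp_all add: linear_maps_record_cong[OF tensor_mod_fields(1,2,4)])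

lemma tensor_is_module:
  assumes "module K M" "module K N"
  shows "module K (tensor K M N)"
  by (rule module_cong[OF module_pair.tensor_mod_is_module])
    (simp_all add: module_pair_def assms tensor_mod_fields)

lemma pure_tensor_bilinear':
  assumes "module K M" "module K N"
  shows "pure_tensor K M N \<in> bilinear_maps K M N (tensor K M N)"
  using module_pair.pure_tensor_bilinear[of K M N] assms
  by (simp add: module_pair_def bilinear_maps_def linear_maps_tensor_mod)

section \<open>The universal property of the tensor product\<close>

context module_pair begin

lemma tensor_module: "module K (tensor K M N)"
  by (rule tensor_is_module) unfold_locales

lemma lift_linear:
  assumes "module K P" "\<beta> \<in> bilinear_maps K M N P"
  shows "tensor_lift K P \<beta> \<in> linear_maps K (tensor K M N) P"
  using tensor_lift_linear[OF assms] by (simp add: linear_maps_tensor_mod)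

text \<open>Uniqueness in the universal property: \<open>f\<close> after the coset map is linear on
  the free module, hence fixed by its values on generators, whose cosets are the pure tensors;
  \<open>tensor_lift_coset\<close> evaluates the lift as the same sum.\<close>

lemma tensor_linear_eq_lift:
  assumes P: "module K P" and f: "f \<in> linear_maps K (tensor K M N) P"
    and t: "t \<in> carrier (tensor K M N)"
  shows "f t = tensor_lift K P (\<lambda>x y. f (pure_tensor K M N x y)) t"
proof -
  interpret P: module K P by fact
  have bil: "(\<lambda>x y. f (pure_tensor K M N x y)) \<in> bilinear_maps K M N P"
    by (rule bilinear_maps_comp[OF pure_tensor_bilinear' f]) unfold_locales
  let ?c = "\<lambda>h. tensor_rel K M N +>\<^bsub>F\<^esub> h"
  note sub = tensor_rel_submodule
  obtain h where h: "h \<in> carrier F" "t = ?c h"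
    using t F.quot_module_carrierE by (auto simp: tensor_mod_fields[symmetric] tensor_mod_def)
  have "?c \<in> linear_maps K F (tensor K M N)"
    unfolding linear_maps_tensor_mod[symmetric] tensor_mod_def
    by (rule linear_mapsI)
      (auto simp: F.quot_module_coset_add[OF sub] F.quot_module_coset_smult[OF sub]
        F.quot_module_coset_closed[OF sub])
  from free_module_span[OF P linear_maps_comp[OF this f] _ _ h(1), of "{p. h p \<noteq> \<zero>\<^bsub>K\<^esub>}"]
  have "f (?c h) = (\<Oplus>\<^bsub>P\<^esub>p \<in> {p. h p \<noteq> \<zero>\<^bsub>K\<^esub>}. h p \<odot>\<^bsub>P\<^esub> f (?c (free_gen K p)))"
    using h by (auto simp: free_module_simps)
  with tensor_lift_coset[OF P bil h(1)] show ?thesis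
    by (simp add: h(2) pure_tensor_def)
qed

text \<open>Bilinearity is tested on carriers only, so \<open>\<gamma>\<close> inherits it from
  \<open>\<beta>\<close>. This makes it possible to change an integrand outside the carriers, as the
  guard in \<open>sweedler\<close> does.\<close>

lemma tensor_lift_cong:
  assumes P: "module K P" and \<beta>: "\<beta> \<in> bilinear_maps K M N P"
    and eq: "\<And>x y. x \<in> carrier M \<Longrightarrow> y \<in> carrier N \<Longrightarrow> \<beta> x y = \<gamma> x y"
    and t: "t \<in> carrier (tensor K M N)"
  shows "tensor_lift K P \<beta> t = tensor_lift K P \<gamma> t"
proof -
  interpret P: module K P by fact
  have \<gamma>: "\<gamma> \<in> bilinear_maps K M N P"
  proof (rule bilinear_mapsI)
    show "(\<lambda>y. \<gamma> x y) \<in> linear_maps K N P" if "x \<in> carrier M" for x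
      using bilinear_mapsD(1)[OF \<beta> that] N.linear_maps_cong[of "\<gamma> x" "\<beta> x" P] eq[OF that] by simp
    show "(\<lambda>x. \<gamma> x y) \<in> linear_maps K M P" if "y \<in> carrier N" for y
      using bilinear_mapsD(2)[OF \<beta> that] M.linear_maps_cong[of "\<lambda>x. \<gamma> x y" "\<lambda>x. \<beta> x y" P] eq[OF _ that]
      by simp
  qed
  obtain h where h: "h \<in> carrier F" "t = tensor_rel K M N +>\<^bsub>F\<^esub> h"
    using t F.quot_module_carrierE by (auto simp: tensor_mod_fields[symmetric] tensor_mod_def)
  show ?thesis
    unfolding h(2) tensor_lift_coset[OF P \<beta> h(1)] tensor_lift_coset[OF P \<gamma> h(1)]
    by (rule P.M.finsum_cong') (use h(1) eq bilinear_mapsD(3)[OF \<gamma>] in \<open>auto simp: free_module_simps\<close>)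
qed

lemma tensor_ext:
  assumes P: "module K P" and f: "f \<in> linear_maps K (tensor K M N) P"
    and g: "g \<in> linear_maps K (tensor K M N) P"
    and eq: "\<And>x y. x \<in> carrier M \<Longrightarrow> y \<in> carrier N \<Longrightarrow>
      f (pure_tensor K M N x y) = g (pure_tensor K M N x y)"
    and t: "t \<in> carrier (tensor K M N)"
  shows "f t = g t"
proof -
  have bil: "(\<lambda>x y. f (pure_tensor K M N x y)) \<in> bilinear_maps K M N P"
    by (rule bilinear_maps_comp[OF pure_tensor_bilinear' f]) unfold_locales
  show ?thesis
    using tensor_lift_cong[OF P bil eq t] tensor_linear_eq_lift[OF P f t]
      tensor_linear_eq_lift[OF P g t] by simp
qed

lemma tensor_lift_comp:
  assumes P: "module K P" and R: "module K R" and \<beta>: "\<beta> \<in> bilinear_maps K M N P"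
    and f: "f \<in> linear_maps K P R" and t: "t \<in> carrier (tensor K M N)"
  shows "f (tensor_lift K P \<beta> t) = tensor_lift K R (\<lambda>x y. f (\<beta> x y)) t"
  by (rule tensor_ext[OF R linear_maps_comp[OF lift_linear f] lift_linear])
    (use P R \<beta> f t in \<open>auto simp: tensor_lift_pure bilinear_maps_comp\<close>)

text \<open>For a fixed equation in the parameter both sides are linear in \<open>t\<close>, so it
  may be checked on pure tensors. This is what makes nested Sweedler sums linear in the outer
  variables.\<close>

lemma tensor_lift_lin_param:
  assumes P: "module K P" and Z: "module K Z"
    and lin: "\<And>x y. x \<in> carrier M \<Longrightarrow> y \<in> carrier N \<Longrightarrow> (\<lambda>z. \<beta> z x y) \<in> linear_maps K Z P"
    and bil: "\<And>z. z \<in> carrier Z \<Longrightarrow> \<beta> z \<in> bilinear_maps K M N P"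
    and t: "t \<in> carrier (tensor K M N)"
  shows "(\<lambda>z. tensor_lift K P (\<beta> z) t) \<in> linear_maps K Z P"
proof -
  interpret P: module K P by fact
  interpret Z: module K Z by fact
  note ll = lift_linear[OF P bil]
  show ?thesis
  proof (rule linear_mapsI)
    show "z \<in> carrier Z \<Longrightarrow> tensor_lift K P (\<beta> z) t \<in> carrier P" for z
      using linear_mapsD(1)[OF ll] t by blast
  next
    fix z z' assume z: "z \<in> carrier Z" "z' \<in> carrier Z"
    show "tensor_lift K P (\<beta> (z \<oplus>\<^bsub>Z\<^esub> z')) t = tensor_lift K P (\<beta> z) t \<oplus>\<^bsub>P\<^esub> tensor_lift K P (\<beta> z') t"
      by (rule tensor_ext[OF P ll P.add_lin[OF ll ll] _ t])
        (use z in \<open>simp_all add: tensor_lift_pure[OF P bil] linear_mapsD(2)[OF lin]\<close>)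
  next
    fix c z assume z: "c \<in> carrier K" "z \<in> carrier Z"
    show "tensor_lift K P (\<beta> (c \<odot>\<^bsub>Z\<^esub> z)) t = c \<odot>\<^bsub>P\<^esub> tensor_lift K P (\<beta> z) t"
      by (rule tensor_ext[OF P ll P.smult_lin[OF _ ll] _ t])
        (use z in \<open>simp_all add: tensor_lift_pure[OF P bil] linear_mapsD(3)[OF lin]\<close>)
  qed
qed

lemma tensor_lift_pure_tensor:
  assumes "t \<in> carrier (tensor K M N)"
  shows "tensor_lift K (tensor K M N) (pure_tensor K M N) t = t"
  using tensor_linear_eq_lift[OF tensor_module linear_maps_id assms] by simp

text \<open>Shrinking the carrier of \<open>P\<close> to \<open>H\<close> leaves
  \<open>\<beta>\<close> bilinear, so its lift can be formed inside \<open>H\<close>; the two lifts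
  agree on pure tensors and hence everywhere.\<close>

lemma tensor_lift_in_submodule:
  assumes P: "module K P" and \<beta>: "\<beta> \<in> bilinear_maps K M N P" and H: "submodule H K P"
    and in_H: "\<And>x y. x \<in> carrier M \<Longrightarrow> y \<in> carrier N \<Longrightarrow> \<beta> x y \<in> H"
    and t: "t \<in> carrier (tensor K M N)"
  shows "tensor_lift K P \<beta> t \<in> H"
proof -
  interpret P: module K P by fact
  interpret PH: module K "P\<lparr>carrier := H\<rparr>"
    by (rule submodule.submodule_is_module[OF H P])
  have "\<beta> \<in> bilinear_maps K M N (P\<lparr>carrier := H\<rparr>)"
    using \<beta> in_H by (auto simp: bilinear_maps_def linear_maps_def)
  then have 1: "tensor_lift K (P\<lparr>carrier := H\<rparr>) \<beta> \<in> linear_maps K (tensor K M N) (P\<lparr>carrier := H\<rparr>)"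
    and 2: "\<And>x y. x \<in> carrier M \<Longrightarrow> y \<in> carrier N \<Longrightarrow>
      tensor_lift K (P\<lparr>carrier := H\<rparr>) \<beta> (pure_tensor K M N x y) = \<beta> x y"
    using lift_linear tensor_lift_pure PH.module_axioms by blast+
  have 3: "tensor_lift K (P\<lparr>carrier := H\<rparr>) \<beta> \<in> linear_maps K (tensor K M N) P"
    using 1 P.submoduleE(1)[OF H] by (auto simp: linear_maps_def)
  have "tensor_lift K P \<beta> t = tensor_lift K (P\<lparr>carrier := H\<rparr>) \<beta> t"
    by (rule tensor_ext[OF P lift_linear[OF P \<beta>] 3 _ t]) (simp add: 2 tensor_lift_pure[OF P \<beta>])
  then show ?thesis
    using linear_mapsD(1)[OF 1 t] by simp
qed

end

section \<open>Sweedler notation\<close>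

text \<open>Test maps on a triple tensor product that favour neither bracketing; with them
  coassociativity can be used without the associator.\<close>

definition trilinear_maps ::
    "('k, 'x) ring_scheme \<Rightarrow> ('k, 'a, 'l) module_scheme \<Rightarrow> ('k, 'b, 'm) module_scheme
      \<Rightarrow> ('k, 'c, 'n) module_scheme \<Rightarrow> ('k, 'd, 'p) module_scheme \<Rightarrow> ('a \<Rightarrow> 'b \<Rightarrow> 'c \<Rightarrow> 'd) set"
  where "trilinear_maps K L M N P =
    {\<gamma>. (\<forall>x \<in> carrier L. \<gamma> x \<in> bilinear_maps K M N P) \<and>
        (\<forall>y \<in> carrier M. \<forall>z \<in> carrier N. (\<lambda>x. \<gamma> x y z) \<in> linear_maps K L P)}"

lemma trilinear_mapsI [lin_intros]:
  assumes "\<And>x y. x \<in> carrier L \<Longrightarrow> y \<in> carrier M \<Longrightarrow> (\<lambda>z. \<gamma> x y z) \<in> linear_maps K N P"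
    and "\<And>x z. x \<in> carrier L \<Longrightarrow> z \<in> carrier N \<Longrightarrow> (\<lambda>y. \<gamma> x y z) \<in> linear_maps K M P"
    and "\<And>y z. y \<in> carrier M \<Longrightarrow> z \<in> carrier N \<Longrightarrow> (\<lambda>x. \<gamma> x y z) \<in> linear_maps K L P"
  shows "\<gamma> \<in> trilinear_maps K L M N P"
  using assms by (simp add: trilinear_maps_def bilinear_maps_def)

lemma trilinear_mapsD:
  assumes "\<gamma> \<in> trilinear_maps K L M N P"
  shows "x \<in> carrier L \<Longrightarrow> y \<in> carrier M \<Longrightarrow> z \<in> carrier N \<Longrightarrow> \<gamma> x y z \<in> carrier P"
    and "x \<in> carrier L \<Longrightarrow> \<gamma> x \<in> bilinear_maps K M N P"
  using assms by (auto simp: trilinear_maps_def intro: bilinear_mapsD(3))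

lemma trilinear_maps_lin:
  assumes "\<gamma> \<in> trilinear_maps K L M N P"
  shows "f \<in> linear_maps K Z L \<Longrightarrow> y \<in> carrier M \<Longrightarrow> z \<in> carrier N \<Longrightarrow>
      (\<lambda>x. \<gamma> (f x) y z) \<in> linear_maps K Z P"
    and "x \<in> carrier L \<Longrightarrow> g \<in> linear_maps K Z M \<Longrightarrow> z \<in> carrier N \<Longrightarrow>
      (\<lambda>y. \<gamma> x (g y) z) \<in> linear_maps K Z P"
    and "x \<in> carrier L \<Longrightarrow> y \<in> carrier M \<Longrightarrow> h \<in> linear_maps K Z N \<Longrightarrow>
      (\<lambda>z. \<gamma> x y (h z)) \<in> linear_maps K Z P"
  using assms by (auto simp: trilinear_maps_def bilinear_maps_def linear_maps_def Pi_def)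

lemma tensor_mult:
  "s \<otimes>\<^bsub>tensor K M N\<^esub> t = tensor_lift K (tensor K M N) (\<lambda>x y. tensor_lift K (tensor K M N) (\<lambda>x' y'.
    pure_tensor K M N (x \<otimes>\<^bsub>M\<^esub> x') (y \<otimes>\<^bsub>N\<^esub> y')) t) s"
  unfolding tensor_lift_tensor_mod[symmetric] by (simp add: tensor_def)

lemma tensor_one: "\<one>\<^bsub>tensor K M N\<^esub> = pure_tensor K M N \<one>\<^bsub>M\<^esub> \<one>\<^bsub>N\<^esub>"
  by (simp add: tensor_def)

lemma pure_tensor_lin [lin_intros]:
  assumes "module K M" "module K N"
  shows "f \<in> linear_maps K Z M \<Longrightarrow> y \<in> carrier N \<Longrightarrow>
      (\<lambda>x. pure_tensor K M N (f x) y) \<in> linear_maps K Z (tensor K M N)"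
    and "x \<in> carrier M \<Longrightarrow> g \<in> linear_maps K Z N \<Longrightarrow>
      (\<lambda>y. pure_tensor K M N x (g y)) \<in> linear_maps K Z (tensor K M N)"
  using bilinear_maps_lin[OF pure_tensor_bilinear'[OF assms]] by blast+

lemma pure_tensor_closed' [simp]:
  assumes "module K M" "module K N" "x \<in> carrier M" "y \<in> carrier N"
  shows "pure_tensor K M N x y \<in> carrier (tensor K M N)"
  using bilinear_mapsD(3)[OF pure_tensor_bilinear'[OF assms(1,2)]] assms(3,4) by blast

lemma tensor_lift_lin [lin_intros]:
  assumes "module K M" "module K N" "module K P" "\<beta> \<in> bilinear_maps K M N P"
    and "f \<in> linear_maps K Z (tensor K M N)"
  shows "(\<lambda>x. tensor_lift K P \<beta> (f x)) \<in> linear_maps K Z P"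
  by (rule linear_maps_comp[OF assms(5) module_pair.lift_linear])
    (use assms in \<open>auto simp: module_pair_def\<close>)

lemma tensor_lift_lin_param' [lin_intros]:
  assumes "module K M" "module K N" "module K P" "module K Z"
    and "\<And>x y. x \<in> carrier M \<Longrightarrow> y \<in> carrier N \<Longrightarrow> (\<lambda>z. \<beta> z x y) \<in> linear_maps K Z P"
    and "\<And>z. z \<in> carrier Z \<Longrightarrow> (\<lambda>x y. \<beta> z x y) \<in> bilinear_maps K M N P"
    and "t \<in> carrier (tensor K M N)"
  shows "(\<lambda>z. tensor_lift K P (\<lambda>x y. \<beta> z x y) t) \<in> linear_maps K Z P"
  by (rule module_pair.tensor_lift_lin_param) (use assms in \<open>auto simp: module_pair_def\<close>)

lemma tensor_lift_pure' [simp]: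
  assumes "module K M" "module K N" "module K P" "\<beta> \<in> bilinear_maps K M N P"
    "x \<in> carrier M" "y \<in> carrier N"
  shows "tensor_lift K P \<beta> (pure_tensor K M N x y) = \<beta> x y"
  by (rule module_pair.tensor_lift_pure) (use assms in \<open>auto simp: module_pair_def\<close>)

text \<open>
  \<open>sweedler K A P x \<beta>\<close> is \<open>\<Sum> \<beta> x\<^sub>1 x\<^sub>2\<close>, computed in \<open>P\<close>.  The guard makes the congruence rule
  unconditional, so that the simplifier can rewrite \<open>\<beta> x\<^sub>1 x\<^sub>2\<close>.
\<close>

definition sweedler ::
    "('k, 'x) ring_scheme \<Rightarrow> ('k, 'a) hopf \<Rightarrow> ('k, 'p, 'm) module_scheme \<Rightarrow> 'a \<Rightarrow> ('a \<Rightarrow> 'a \<Rightarrow> 'p) \<Rightarrow> 'p"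
  where "sweedler K A P x \<beta> = tensor_lift K P
    (\<lambda>a b. if a \<in> carrier A \<and> b \<in> carrier A then \<beta> a b else \<zero>\<^bsub>P\<^esub>) (comult A x)"

lemma sweedler_cong [cong]:
  assumes "x = y" "\<And>a b. a \<in> carrier A \<Longrightarrow> b \<in> carrier A \<Longrightarrow> \<beta> a b = \<gamma> a b"
  shows "sweedler K A P x \<beta> = sweedler K A P y \<gamma>"
proof -
  have "(\<lambda>a b. if a \<in> carrier A \<and> b \<in> carrier A then \<beta> a b else \<zero>\<^bsub>P\<^esub>) =
      (\<lambda>a b. if a \<in> carrier A \<and> b \<in> carrier A then \<gamma> a b else \<zero>\<^bsub>P\<^esub>)"
    using assms(2) by (intro ext) simp
  then show ?thesis by (simp add: sweedler_def assms(1))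
qed

lemma (in assoc_algebra) mult_lin [lin_intros]:
  "f \<in> linear_maps K Z A \<Longrightarrow> a \<in> carrier A \<Longrightarrow> (\<lambda>x. f x \<otimes>\<^bsub>A\<^esub> a) \<in> linear_maps K Z A"
  "a \<in> carrier A \<Longrightarrow> f \<in> linear_maps K Z A \<Longrightarrow> (\<lambda>x. a \<otimes>\<^bsub>A\<^esub> f x) \<in> linear_maps K Z A"
  by (auto simp: linear_maps_def Pi_def A.l_distr A.r_distr smult_mult_left smult_mult_right)

section \<open>Sweedler sums, and the Hopf axioms rewritten in terms of them\<close>

context hopf_algebra begin

abbreviation "S \<equiv> antipode A"
abbreviation "\<epsilon> \<equiv> counit A"
abbreviation "sw \<equiv> sweedler K A"

lemma mod_A [simp, intro]: "module K A" ..
lemma mod_AA [simp, intro]: "module K (tensor K A A)" by (simp add: tensor_is_module)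

lemma pair_AA: "module_pair K A A" by (simp add: module_pair_def)

lemma comult_closed [simp]: "x \<in> carrier A \<Longrightarrow> comult A x \<in> carrier (tensor K A A)"
  using comult_linear by (auto simp: linear_maps_def)

lemma antipode_closed [simp]: "x \<in> carrier A \<Longrightarrow> S x \<in> carrier A"
  using antipode_linear by (auto simp: linear_maps_def)

lemma counit_closed [simp]: "x \<in> carrier A \<Longrightarrow> \<epsilon> x \<in> carrier K"
  using counit_ring_hom by (auto simp: ring_hom_def)

lemma counit_one [simp]: "\<epsilon> \<one>\<^bsub>A\<^esub> = \<one>\<^bsub>K\<^esub>"
  and counit_mult [simp]: "x \<in> carrier A \<Longrightarrow> y \<in> carrier A \<Longrightarrow> \<epsilon> (x \<otimes>\<^bsub>A\<^esub> y) = \<epsilon> x \<otimes>\<^bsub>K\<^esub> \<epsilon> y"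
  and counit_add [simp]: "x \<in> carrier A \<Longrightarrow> y \<in> carrier A \<Longrightarrow> \<epsilon> (x \<oplus>\<^bsub>A\<^esub> y) = \<epsilon> x \<oplus>\<^bsub>K\<^esub> \<epsilon> y"
  using counit_ring_hom by (auto simp: ring_hom_def)

lemma antipode_lin [lin_intros]: "f \<in> linear_maps K Z A \<Longrightarrow> (\<lambda>x. S (f x)) \<in> linear_maps K Z A"
  by (rule linear_maps_comp[OF _ antipode_linear])

lemma comult_lin [lin_intros]:
  "f \<in> linear_maps K Z A \<Longrightarrow> (\<lambda>x. comult A (f x)) \<in> linear_maps K Z (tensor K A A)"
  by (rule linear_maps_comp[OF _ comult_linear])

lemma counit_lin [lin_intros]:
  assumes "module K P" "f \<in> linear_maps K Z A" "v \<in> carrier P"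
  shows "(\<lambda>x. \<epsilon> (f x) \<odot>\<^bsub>P\<^esub> v) \<in> linear_maps K Z P"
proof -
  interpret P: module K P by fact
  show ?thesis
    using assms(2,3) by (auto simp: linear_maps_def Pi_def P.smult_l_distr P.smult_assoc1 counit_smult)
qed

text \<open>On carrier elements the guard in \<open>sweedler\<close> is inert, so
  \<open>tensor_lift_cong\<close> removes it.\<close>

lemma sw_eq_lift:
  assumes "module K P" "\<beta> \<in> bilinear_maps K A A P" "x \<in> carrier A"
  shows "sw P x \<beta> = tensor_lift K P \<beta> (comult A x)"
  unfolding sweedler_def
  by (rule sym, rule module_pair.tensor_lift_cong[OF pair_AA]) (use assms in auto)

lemma sw_bilinear_closed:
  assumes "module K P" "\<beta> \<in> bilinear_maps K A A P" "x \<in> carrier A"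
  shows "sw P x \<beta> \<in> carrier P"
  using linear_mapsD(1)[OF module_pair.lift_linear[OF pair_AA assms(1,2)]] assms
  by (simp add: sw_eq_lift)

lemma sw_closed:
  assumes "module K P" "x \<in> carrier A"
    and "\<And>a. a \<in> carrier A \<Longrightarrow> (\<lambda>b. \<beta> a b) \<in> linear_maps K A P"
    and "\<And>b. b \<in> carrier A \<Longrightarrow> (\<lambda>a. \<beta> a b) \<in> linear_maps K A P"
  shows "sw P x (\<lambda>a b. \<beta> a b) \<in> carrier P"
  by (rule sw_bilinear_closed) (use assms in \<open>auto intro: bilinear_mapsI\<close>)

lemma sw_lin [lin_intros]:
  assumes "module K P" "\<beta> \<in> bilinear_maps K A A P" "module K Z" "f \<in> linear_maps K Z A"
  shows "(\<lambda>x. sw P (f x) \<beta>) \<in> linear_maps K Z P"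
proof -
  have "(\<lambda>x. tensor_lift K P \<beta> (comult A (f x))) \<in> linear_maps K Z P"
    by (rule tensor_lift_lin) (use assms in \<open>auto intro: comult_lin\<close>)
  then show ?thesis
    using assms by (simp add: module.linear_maps_cong[of K Z "\<lambda>x. sw P (f x) \<beta>"
          "\<lambda>x. tensor_lift K P \<beta> (comult A (f x))"] sw_eq_lift linear_mapsD(1)[OF assms(4)])
qed

lemma sw_lin_param [lin_intros]:
  assumes "module K P" "module K Z" "y \<in> carrier A"
    and "\<And>a b. a \<in> carrier A \<Longrightarrow> b \<in> carrier A \<Longrightarrow> (\<lambda>z. \<beta> z a b) \<in> linear_maps K Z P"
    and "\<And>z. z \<in> carrier Z \<Longrightarrow> (\<lambda>a b. \<beta> z a b) \<in> bilinear_maps K A A P"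
  shows "(\<lambda>z. sw P y (\<lambda>a b. \<beta> z a b)) \<in> linear_maps K Z P"
proof -
  have "(\<lambda>z. tensor_lift K P (\<lambda>a b. \<beta> z a b) (comult A y)) \<in> linear_maps K Z P"
    by (rule tensor_lift_lin_param') (use assms in auto)
  then show ?thesis
    using assms by (subst module.linear_maps_cong[of K Z _
          "\<lambda>z. tensor_lift K P (\<lambda>a b. \<beta> z a b) (comult A y)"]) (simp_all add: sw_eq_lift)
qed

lemma lin_sw:
  assumes "module K P" "module K R" "f \<in> linear_maps K P R" "\<beta> \<in> bilinear_maps K A A P" "x \<in> carrier A"
  shows "f (sw P x \<beta>) = sw R x (\<lambda>a b. f (\<beta> a b))"
  using module_pair.tensor_lift_comp[OF pair_AA assms(1,2,4,3), of "comult A x"] assms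
  by (simp add: sw_eq_lift bilinear_maps_comp)

lemma lift_comult:
  assumes "module K P" "\<beta> \<in> bilinear_maps K A A P" "x \<in> carrier A"
  shows "tensor_lift K P \<beta> (comult A x) = sw P x \<beta>"
  using assms by (simp add: sw_eq_lift)

lemma comult_eq_sw: "x \<in> carrier A \<Longrightarrow> comult A x = sw (tensor K A A) x (pure_tensor K A A)"
  by (simp add: sw_eq_lift pure_tensor_bilinear' module_pair.tensor_lift_pure_tensor[OF pair_AA])

text \<open>The trilinear map extends to a linear map \<open>G\<close> on A \<otimes> (A \<otimes>
  A). Applying \<open>G\<close> to both sides of the axiom \<open>coassoc\<close> and evaluating
  associator and lifts on pure tensors yields the two bracketings.\<close>

lemma sw_coassoc:
  assumes P: "module K P" and \<gamma>: "\<gamma> \<in> trilinear_maps K A A A P" and x: "x \<in> carrier A"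
  shows "sw P x (\<lambda>a b. sw P a (\<lambda>c d. \<gamma> c d b)) = sw P x (\<lambda>a b. sw P b (\<lambda>c d. \<gamma> a c d))"
proof -
  let ?T = "tensor K A A" let ?L = "tensor K ?T A" let ?R = "tensor K A ?T"
  note \<gamma>l = trilinear_maps_lin[OF \<gamma>]
  have mods: "module K ?L" "module K ?R" by (simp_all add: tensor_is_module)
  define G where "G t = tensor_lift K P (\<lambda>a u. tensor_lift K P (\<lambda>c d. \<gamma> a c d) u) t" for t
  have G: "G \<in> linear_maps K ?R P"
    unfolding G_def using P by (auto intro!: lin_intros \<gamma>l)
  have G_pure: "G (pure_tensor K A ?T a (pure_tensor K A A c d)) = \<gamma> a c d"
    if "a \<in> carrier A" "c \<in> carrier A" "d \<in> carrier A" for a c d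
    unfolding G_def using that P
    by (subst tensor_lift_pure') (auto intro!: lin_intros \<gamma>l simp: trilinear_mapsD(2)[OF \<gamma>])
  define as where "as = tensor_assoc K A A A"
  have bil: "(\<lambda>u z. tensor_lift K ?R (\<lambda>x y. pure_tensor K A ?T x (pure_tensor K A A y z)) u)
      \<in> bilinear_maps K ?T A ?R"
    using mods by (auto intro!: lin_intros)
  have as: "as \<in> linear_maps K ?L ?R"
    unfolding as_def tensor_assoc_def
    using module_pair.lift_linear[OF _ mods(2) bil] by (simp add: module_pair_def)
  have as_pure: "as (pure_tensor K ?T A u z) =
      tensor_lift K ?R (\<lambda>x y. pure_tensor K A ?T x (pure_tensor K A A y z)) u"
    if "u \<in> carrier ?T" "z \<in> carrier A" for u z
    unfolding as_def tensor_assoc_def using that bil mods by simp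
  have 1: "G (as (pure_tensor K ?T A (comult A a) b)) = sw P a (\<lambda>c d. \<gamma> c d b)"
    if "a \<in> carrier A" "b \<in> carrier A" for a b
  proof -
    have "G (as (pure_tensor K ?T A (comult A a) b)) =
        sw P a (\<lambda>x y. G (pure_tensor K A ?T x (pure_tensor K A A y b)))"
      using that mods P G
      by (simp add: as_pure, subst lift_comult) (auto intro!: lin_intros intro: lin_sw)
    then show ?thesis using that by (simp add: G_pure)
  qed
  have 2: "G (pure_tensor K A ?T a (comult A b)) = sw P b (\<lambda>c d. \<gamma> a c d)"
    if "a \<in> carrier A" "b \<in> carrier A" for a b
    unfolding G_def using that P
    by (subst tensor_lift_pure') (auto intro!: lin_intros \<gamma>l lift_comult)
  have "G (as (tensor_map K ?T A (comult A) (\<lambda>y. y) (comult A x))) =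
      sw P x (\<lambda>a b. G (as (pure_tensor K ?T A (comult A a) b)))"
    unfolding tensor_map_def using mods P x
    by (subst lift_comult) (auto intro!: lin_intros lin_sw linear_maps_comp[OF as G])
  moreover have "G (tensor_map K A ?T (\<lambda>y. y) (comult A) (comult A x)) =
      sw P x (\<lambda>a b. G (pure_tensor K A ?T a (comult A b)))"
    unfolding tensor_map_def using mods P x
    by (subst lift_comult) (auto intro!: lin_intros lin_sw G)
  ultimately show ?thesis
    using coassoc[OF x] by (simp add: as_def[symmetric] 1 2)
qed

lemma sw_counit_left:
  assumes P: "module K P" and f: "f \<in> linear_maps K A P" and x: "x \<in> carrier A"
  shows "sw P x (\<lambda>a b. \<epsilon> a \<odot>\<^bsub>P\<^esub> f b) = f x"
proof -
  have "f x = f (sw A x (\<lambda>y z. \<epsilon> y \<odot>\<^bsub>A\<^esub> z))"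
    using counit_left[OF x] x by (subst (asm) lift_comult) (auto intro!: lin_intros)
  also have "\<dots> = sw P x (\<lambda>a b. \<epsilon> a \<odot>\<^bsub>P\<^esub> f b)"
    using P x by (subst lin_sw[OF _ P f]) (auto intro!: lin_intros simp: linear_mapsD[OF f])
  finally show ?thesis by simp
qed

lemma sw_counit_right:
  assumes P: "module K P" and f: "f \<in> linear_maps K A P" and x: "x \<in> carrier A"
  shows "sw P x (\<lambda>a b. \<epsilon> b \<odot>\<^bsub>P\<^esub> f a) = f x"
proof -
  have "f x = f (sw A x (\<lambda>y z. \<epsilon> z \<odot>\<^bsub>A\<^esub> y))"
    using counit_right[OF x] x by (subst (asm) lift_comult) (auto intro!: lin_intros)
  also have "\<dots> = sw P x (\<lambda>a b. \<epsilon> b \<odot>\<^bsub>P\<^esub> f a)"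
    using P x by (subst lin_sw[OF _ P f]) (auto intro!: lin_intros simp: linear_mapsD[OF f])
  finally show ?thesis by simp
qed

lemma sw_antipode_left:
  assumes P: "module K P" and f: "f \<in> linear_maps K A P" and x: "x \<in> carrier A"
  shows "sw P x (\<lambda>a b. f (S a \<otimes>\<^bsub>A\<^esub> b)) = \<epsilon> x \<odot>\<^bsub>P\<^esub> f \<one>\<^bsub>A\<^esub>"
proof -
  have "f (\<epsilon> x \<odot>\<^bsub>A\<^esub> \<one>\<^bsub>A\<^esub>) = f (sw A x (\<lambda>y z. S y \<otimes>\<^bsub>A\<^esub> z))"
    using antipode_left[OF x] x by (subst (asm) lift_comult) (auto intro!: lin_intros)
  also have "\<dots> = sw P x (\<lambda>a b. f (S a \<otimes>\<^bsub>A\<^esub> b))"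
    using P x by (subst lin_sw[OF _ P f]) (auto intro!: lin_intros)
  finally show ?thesis using x by (simp add: linear_mapsD[OF f])
qed

lemma sw_antipode_right:
  assumes P: "module K P" and f: "f \<in> linear_maps K A P" and x: "x \<in> carrier A"
  shows "sw P x (\<lambda>a b. f (a \<otimes>\<^bsub>A\<^esub> S b)) = \<epsilon> x \<odot>\<^bsub>P\<^esub> f \<one>\<^bsub>A\<^esub>"
proof -
  have "f (\<epsilon> x \<odot>\<^bsub>A\<^esub> \<one>\<^bsub>A\<^esub>) = f (sw A x (\<lambda>y z. y \<otimes>\<^bsub>A\<^esub> S z))"
    using antipode_right[OF x] x by (subst (asm) lift_comult) (auto intro!: lin_intros)
  also have "\<dots> = sw P x (\<lambda>a b. f (a \<otimes>\<^bsub>A\<^esub> S b))"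
    using P x by (subst lin_sw[OF _ P f]) (auto intro!: lin_intros)
  finally show ?thesis using x by (simp add: linear_mapsD[OF f])
qed

text \<open>The coproduct is a ring homomorphism, and the componentwise product of two coproducts
  unfolds to a double Sweedler sum of pure tensors; the lift of \<open>\<beta>\<close> is then moved
  inside both sums.\<close>

lemma sw_mult:
  assumes P: "module K P" and \<beta>: "\<beta> \<in> bilinear_maps K A A P"
    and x: "x \<in> carrier A" and y: "y \<in> carrier A"
  shows "sw P (x \<otimes>\<^bsub>A\<^esub> y) \<beta> =
    sw P x (\<lambda>a b. sw P y (\<lambda>c d. \<beta> (a \<otimes>\<^bsub>A\<^esub> c) (b \<otimes>\<^bsub>A\<^esub> d)))"
proof -
  let ?T = "tensor K A A"
  have "comult A (x \<otimes>\<^bsub>A\<^esub> y) = comult A x \<otimes>\<^bsub>?T\<^esub> comult A y"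
    using comult_ring_hom x y by (simp add: ring_hom_def)
  also have "\<dots> = tensor_lift K ?T (\<lambda>x y'. tensor_lift K ?T (\<lambda>x' y''.
      pure_tensor K A A (x \<otimes>\<^bsub>A\<^esub> x') (y' \<otimes>\<^bsub>A\<^esub> y'')) (comult A y)) (comult A x)"
    by (rule tensor_mult)
  also have "\<dots> = sw ?T x (\<lambda>a b. tensor_lift K ?T (\<lambda>c d.
      pure_tensor K A A (a \<otimes>\<^bsub>A\<^esub> c) (b \<otimes>\<^bsub>A\<^esub> d)) (comult A y))"
    using x y by (subst lift_comult) (auto intro!: lin_intros)
  also have "\<dots> = sw ?T x (\<lambda>a b. sw ?T y (\<lambda>c d. pure_tensor K A A (a \<otimes>\<^bsub>A\<^esub> c) (b \<otimes>\<^bsub>A\<^esub> d)))"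
    using x y by (intro sweedler_cong refl lift_comult) (auto intro!: lin_intros)
  finally have *: "comult A (x \<otimes>\<^bsub>A\<^esub> y) = \<dots>" .
  have lift: "tensor_lift K P \<beta> \<in> linear_maps K ?T P"
    by (rule module_pair.lift_linear[OF pair_AA P \<beta>])
  have "sw P (x \<otimes>\<^bsub>A\<^esub> y) \<beta> = tensor_lift K P \<beta> (comult A (x \<otimes>\<^bsub>A\<^esub> y))"
    using P \<beta> x y by (simp add: sw_eq_lift)
  also have "\<dots> = sw P x (\<lambda>a b. tensor_lift K P \<beta>
      (sw ?T y (\<lambda>c d. pure_tensor K A A (a \<otimes>\<^bsub>A\<^esub> c) (b \<otimes>\<^bsub>A\<^esub> d))))"
    unfolding * using P x y by (intro lin_sw lift) (auto intro!: lin_intros)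
  also have "\<dots> = sw P x (\<lambda>a b. sw P y (\<lambda>c d. tensor_lift K P \<beta>
      (pure_tensor K A A (a \<otimes>\<^bsub>A\<^esub> c) (b \<otimes>\<^bsub>A\<^esub> d))))"
    using P x y by (intro sweedler_cong refl lin_sw lift) (auto intro!: lin_intros)
  also have "\<dots> = sw P x (\<lambda>a b. sw P y (\<lambda>c d. \<beta> (a \<otimes>\<^bsub>A\<^esub> c) (b \<otimes>\<^bsub>A\<^esub> d)))"
    using P \<beta> by simp
  finally show ?thesis .
qed

lemma sw_one:
  assumes P: "module K P" and \<beta>: "\<beta> \<in> bilinear_maps K A A P"
  shows "sw P \<one>\<^bsub>A\<^esub> \<beta> = \<beta> \<one>\<^bsub>A\<^esub> \<one>\<^bsub>A\<^esub>"
proof -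
  have "comult A \<one>\<^bsub>A\<^esub> = \<one>\<^bsub>tensor K A A\<^esub>"
    using comult_ring_hom by (simp add: ring_hom_def)
  then show ?thesis
    using P \<beta> by (simp add: sw_eq_lift tensor_one)
qed

text \<open>Fubini for independent sums: with the sum over \<open>x\<close> outside, the expression
  is linear in the tensor put in place of \<open>comult A y\<close>, so it is determined by its
  values on pure tensors.\<close>

lemma sw_swap:
  assumes P: "module K P" and x: "x \<in> carrier A" and y: "y \<in> carrier A"
    and 1: "\<And>a b. a \<in> carrier A \<Longrightarrow> b \<in> carrier A \<Longrightarrow> (\<lambda>c d. \<beta> a b c d) \<in> bilinear_maps K A A P"
    and 2: "\<And>c d. c \<in> carrier A \<Longrightarrow> d \<in> carrier A \<Longrightarrow> (\<lambda>a b. \<beta> a b c d) \<in> bilinear_maps K A A P"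
  shows "sw P x (\<lambda>a b. sw P y (\<lambda>c d. \<beta> a b c d)) = sw P y (\<lambda>c d. sw P x (\<lambda>a b. \<beta> a b c d))"
proof -
  let ?T = "tensor K A A"
  define h where "h t = sw P x (\<lambda>a b. tensor_lift K P (\<lambda>c d. \<beta> a b c d) t)" for t
  note l = bilinear_mapsD(1,2)[OF 1] bilinear_mapsD(1,2)[OF 2]
  have h: "h \<in> linear_maps K ?T P"
    unfolding h_def using P x by (auto intro!: lin_intros intro: l)
  have h_pure: "h (pure_tensor K A A c d) = sw P x (\<lambda>a b. \<beta> a b c d)"
    if "c \<in> carrier A" "d \<in> carrier A" for c d
    unfolding h_def using P that 1 by simp
  have "sw P x (\<lambda>a b. sw P y (\<lambda>c d. \<beta> a b c d)) = h (comult A y)"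
    unfolding h_def using P y 1 by (simp add: sw_eq_lift)
  also have "\<dots> = tensor_lift K P (\<lambda>c d. h (pure_tensor K A A c d)) (comult A y)"
    by (rule module_pair.tensor_linear_eq_lift[OF pair_AA P h]) (simp add: y)
  also have "\<dots> = sw P y (\<lambda>c d. h (pure_tensor K A A c d))"
    by (rule lift_comult[OF P _ y]) (auto intro!: bilinear_maps_comp[OF _ h] pure_tensor_bilinear')
  also have "\<dots> = sw P y (\<lambda>c d. sw P x (\<lambda>a b. \<beta> a b c d))"
    by (simp add: h_pure)
  finally show ?thesis .
qed

end

section \<open>Complements and generalized inverses over a field\<close>

lemma (in abelian_group) minus_eq_zero_iff:
  assumes "x \<in> carrier G" "y \<in> carrier G"
  shows "x \<ominus> y = \<zero> \<longleftrightarrow> x = y"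
  using assms by (metis a_minus_def a_inv_closed minus_equality minus_minus r_neg)

text \<open>Zorn's lemma for the submodules that meet \<open>W\<close> trivially. A maximal one is a
  complement because a vector outside \<open>W + Y\<close> could be adjoined to it; division by
  scalars enters exactly there.\<close>

lemma submodule_complement:
  assumes K: "field K" and M: "module K M" and W: "submodule W K M"
  obtains Y where "submodule Y K M" "Y \<inter> W = {\<zero>\<^bsub>M\<^esub>}"
    "\<And>v. v \<in> carrier M \<Longrightarrow> \<exists>w\<in>W. \<exists>y\<in>Y. v = w \<oplus>\<^bsub>M\<^esub> y"
proof -
  interpret field K by fact
  interpret M: module K M by fact
  note sub = M.submoduleE
  have zero: "\<zero>\<^bsub>M\<^esub> \<in> H" if "submodule H K M" for H
    using that M.submodule_abelian_subgroup abelian_subgroup.axioms(1) additive_subgroup.zero_closed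
    by metis
  define \<A> where "\<A> = {Y. submodule Y K M \<and> Y \<inter> W = {\<zero>\<^bsub>M\<^esub>}}"
  have "{\<zero>\<^bsub>M\<^esub>} \<in> \<A>"
    using zero[OF W] by (auto simp: \<A>_def intro!: M.submoduleI)
  moreover have "\<Union>\<C> \<in> \<A>" if C: "\<C> \<noteq> {}" "subset.chain \<A> \<C>" for \<C>
  proof -
    have s: "submodule Y K M" "Y \<inter> W = {\<zero>\<^bsub>M\<^esub>}" if "Y \<in> \<C>" for Y
      using C that by (auto simp: subset.chain_def \<A>_def)
    have "submodule (\<Union>\<C>) K M"
    proof (rule M.submoduleI)
      show "\<Union>\<C> \<subseteq> carrier M" using s(1) sub(1) by blast
      show "\<zero>\<^bsub>M\<^esub> \<in> \<Union>\<C>" using C(1) s(1) zero by blast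
      fix a b assume "a \<in> \<Union>\<C>" "b \<in> \<Union>\<C>"
      then obtain Y where "Y \<in> \<C>" "a \<in> Y" "b \<in> Y"
        using C(2) by (fastforce simp: subset.chain_def)
      then show "a \<oplus>\<^bsub>M\<^esub> b \<in> \<Union>\<C>" using sub(5)[OF s(1)] by blast
    qed (use s(1) sub(3,4) in blast)+
    moreover have "\<Union>\<C> \<inter> W = {\<zero>\<^bsub>M\<^esub>}" using C(1) s(2) by blast
    ultimately show ?thesis by (simp add: \<A>_def)
  qed
  ultimately obtain Y where Y: "Y \<in> \<A>" and max: "\<And>Z. Z \<in> \<A> \<Longrightarrow> Y \<subseteq> Z \<Longrightarrow> Z = Y"
    using subset_Zorn_nonempty[of \<A>] by blast
  have Ys: "submodule Y K M" and YW: "Y \<inter> W = {\<zero>\<^bsub>M\<^esub>}"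
    using Y by (auto simp: \<A>_def)
  note Yc = subsetD[OF sub(1)[OF Ys]] and Wc = subsetD[OF sub(1)[OF W]]
  have "\<exists>w\<in>W. \<exists>y\<in>Y. v = w \<oplus>\<^bsub>M\<^esub> y" if v: "v \<in> carrier M" for v
  proof (rule ccontr)
    assume not: "\<not> ?thesis"
    \<comment> \<open>The enlargement \<open>Y + K v\<close>, which is to contradict
      maximality.\<close>
    define Z where "Z = {y \<oplus>\<^bsub>M\<^esub> c \<odot>\<^bsub>M\<^esub> v | y c. y \<in> Y \<and> c \<in> carrier K}"
    have "submodule Z K M"
    proof (rule M.submoduleI)
      show "Z \<subseteq> carrier M" using v Yc by (auto simp: Z_def)
      have "\<zero>\<^bsub>M\<^esub> = \<zero>\<^bsub>M\<^esub> \<oplus>\<^bsub>M\<^esub> \<zero>\<^bsub>K\<^esub> \<odot>\<^bsub>M\<^esub> v" using v by simp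
      then show "\<zero>\<^bsub>M\<^esub> \<in> Z" using zero[OF Ys] unfolding Z_def by blast
    next
      fix a assume "a \<in> Z"
      then obtain y c where a: "y \<in> Y" "c \<in> carrier K" "a = y \<oplus>\<^bsub>M\<^esub> c \<odot>\<^bsub>M\<^esub> v"
        by (auto simp: Z_def)
      have "\<ominus>\<^bsub>M\<^esub> a = \<ominus>\<^bsub>M\<^esub> y \<oplus>\<^bsub>M\<^esub> (\<ominus>\<^bsub>K\<^esub> c) \<odot>\<^bsub>M\<^esub> v"
        using a v Yc by (simp add: M.minus_add M.smult_l_minus)
      then show "\<ominus>\<^bsub>M\<^esub> a \<in> Z" using sub(3)[OF Ys a(1)] a(2) unfolding Z_def by blast
    next
      fix a b assume "a \<in> Z" "b \<in> Z"
      then obtain y c y' c' where a: "y \<in> Y" "c \<in> carrier K" "a = y \<oplus>\<^bsub>M\<^esub> c \<odot>\<^bsub>M\<^esub> v"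
        and b: "y' \<in> Y" "c' \<in> carrier K" "b = y' \<oplus>\<^bsub>M\<^esub> c' \<odot>\<^bsub>M\<^esub> v"
        by (auto simp: Z_def)
      have "a \<oplus>\<^bsub>M\<^esub> b = (y \<oplus>\<^bsub>M\<^esub> y') \<oplus>\<^bsub>M\<^esub> (c \<oplus>\<^bsub>K\<^esub> c') \<odot>\<^bsub>M\<^esub> v"
        using a b v Yc by (simp add: M.smult_l_distr M.M.a_ac)
      then show "a \<oplus>\<^bsub>M\<^esub> b \<in> Z" using sub(5)[OF Ys a(1) b(1)] a(2) b(2) unfolding Z_def by blast
    next
      fix k a assume k: "k \<in> carrier K" and "a \<in> Z"
      then obtain y c where a: "y \<in> Y" "c \<in> carrier K" "a = y \<oplus>\<^bsub>M\<^esub> c \<odot>\<^bsub>M\<^esub> v"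
        by (auto simp: Z_def)
      have "k \<odot>\<^bsub>M\<^esub> a = k \<odot>\<^bsub>M\<^esub> y \<oplus>\<^bsub>M\<^esub> (k \<otimes>\<^bsub>K\<^esub> c) \<odot>\<^bsub>M\<^esub> v"
        using a v Yc k by (simp add: M.smult_r_distr M.smult_assoc1)
      then show "k \<odot>\<^bsub>M\<^esub> a \<in> Z" using sub(4)[OF Ys k a(1)] a(2) k unfolding Z_def by blast
    qed
    moreover have "Z \<inter> W = {\<zero>\<^bsub>M\<^esub>}"
    proof
      show "Z \<inter> W \<subseteq> {\<zero>\<^bsub>M\<^esub>}"
      proof
        fix w assume w: "w \<in> Z \<inter> W"
        then obtain y c where y: "y \<in> Y" and c: "c \<in> carrier K" and weq: "w = y \<oplus>\<^bsub>M\<^esub> c \<odot>\<^bsub>M\<^esub> v"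
          by (auto simp: Z_def)
        \<comment> \<open>A nonzero coefficient could be inverted, which would write
          \<open>v\<close> as a sum of elements of \<open>W\<close> and \<open>Y\<close>, against
          its choice.\<close>
        have "c = \<zero>\<^bsub>K\<^esub>"
        proof (rule ccontr)
          assume "c \<noteq> \<zero>\<^bsub>K\<^esub>"
          then have i: "inv\<^bsub>K\<^esub> c \<in> carrier K" "inv\<^bsub>K\<^esub> c \<otimes>\<^bsub>K\<^esub> c = \<one>\<^bsub>K\<^esub>"
            using c by (auto simp: field_Units)
          have "c \<odot>\<^bsub>M\<^esub> v = w \<ominus>\<^bsub>M\<^esub> y"
            using y c v Yc by (simp add: weq a_minus_def M.M.a_ac M.M.r_neg2)
          moreover have "v = inv\<^bsub>K\<^esub> c \<odot>\<^bsub>M\<^esub> (c \<odot>\<^bsub>M\<^esub> v)"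
            using i c v by (simp add: M.smult_assoc1[symmetric])
          ultimately have "v = inv\<^bsub>K\<^esub> c \<odot>\<^bsub>M\<^esub> (w \<ominus>\<^bsub>M\<^esub> y)"
            by simp
          then have "v = inv\<^bsub>K\<^esub> c \<odot>\<^bsub>M\<^esub> w \<oplus>\<^bsub>M\<^esub> inv\<^bsub>K\<^esub> c \<odot>\<^bsub>M\<^esub> (\<ominus>\<^bsub>M\<^esub> y)"
            using i v y w Yc Wc by (simp add: a_minus_def M.smult_r_distr)
          moreover have "inv\<^bsub>K\<^esub> c \<odot>\<^bsub>M\<^esub> w \<in> W" "inv\<^bsub>K\<^esub> c \<odot>\<^bsub>M\<^esub> (\<ominus>\<^bsub>M\<^esub> y) \<in> Y"
            using i w y sub(4)[OF W] sub(4)[OF Ys] sub(3)[OF Ys] by auto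
          ultimately show False using not by blast
        qed
        then have "w \<in> Y" using weq y v Yc by simp
        then show "w \<in> {\<zero>\<^bsub>M\<^esub>}" using w YW by blast
      qed
      show "{\<zero>\<^bsub>M\<^esub>} \<subseteq> Z \<inter> W"
        using zero[OF W] zero[OF \<open>submodule Z K M\<close>] by blast
    qed
    ultimately have "Z \<in> \<A>" by (simp add: \<A>_def)
    moreover have "y \<in> Z" if "y \<in> Y" for y
    proof -
      have "y = y \<oplus>\<^bsub>M\<^esub> \<zero>\<^bsub>K\<^esub> \<odot>\<^bsub>M\<^esub> v" using v that Yc by simp
      then show ?thesis using that unfolding Z_def by blast
    qed
    ultimately have "Z = Y" using max by blast
    moreover have "v \<in> Z"
    proof -
      have "v = \<zero>\<^bsub>M\<^esub> \<oplus>\<^bsub>M\<^esub> \<one>\<^bsub>K\<^esub> \<odot>\<^bsub>M\<^esub> v" using v by simp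
      then show ?thesis using zero[OF Ys] unfolding Z_def by blast
    qed
    ultimately have "v \<in> Y" by simp
    moreover have "v = \<zero>\<^bsub>M\<^esub> \<oplus>\<^bsub>M\<^esub> v" using v by simp
    ultimately show False using not zero[OF W] by blast
  qed
  with that Ys YW show thesis by blast
qed

lemma linear_map_image_submodule:
  assumes "module K M" "module K N" and T: "T \<in> linear_maps K M N"
  shows "submodule (T ` carrier M) K N"
proof -
  interpret M: module K M by fact
  interpret N: module K N by fact
  note T' = linear_mapsD[OF T]
  show ?thesis
  proof (rule N.submoduleI)
    show "\<zero>\<^bsub>N\<^esub> \<in> T ` carrier M"
      using linear_map_zero[OF assms] M.M.zero_closed by (metis imageI)
    fix a assume "a \<in> T ` carrier M"
    then obtain x where x: "x \<in> carrier M" "a = T x" by blast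
    then have "\<ominus>\<^bsub>N\<^esub> a = T (\<ominus>\<^bsub>M\<^esub> x)"
      using linear_map_minus[OF assms M.M.zero_closed x(1)] linear_map_zero[OF assms] T'(1)[OF x(1)]
      by (simp add: a_minus_def)
    then show "\<ominus>\<^bsub>N\<^esub> a \<in> T ` carrier M" using x(1) by blast
  next
    fix a b assume "a \<in> T ` carrier M" "b \<in> T ` carrier M"
    then show "a \<oplus>\<^bsub>N\<^esub> b \<in> T ` carrier M" using T'(2) by (auto simp: image_iff) (metis M.M.a_closed)
  next
    fix c b assume "c \<in> carrier K" "b \<in> T ` carrier M"
    then show "c \<odot>\<^bsub>N\<^esub> b \<in> T ` carrier M" using T'(3) by (auto simp: image_iff) (metis M.smult_closed)
  qed (use T'(1) in auto)
qed

text \<open>Let \<open>Y\<close> complement the kernel of \<open>T\<close> and \<open>Z\<close> its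
  image. Then \<open>T\<close> maps \<open>Y\<close> bijectively onto the image; \<open>U\<close> is
  the inverse there and zero on \<open>Z\<close>.\<close>

lemma generalized_inverse:
  assumes K: "field K" and M: "module K M" and N: "module K N" and T: "T \<in> linear_maps K M N"
  obtains U where "U \<in> linear_maps K N M" "\<And>x. x \<in> carrier M \<Longrightarrow> T (U (T x)) = T x"
proof -
  interpret M: module K M by fact
  interpret N: module K N by fact
  note T' = linear_mapsD[OF T] and Tm = linear_map_minus[OF M N T]
  define W where "W = {x \<in> carrier M. T x = \<zero>\<^bsub>N\<^esub>}"
  have W: "submodule W K M"
    unfolding W_def by (rule linear_map_ker_submodule[OF M N T])
  obtain Y where Y: "submodule Y K M" "Y \<inter> W = {\<zero>\<^bsub>M\<^esub>}"
    and Y_ex: "\<And>v. v \<in> carrier M \<Longrightarrow> \<exists>w\<in>W. \<exists>y\<in>Y. v = w \<oplus>\<^bsub>M\<^esub> y"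
    using submodule_complement[OF K M W] by blast
  obtain Z where Z: "submodule Z K N" "Z \<inter> T ` carrier M = {\<zero>\<^bsub>N\<^esub>}"
    and Z_ex: "\<And>v. v \<in> carrier N \<Longrightarrow> \<exists>w\<in>T ` carrier M. \<exists>y\<in>Z. v = w \<oplus>\<^bsub>N\<^esub> y"
    using submodule_complement[OF K N linear_map_image_submodule[OF M N T]] by blast
  note Yc = subsetD[OF M.submoduleE(1)[OF Y(1)]] and Zc = subsetD[OF N.submoduleE(1)[OF Z(1)]]
  have Ym: "a \<ominus>\<^bsub>M\<^esub> b \<in> Y" if "a \<in> Y" "b \<in> Y" for a b
    using that by (simp add: a_minus_def M.submoduleE(3,5)[OF Y(1)])
  have Zm: "a \<ominus>\<^bsub>N\<^esub> b \<in> Z" if "a \<in> Z" "b \<in> Z" for a b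
    using that by (simp add: a_minus_def N.submoduleE(3,5)[OF Z(1)])
  have ex: "\<exists>x. x \<in> Y \<and> n \<ominus>\<^bsub>N\<^esub> T x \<in> Z" if n: "n \<in> carrier N" for n
  proof -
    obtain m z where m: "m \<in> carrier M" "z \<in> Z" "n = T m \<oplus>\<^bsub>N\<^esub> z" using Z_ex[OF n] by blast
    obtain w y where w: "w \<in> W" "y \<in> Y" "m = w \<oplus>\<^bsub>M\<^esub> y" using Y_ex[OF m(1)] by blast
    have "T m = T y" using w Yc by (auto simp: W_def T')
    then have "n \<ominus>\<^bsub>N\<^esub> T y = z"
      using m w Zc T'(1)[OF Yc[OF w(2)]] by (simp add: a_minus_def N.M.a_ac N.M.r_neg)
    then show ?thesis using w m by blast
  qed
  have uniq: "x = x'"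
    if x: "x \<in> Y" "x' \<in> Y" "n \<ominus>\<^bsub>N\<^esub> T x \<in> Z" "n \<ominus>\<^bsub>N\<^esub> T x' \<in> Z" and n: "n \<in> carrier N" for n x x'
  proof -
    have c: "x \<in> carrier M" "x' \<in> carrier M" using x Yc by auto
    then have t: "T x \<in> carrier N" "T x' \<in> carrier N" using T' by auto
    \<comment> \<open>The difference of the two residues lies in \<open>Z\<close> and in the image
      of \<open>T\<close>, hence is zero; so \<open>x\<close> and \<open>x'\<close> differ by an
      element of both \<open>Y\<close> and the kernel.\<close>
    have "(n \<ominus>\<^bsub>N\<^esub> T x') \<ominus>\<^bsub>N\<^esub> (n \<ominus>\<^bsub>N\<^esub> T x) = (n \<oplus>\<^bsub>N\<^esub> \<ominus>\<^bsub>N\<^esub> n) \<oplus>\<^bsub>N\<^esub> (T x \<ominus>\<^bsub>N\<^esub> T x')"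
      using n t by (simp add: a_minus_def N.M.minus_add N.M.a_ac)
    also have "\<dots> = T (x \<ominus>\<^bsub>M\<^esub> x')" using n t c by (simp add: N.M.r_neg Tm)
    finally have "T (x \<ominus>\<^bsub>M\<^esub> x') \<in> Z" using Zm[OF x(4,3)] by simp
    then have "T (x \<ominus>\<^bsub>M\<^esub> x') = \<zero>\<^bsub>N\<^esub>" using Z(2) c by blast
    then have "x \<ominus>\<^bsub>M\<^esub> x' = \<zero>\<^bsub>M\<^esub>" using Ym[OF x(1,2)] Y(2) c by (auto simp: W_def)
    then show ?thesis using c by (simp add: M.M.minus_eq_zero_iff)
  qed
  define U where "U n = (THE x. x \<in> Y \<and> n \<ominus>\<^bsub>N\<^esub> T x \<in> Z)" for n
  have U: "U n \<in> Y" "n \<ominus>\<^bsub>N\<^esub> T (U n) \<in> Z" if "n \<in> carrier N" for n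
    using theI'[of "\<lambda>x. x \<in> Y \<and> n \<ominus>\<^bsub>N\<^esub> T x \<in> Z"] ex[OF that] uniq[OF _ _ _ _ that]
    unfolding U_def by blast+
  have U_eq: "U n = x" if "n \<in> carrier N" "x \<in> Y" "n \<ominus>\<^bsub>N\<^esub> T x \<in> Z" for n x
    using uniq[OF U(1) that(2) U(2) that(3)] that(1) by blast
  have Uc: "U n \<in> carrier M" "T (U n) \<in> carrier N" if "n \<in> carrier N" for n
    using U(1)[OF that] Yc T' by auto
  show thesis
  proof (rule that)
    show "U \<in> linear_maps K N M"
    proof (rule linear_mapsI)
      show "n \<in> carrier N \<Longrightarrow> U n \<in> carrier M" for n by (rule Uc)
    next
      fix n n' assume n: "n \<in> carrier N" "n' \<in> carrier N"
      have "(n \<oplus>\<^bsub>N\<^esub> n') \<ominus>\<^bsub>N\<^esub> T (U n \<oplus>\<^bsub>M\<^esub> U n') = (n \<ominus>\<^bsub>N\<^esub> T (U n)) \<oplus>\<^bsub>N\<^esub> (n' \<ominus>\<^bsub>N\<^esub> T (U n'))"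
        using n Uc by (simp add: T' a_minus_def N.M.minus_add N.M.a_ac)
      then show "U (n \<oplus>\<^bsub>N\<^esub> n') = U n \<oplus>\<^bsub>M\<^esub> U n'"
        using n U N.submoduleE(5)[OF Z(1)] M.submoduleE(5)[OF Y(1)] by (intro U_eq) auto
    next
      fix c n assume c: "c \<in> carrier K" "n \<in> carrier N"
      have "(c \<odot>\<^bsub>N\<^esub> n) \<ominus>\<^bsub>N\<^esub> T (c \<odot>\<^bsub>M\<^esub> U n) = c \<odot>\<^bsub>N\<^esub> (n \<ominus>\<^bsub>N\<^esub> T (U n))"
        using c Uc by (simp add: T' a_minus_def N.smult_r_distr N.smult_r_minus)
      then show "U (c \<odot>\<^bsub>N\<^esub> n) = c \<odot>\<^bsub>M\<^esub> U n"
        using c U N.submoduleE(4)[OF Z(1)] M.submoduleE(4)[OF Y(1)] by (intro U_eq) auto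
    qed
  next
    fix x assume x: "x \<in> carrier M"
    have t: "T x \<in> carrier N" and u: "U (T x) \<in> carrier M" using x Uc(1) T' by auto
    \<comment> \<open>The residue of \<open>T x\<close> lies in the image of \<open>T\<close> as
      well as in \<open>Z\<close>, so it vanishes.\<close>
    have "T (x \<ominus>\<^bsub>M\<^esub> U (T x)) \<in> Z" using U(2)[OF t] by (simp add: Tm[OF x u])
    then have "T x \<ominus>\<^bsub>N\<^esub> T (U (T x)) = \<zero>\<^bsub>N\<^esub>" using Z(2) x u by (simp add: Tm[OF x u, symmetric]) blast
    then show "T (U (T x)) = T x" using t Uc by (simp add: N.M.minus_eq_zero_iff)
  qed
qed

section \<open>The antipode\<close>

context hopf_algebra begin

text \<open>In this family the first of the two side words names the antipode axiom used, the second
  the slot in which the product collapses. Here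
  \<open>x\<^sub>1 S x\<^sub>2 \<otimes> x\<^sub>3\<close> becomes \<open>1 \<otimes> x\<close>:
  coassociativity puts the two factors into one inner sum, the axiom leaves
  \<open>\<epsilon>\<close>, and the counit absorbs it.\<close>

lemma sw_cancel_right_left:
  assumes P: "module K P" and \<Gamma>: "\<Gamma> \<in> bilinear_maps K A A P" and x: "x \<in> carrier A"
  shows "sw P x (\<lambda>a b. sw P b (\<lambda>c d. \<Gamma> (a \<otimes>\<^bsub>A\<^esub> S c) d)) = \<Gamma> \<one>\<^bsub>A\<^esub> x"
proof -
  note l = bilinear_maps_lin[OF \<Gamma>] bilinear_mapsD(1,2)[OF \<Gamma>]
  have "sw P x (\<lambda>a b. sw P b (\<lambda>c d. \<Gamma> (a \<otimes>\<^bsub>A\<^esub> S c) d)) =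
      sw P x (\<lambda>a b. sw P a (\<lambda>c d. \<Gamma> (c \<otimes>\<^bsub>A\<^esub> S d) b))"
    using P x by (intro sw_coassoc[symmetric]) (auto intro!: lin_intros l)
  also have "\<dots> = sw P x (\<lambda>a b. \<epsilon> a \<odot>\<^bsub>P\<^esub> \<Gamma> \<one>\<^bsub>A\<^esub> b)"
    using P by (intro sweedler_cong refl sw_antipode_right) (auto intro!: l)
  also have "\<dots> = \<Gamma> \<one>\<^bsub>A\<^esub> x"
    using P x by (intro sw_counit_left) (auto intro!: l)
  finally show ?thesis .
qed

lemma sw_cancel_left_left:
  assumes P: "module K P" and \<Gamma>: "\<Gamma> \<in> bilinear_maps K A A P" and x: "x \<in> carrier A"
  shows "sw P x (\<lambda>a b. sw P b (\<lambda>c d. \<Gamma> (S a \<otimes>\<^bsub>A\<^esub> c) d)) = \<Gamma> \<one>\<^bsub>A\<^esub> x"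
proof -
  note l = bilinear_maps_lin[OF \<Gamma>] bilinear_mapsD(1,2)[OF \<Gamma>]
  have "sw P x (\<lambda>a b. sw P b (\<lambda>c d. \<Gamma> (S a \<otimes>\<^bsub>A\<^esub> c) d)) =
      sw P x (\<lambda>a b. sw P a (\<lambda>c d. \<Gamma> (S c \<otimes>\<^bsub>A\<^esub> d) b))"
    using P x by (intro sw_coassoc[symmetric]) (auto intro!: lin_intros l)
  also have "\<dots> = sw P x (\<lambda>a b. \<epsilon> a \<odot>\<^bsub>P\<^esub> \<Gamma> \<one>\<^bsub>A\<^esub> b)"
    using P by (intro sweedler_cong refl sw_antipode_left) (auto intro!: l)
  also have "\<dots> = \<Gamma> \<one>\<^bsub>A\<^esub> x"
    using P x by (intro sw_counit_left) (auto intro!: l)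
  finally show ?thesis .
qed

lemma sw_cancel_right_right:
  assumes P: "module K P" and \<Gamma>: "\<Gamma> \<in> bilinear_maps K A A P" and x: "x \<in> carrier A"
  shows "sw P x (\<lambda>a b. sw P b (\<lambda>c d. \<Gamma> a (c \<otimes>\<^bsub>A\<^esub> S d))) = \<Gamma> x \<one>\<^bsub>A\<^esub>"
proof -
  note l = bilinear_maps_lin[OF \<Gamma>] bilinear_mapsD(1,2)[OF \<Gamma>]
  have "sw P x (\<lambda>a b. sw P b (\<lambda>c d. \<Gamma> a (c \<otimes>\<^bsub>A\<^esub> S d))) = sw P x (\<lambda>a b. \<epsilon> b \<odot>\<^bsub>P\<^esub> \<Gamma> a \<one>\<^bsub>A\<^esub>)"
    using P by (intro sweedler_cong refl sw_antipode_right) (auto intro!: l)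
  also have "\<dots> = \<Gamma> x \<one>\<^bsub>A\<^esub>"
    using P x by (intro sw_counit_right) (auto intro!: l)
  finally show ?thesis .
qed

text \<open>In \<open>x\<^sub>1 \<otimes> S x\<^sub>2 x\<^sub>3 \<otimes> x\<^sub>4\<close>,
  bracketed in two pairs, rebracketing to the right isolates the last three legs, where
  \<open>sw_cancel_left_left\<close> applies.\<close>

lemma sw_cancel_left_middle:
  assumes P: "module K P" and \<Psi>: "\<Psi> \<in> trilinear_maps K A A A P" and x: "x \<in> carrier A"
  shows "sw P x (\<lambda>a b. sw P a (\<lambda>c d. sw P b (\<lambda>e f. \<Psi> c (S d \<otimes>\<^bsub>A\<^esub> e) f))) =
    sw P x (\<lambda>a b. \<Psi> a \<one>\<^bsub>A\<^esub> b)"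
proof -
  note l = trilinear_maps_lin[OF \<Psi>]
  have "sw P x (\<lambda>a b. sw P a (\<lambda>c d. sw P b (\<lambda>e f. \<Psi> c (S d \<otimes>\<^bsub>A\<^esub> e) f))) =
      sw P x (\<lambda>a b. sw P b (\<lambda>c d. sw P d (\<lambda>e f. \<Psi> a (S c \<otimes>\<^bsub>A\<^esub> e) f)))"
    using P x by (intro sw_coassoc) (auto intro!: lin_intros l)
  also have "\<dots> = sw P x (\<lambda>a b. \<Psi> a \<one>\<^bsub>A\<^esub> b)"
    using P by (intro sweedler_cong refl sw_cancel_left_left) (auto intro: trilinear_mapsD(2)[OF \<Psi>])
  finally show ?thesis .
qed

lemma sw_cancel_right_middle:
  assumes P: "module K P" and \<Psi>: "\<Psi> \<in> trilinear_maps K A A A P" and x: "x \<in> carrier A"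
  shows "sw P x (\<lambda>a b. sw P a (\<lambda>c d. sw P b (\<lambda>e f. \<Psi> c (d \<otimes>\<^bsub>A\<^esub> S e) f))) =
    sw P x (\<lambda>a b. \<Psi> a \<one>\<^bsub>A\<^esub> b)"
proof -
  note l = trilinear_maps_lin[OF \<Psi>]
  have "sw P x (\<lambda>a b. sw P a (\<lambda>c d. sw P b (\<lambda>e f. \<Psi> c (d \<otimes>\<^bsub>A\<^esub> S e) f))) =
      sw P x (\<lambda>a b. sw P b (\<lambda>c d. sw P d (\<lambda>e f. \<Psi> a (c \<otimes>\<^bsub>A\<^esub> S e) f)))"
    using P x by (intro sw_coassoc) (auto intro!: lin_intros l)
  also have "\<dots> = sw P x (\<lambda>a b. \<Psi> a \<one>\<^bsub>A\<^esub> b)"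
    using P by (intro sweedler_cong refl sw_cancel_right_left) (auto intro: trilinear_mapsD(2)[OF \<Psi>])
  finally show ?thesis .
qed

section \<open>The antipode preserves unit and counit and reverses products and coproducts\<close>

lemma antipode_one [simp]: "S \<one>\<^bsub>A\<^esub> = \<one>\<^bsub>A\<^esub>"
  using sw_antipode_left[OF mod_A linear_maps_id A.one_closed]
  by (subst (asm) sw_one) (auto intro!: lin_intros)

text \<open>From \<open>\<epsilon> (S x) = \<epsilon> (S x\<^sub>1) \<epsilon> (x\<^sub>2) =
  \<epsilon> (S x\<^sub>1 x\<^sub>2) = \<epsilon> x\<close>. Sweedler sums take values in module
  records and \<open>K\<close> is only a ring record, so the scalars are carried as multiples of the
  unit of A; a last application of \<open>\<epsilon>\<close> recovers them.\<close>

lemma counit_antipode [simp]: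
  assumes x: "x \<in> carrier A"
  shows "\<epsilon> (S x) = \<epsilon> x"
proof -
  have f: "(\<lambda>y. \<epsilon> y \<odot>\<^bsub>A\<^esub> \<one>\<^bsub>A\<^esub>) \<in> linear_maps K A A" by (auto intro!: lin_intros)
  have "\<epsilon> (S x) \<odot>\<^bsub>A\<^esub> \<one>\<^bsub>A\<^esub> = sw A x (\<lambda>a b. \<epsilon> b \<odot>\<^bsub>A\<^esub> (\<epsilon> (S a) \<odot>\<^bsub>A\<^esub> \<one>\<^bsub>A\<^esub>))"
    using x by (intro sw_counit_right[symmetric]) (auto intro!: lin_intros)
  also have "\<dots> = sw A x (\<lambda>a b. \<epsilon> (S a \<otimes>\<^bsub>A\<^esub> b) \<odot>\<^bsub>A\<^esub> \<one>\<^bsub>A\<^esub>)"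
    by (simp add: smult_assoc1[symmetric] m_comm)
  also have "\<dots> = \<epsilon> x \<odot>\<^bsub>A\<^esub> \<one>\<^bsub>A\<^esub>"
    using x by (subst sw_antipode_left[OF mod_A f]) auto
  finally have "\<epsilon> (\<epsilon> (S x) \<odot>\<^bsub>A\<^esub> \<one>\<^bsub>A\<^esub>) = \<epsilon> (\<epsilon> x \<odot>\<^bsub>A\<^esub> \<one>\<^bsub>A\<^esub>)" by simp
  then show ?thesis using x by (simp add: counit_smult)
qed

text \<open>Uniqueness of convolution inverses: both sides invert the multiplication on A \<otimes>
  A. The common expression \<open>?E\<close> is \<open>S (x\<^sub>1 y\<^sub>1) x\<^sub>2 y\<^sub>2 S
  y\<^sub>3 S x\<^sub>3\<close>, collapsed once from the right and once from the left.\<close>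

lemma antipode_mult:
  assumes x: "x \<in> carrier A" and y: "y \<in> carrier A"
  shows "S (x \<otimes>\<^bsub>A\<^esub> y) = S y \<otimes>\<^bsub>A\<^esub> S x"
proof -
  define \<Theta> where "\<Theta> a b c d e f = S (a \<otimes>\<^bsub>A\<^esub> b) \<otimes>\<^bsub>A\<^esub> (c \<otimes>\<^bsub>A\<^esub> d) \<otimes>\<^bsub>A\<^esub> (S f \<otimes>\<^bsub>A\<^esub> S e)" for a b c d e f
  have \<Theta>_lin:
    "(\<lambda>z. \<Theta> (g z) b c d e f) \<in> linear_maps K Z A"
    "(\<lambda>z. \<Theta> a (g z) c d e f) \<in> linear_maps K Z A"
    "(\<lambda>z. \<Theta> a b (g z) d e f) \<in> linear_maps K Z A"
    "(\<lambda>z. \<Theta> a b c (g z) e f) \<in> linear_maps K Z A"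
    "(\<lambda>z. \<Theta> a b c d (g z) f) \<in> linear_maps K Z A"
    "(\<lambda>z. \<Theta> a b c d e (g z)) \<in> linear_maps K Z A"
    if "g \<in> linear_maps K Z A" "a \<in> carrier A" "b \<in> carrier A" "c \<in> carrier A" "d \<in> carrier A"
      "e \<in> carrier A" "f \<in> carrier A" for g a b c d e f and Z :: "('k, 'a) hopf"
    unfolding \<Theta>_def using that by (auto intro!: lin_intros)
  let ?E = "sw A x (\<lambda>a x'. sw A x' (\<lambda>c e. sw A y (\<lambda>b y'. sw A y' (\<lambda>d f. \<Theta> a b c d e f))))"
  have "?E = sw A x (\<lambda>a x'. sw A x' (\<lambda>c e. S (a \<otimes>\<^bsub>A\<^esub> y) \<otimes>\<^bsub>A\<^esub> (c \<otimes>\<^bsub>A\<^esub> S e)))"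
  proof (intro sweedler_cong refl)
    fix a x' c e assume c: "a \<in> carrier A" "x' \<in> carrier A" "c \<in> carrier A" "e \<in> carrier A"
    have "sw A y (\<lambda>b y'. sw A y' (\<lambda>d f. \<Theta> a b c d e f)) =
        sw A y (\<lambda>b y'. sw A y' (\<lambda>d f. S (a \<otimes>\<^bsub>A\<^esub> b) \<otimes>\<^bsub>A\<^esub> (c \<otimes>\<^bsub>A\<^esub> (d \<otimes>\<^bsub>A\<^esub> S f) \<otimes>\<^bsub>A\<^esub> S e)))"
      using c by (simp add: \<Theta>_def A.m_assoc)
    also have "\<dots> = S (a \<otimes>\<^bsub>A\<^esub> y) \<otimes>\<^bsub>A\<^esub> (c \<otimes>\<^bsub>A\<^esub> \<one>\<^bsub>A\<^esub> \<otimes>\<^bsub>A\<^esub> S e)"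
      using c y by (subst sw_cancel_right_right) (auto intro!: lin_intros)
    finally show "sw A y (\<lambda>b y'. sw A y' (\<lambda>d f. \<Theta> a b c d e f)) =
        S (a \<otimes>\<^bsub>A\<^esub> y) \<otimes>\<^bsub>A\<^esub> (c \<otimes>\<^bsub>A\<^esub> S e)"
      using c by simp
  qed
  also have "\<dots> = S (x \<otimes>\<^bsub>A\<^esub> y)"
    using x y by (subst sw_cancel_right_right) (auto intro!: lin_intros)
  finally have 1: "?E = S (x \<otimes>\<^bsub>A\<^esub> y)" .
  \<comment> \<open>Coassociativity in both variables and one exchange of sums make
    \<open>a b\<close> and \<open>c d\<close> the two legs of a single product \<open>x' y'\<close>,
    to which the antipode axiom applies.\<close>
  have "?E = sw A x (\<lambda>a x'. sw A x' (\<lambda>c e. sw A y (\<lambda>y' f. sw A y' (\<lambda>b d. \<Theta> a b c d e f))))"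
    by (rule sweedler_cong[OF refl], rule sweedler_cong[OF refl], rule sw_coassoc[symmetric])
      (use y in \<open>auto intro!: lin_intros \<Theta>_lin\<close>)
  also have "\<dots> = sw A x (\<lambda>x' e. sw A x' (\<lambda>a c. sw A y (\<lambda>y' f. sw A y' (\<lambda>b d. \<Theta> a b c d e f))))"
    using x y by (intro sw_coassoc[symmetric]) (auto intro!: lin_intros \<Theta>_lin)
  also have "\<dots> = sw A x (\<lambda>x' e. sw A y (\<lambda>y' f. sw A x' (\<lambda>a c. sw A y' (\<lambda>b d. \<Theta> a b c d e f))))"
    by (rule sweedler_cong[OF refl], rule sw_swap)
      (use y in \<open>auto intro!: lin_intros \<Theta>_lin\<close>)
  also have "\<dots> = sw A x (\<lambda>x' e. sw A y (\<lambda>y' f. \<epsilon> x' \<odot>\<^bsub>A\<^esub> (\<epsilon> y' \<odot>\<^bsub>A\<^esub> (S f \<otimes>\<^bsub>A\<^esub> S e))))"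
  proof (intro sweedler_cong refl)
    fix x' e y' f
    assume c: "x' \<in> carrier A" "e \<in> carrier A" "y' \<in> carrier A" "f \<in> carrier A"
    have "sw A x' (\<lambda>a c. sw A y' (\<lambda>b d. \<Theta> a b c d e f)) =
        sw A (x' \<otimes>\<^bsub>A\<^esub> y') (\<lambda>a b. S a \<otimes>\<^bsub>A\<^esub> b \<otimes>\<^bsub>A\<^esub> (S f \<otimes>\<^bsub>A\<^esub> S e))"
      unfolding \<Theta>_def using c by (intro sw_mult[symmetric]) (auto intro!: lin_intros)
    also have "\<dots> = \<epsilon> (x' \<otimes>\<^bsub>A\<^esub> y') \<odot>\<^bsub>A\<^esub> (\<one>\<^bsub>A\<^esub> \<otimes>\<^bsub>A\<^esub> (S f \<otimes>\<^bsub>A\<^esub> S e))"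
      using c by (intro sw_antipode_left) (auto intro!: lin_intros)
    finally show "sw A x' (\<lambda>a c. sw A y' (\<lambda>b d. \<Theta> a b c d e f)) =
        \<epsilon> x' \<odot>\<^bsub>A\<^esub> (\<epsilon> y' \<odot>\<^bsub>A\<^esub> (S f \<otimes>\<^bsub>A\<^esub> S e))"
      using c by (simp add: smult_assoc1)
  qed
  also have "\<dots> = sw A x (\<lambda>x' e. \<epsilon> x' \<odot>\<^bsub>A\<^esub> (S y \<otimes>\<^bsub>A\<^esub> S e))"
  proof (intro sweedler_cong refl)
    fix x' e assume c: "x' \<in> carrier A" "e \<in> carrier A"
    have "sw A y (\<lambda>y' f. \<epsilon> x' \<odot>\<^bsub>A\<^esub> (\<epsilon> y' \<odot>\<^bsub>A\<^esub> (S f \<otimes>\<^bsub>A\<^esub> S e))) =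
        sw A y (\<lambda>y' f. \<epsilon> y' \<odot>\<^bsub>A\<^esub> (\<epsilon> x' \<odot>\<^bsub>A\<^esub> (S f \<otimes>\<^bsub>A\<^esub> S e)))"
      using c by (simp add: smult_assoc1[symmetric] m_comm)
    also have "\<dots> = \<epsilon> x' \<odot>\<^bsub>A\<^esub> (S y \<otimes>\<^bsub>A\<^esub> S e)"
      using c y by (intro sw_counit_left) (auto intro!: lin_intros)
    finally show "sw A y (\<lambda>y' f. \<epsilon> x' \<odot>\<^bsub>A\<^esub> (\<epsilon> y' \<odot>\<^bsub>A\<^esub> (S f \<otimes>\<^bsub>A\<^esub> S e))) = \<dots>" .
  qed
  also have "\<dots> = S y \<otimes>\<^bsub>A\<^esub> S x"
    using x y by (intro sw_counit_left) (auto intro!: lin_intros)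
  finally show ?thesis using 1 by simp
qed

text \<open>Uniqueness of convolution inverses again, now for maps from A to A \<otimes> A:
  \<open>?E\<close> is \<open>\<Delta>(S x\<^sub>1) \<Delta>(x\<^sub>2) (S x\<^sub>4 \<otimes> S
  x\<^sub>3)\<close> seen through \<open>\<beta>\<close>, and both sides of the claim invert the
  coproduct.\<close>

lemma sw_antipode:
  assumes P: "module K P" and \<beta>: "\<beta> \<in> bilinear_maps K A A P" and x: "x \<in> carrier A"
  shows "sw P (S x) \<beta> = sw P x (\<lambda>a b. \<beta> (S b) (S a))"
proof -
  note l = bilinear_maps_lin[OF \<beta>] bilinear_mapsD(1,2)[OF \<beta>] bilinear_mapsD(3)[OF \<beta>]
  define \<Theta> where "\<Theta> p q c d e f = \<beta> (p \<otimes>\<^bsub>A\<^esub> (c \<otimes>\<^bsub>A\<^esub> S f)) (q \<otimes>\<^bsub>A\<^esub> (d \<otimes>\<^bsub>A\<^esub> S e))" for p q c d e f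
  have \<Theta>_lin:
    "(\<lambda>z. \<Theta> (g z) b c d e f) \<in> linear_maps K Z P"
    "(\<lambda>z. \<Theta> a (g z) c d e f) \<in> linear_maps K Z P"
    "(\<lambda>z. \<Theta> a b (g z) d e f) \<in> linear_maps K Z P"
    "(\<lambda>z. \<Theta> a b c (g z) e f) \<in> linear_maps K Z P"
    "(\<lambda>z. \<Theta> a b c d (g z) f) \<in> linear_maps K Z P"
    "(\<lambda>z. \<Theta> a b c d e (g z)) \<in> linear_maps K Z P"
    if "g \<in> linear_maps K Z A" "a \<in> carrier A" "b \<in> carrier A" "c \<in> carrier A" "d \<in> carrier A"
      "e \<in> carrier A" "f \<in> carrier A" for g a b c d e f and Z :: "('k, 'a) hopf"
    unfolding \<Theta>_def using that by (auto intro!: lin_intros l)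
  let ?E = "sw P x (\<lambda>u x'. sw P (S u) (\<lambda>p q. sw P x' (\<lambda>v x''.
    sw P v (\<lambda>c d. sw P x'' (\<lambda>e f. \<Theta> p q c d e f)))))"
  have "?E = sw P x (\<lambda>u x'. sw P (S u) (\<lambda>p q. \<epsilon> x' \<odot>\<^bsub>P\<^esub> \<beta> p q))"
  proof (intro sweedler_cong refl)
    fix u x' p q assume c: "u \<in> carrier A" "x' \<in> carrier A" "p \<in> carrier A" "q \<in> carrier A"
    \<comment> \<open>The neighbouring legs \<open>d\<close> and \<open>e\<close> cancel first,
      which makes \<open>c\<close> and \<open>f\<close> the two legs of \<open>x'\<close> and allows
      a second cancellation.\<close>
    have "sw P x' (\<lambda>v x''. sw P v (\<lambda>c d. sw P x'' (\<lambda>e f. \<Theta> p q c d e f))) =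
        sw P x' (\<lambda>c f. \<beta> (p \<otimes>\<^bsub>A\<^esub> (c \<otimes>\<^bsub>A\<^esub> S f)) (q \<otimes>\<^bsub>A\<^esub> \<one>\<^bsub>A\<^esub>))"
      unfolding \<Theta>_def using c P by (intro sw_cancel_right_middle) (auto intro!: lin_intros l)
    also have "\<dots> = \<epsilon> x' \<odot>\<^bsub>P\<^esub> \<beta> (p \<otimes>\<^bsub>A\<^esub> \<one>\<^bsub>A\<^esub>) (q \<otimes>\<^bsub>A\<^esub> \<one>\<^bsub>A\<^esub>)"
      using c P by (intro sw_antipode_right) (auto intro!: lin_intros l)
    finally show "sw P x' (\<lambda>v x''. sw P v (\<lambda>c d. sw P x'' (\<lambda>e f. \<Theta> p q c d e f))) = \<epsilon> x' \<odot>\<^bsub>P\<^esub> \<beta> p q"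
      using c by simp
  qed
  also have "\<dots> = sw P x (\<lambda>u x'. \<epsilon> x' \<odot>\<^bsub>P\<^esub> sw P (S u) \<beta>)"
  proof (intro sweedler_cong refl)
    fix u x' assume c: "u \<in> carrier A" "x' \<in> carrier A"
    interpret P: module K P by fact
    show "sw P (S u) (\<lambda>p q. \<epsilon> x' \<odot>\<^bsub>P\<^esub> \<beta> p q) = \<epsilon> x' \<odot>\<^bsub>P\<^esub> sw P (S u) \<beta>"
      using c P \<beta> by (intro lin_sw[symmetric]) (auto intro!: lin_intros P.smult_lin)
  qed
  also have "\<dots> = sw P (S x) \<beta>"
    using x P \<beta> by (intro sw_counit_right) (auto intro!: lin_intros)
  finally have 1: "?E = sw P (S x) \<beta>" .
  \<comment> \<open>Collapse from the other end: three exchanges make the sums over the legs of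
    \<open>S u\<close> and of \<open>v\<close> adjacent, so that they merge into one sum over the
    legs of \<open>S u v\<close>.\<close>
  have "?E = sw P x (\<lambda>u x'. sw P x' (\<lambda>v x''. sw P (S u) (\<lambda>p q.
      sw P v (\<lambda>c d. sw P x'' (\<lambda>e f. \<Theta> p q c d e f)))))"
    by (rule sweedler_cong[OF refl], rule sw_swap)
      (use P in \<open>auto intro!: lin_intros \<Theta>_lin\<close>)
  also have "\<dots> = sw P x (\<lambda>u x'. sw P x' (\<lambda>v x''. sw P (S u) (\<lambda>p q.
      sw P x'' (\<lambda>e f. sw P v (\<lambda>c d. \<Theta> p q c d e f)))))"
    by (rule sweedler_cong[OF refl], rule sweedler_cong[OF refl], rule sweedler_cong[OF refl], rule sw_swap)
      (use P in \<open>auto intro!: lin_intros \<Theta>_lin\<close>)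
  also have "\<dots> = sw P x (\<lambda>u x'. sw P x' (\<lambda>v x''. sw P x'' (\<lambda>e f.
      sw P (S u) (\<lambda>p q. sw P v (\<lambda>c d. \<Theta> p q c d e f)))))"
    by (rule sweedler_cong[OF refl], rule sweedler_cong[OF refl], rule sw_swap)
      (use P in \<open>auto intro!: lin_intros \<Theta>_lin\<close>)
  also have "\<dots> = sw P x (\<lambda>u x'. sw P x' (\<lambda>v x''. sw P x'' (\<lambda>e f.
      sw P (S u \<otimes>\<^bsub>A\<^esub> v) (\<lambda>p q. \<beta> (p \<otimes>\<^bsub>A\<^esub> S f) (q \<otimes>\<^bsub>A\<^esub> S e)))))"
  proof (rule sweedler_cong[OF refl], rule sweedler_cong[OF refl], rule sweedler_cong[OF refl])
    fix u x' v x'' e f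
    assume c: "u \<in> carrier A" "v \<in> carrier A" "e \<in> carrier A" "f \<in> carrier A"
    have "sw P (S u \<otimes>\<^bsub>A\<^esub> v) (\<lambda>p q. \<beta> (p \<otimes>\<^bsub>A\<^esub> S f) (q \<otimes>\<^bsub>A\<^esub> S e)) =
        sw P (S u) (\<lambda>p q. sw P v (\<lambda>c d. \<beta> (p \<otimes>\<^bsub>A\<^esub> c \<otimes>\<^bsub>A\<^esub> S f) (q \<otimes>\<^bsub>A\<^esub> d \<otimes>\<^bsub>A\<^esub> S e)))"
      using c P by (intro sw_mult) (auto intro!: lin_intros l)
    then show "sw P (S u) (\<lambda>p q. sw P v (\<lambda>c d. \<Theta> p q c d e f)) =
        sw P (S u \<otimes>\<^bsub>A\<^esub> v) (\<lambda>p q. \<beta> (p \<otimes>\<^bsub>A\<^esub> S f) (q \<otimes>\<^bsub>A\<^esub> S e))"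
      using c by (simp add: \<Theta>_def A.m_assoc)
  qed
  also have "\<dots> = sw P x (\<lambda>e f. sw P \<one>\<^bsub>A\<^esub> (\<lambda>p q. \<beta> (p \<otimes>\<^bsub>A\<^esub> S f) (q \<otimes>\<^bsub>A\<^esub> S e)))"
    using x P by (intro sw_cancel_left_left) (auto intro!: lin_intros l)
  also have "\<dots> = sw P x (\<lambda>e f. \<beta> (S f) (S e))"
  proof (intro sweedler_cong refl)
    fix e f assume c: "e \<in> carrier A" "f \<in> carrier A"
    show "sw P \<one>\<^bsub>A\<^esub> (\<lambda>p q. \<beta> (p \<otimes>\<^bsub>A\<^esub> S f) (q \<otimes>\<^bsub>A\<^esub> S e)) = \<beta> (S f) (S e)"
      using c P by (subst sw_one) (auto intro!: lin_intros l)
  qed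
  finally show ?thesis using 1 by simp
qed

end

section \<open>Coinvariants of a cocentral morphism\<close>

lemma (in module_pair) tensor_lift_minus:
  assumes P: "module K P" and \<beta>: "\<beta> \<in> bilinear_maps K M N P" and \<gamma>: "\<gamma> \<in> bilinear_maps K M N P"
    and t: "t \<in> carrier (tensor K M N)"
  shows "tensor_lift K P (\<lambda>x y. \<beta> x y \<ominus>\<^bsub>P\<^esub> \<gamma> x y) t = tensor_lift K P \<beta> t \<ominus>\<^bsub>P\<^esub> tensor_lift K P \<gamma> t"
proof -
  have bil: "(\<lambda>x y. \<beta> x y \<ominus>\<^bsub>P\<^esub> \<gamma> x y) \<in> bilinear_maps K M N P"
    using \<beta> \<gamma> by (auto intro!: bilinear_mapsI module.minus_lin[OF P] intro: bilinear_mapsD(1,2))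
  show ?thesis
    by (rule tensor_ext[OF P lift_linear[OF P bil] module.minus_lin[OF P lift_linear[OF P \<beta>] lift_linear[OF P \<gamma>]] _ t])
      (simp add: tensor_lift_pure P bil \<beta> \<gamma>)
qed

locale cocentral_hom = hopf_algebra K A + Q: hopf_algebra K Q
  for K :: "('k, 'x) ring_scheme" (structure) and A :: "('k, 'a) hopf" (structure)
    and Q :: "('k, 'h) hopf" (structure) +
  fixes \<pi> :: "'a \<Rightarrow> 'h"
  assumes \<pi>_hom: "\<pi> \<in> hopf_hom K A Q" and \<pi>_cocentral: "cocentral K A Q \<pi>"
begin

lemma mod_QA [simp, intro]: "module K (tensor K Q A)" by (simp add: tensor_is_module)
lemma mod_AQ [simp, intro]: "module K (tensor K A Q)" by (simp add: tensor_is_module)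

lemma \<pi>_linear: "\<pi> \<in> linear_maps K A Q"
  using \<pi>_hom by (simp add: hopf_hom_def)

lemma \<pi>_lin [lin_intros]: "f \<in> linear_maps K Z A \<Longrightarrow> (\<lambda>x. \<pi> (f x)) \<in> linear_maps K Z Q"
  by (rule linear_maps_comp[OF _ \<pi>_linear])

lemma \<pi>_closed [simp]: "x \<in> carrier A \<Longrightarrow> \<pi> x \<in> carrier Q"
  using \<pi>_linear by (rule linear_mapsD)

lemma \<pi>_one [simp]: "\<pi> \<one>\<^bsub>A\<^esub> = \<one>\<^bsub>Q\<^esub>"
  and \<pi>_mult: "x \<in> carrier A \<Longrightarrow> y \<in> carrier A \<Longrightarrow> \<pi> (x \<otimes>\<^bsub>A\<^esub> y) = \<pi> x \<otimes>\<^bsub>Q\<^esub> \<pi> y"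
  using \<pi>_hom by (auto simp: hopf_hom_def ring_hom_def)

lemma \<pi>_antipode: "x \<in> carrier A \<Longrightarrow> \<pi> (S x) = antipode Q (\<pi> x)"
  using \<pi>_hom by (simp add: hopf_hom_def)

lemma cocentral_sw:
  assumes P: "module K P" and \<beta>: "\<beta> \<in> bilinear_maps K A Q P" and x: "x \<in> carrier A"
  shows "sw P x (\<lambda>a b. \<beta> a (\<pi> b)) = sw P x (\<lambda>a b. \<beta> b (\<pi> a))"
proof -
  let ?T = "tensor K A Q"
  have g: "tensor_lift K P \<beta> \<in> linear_maps K ?T P"
    by (rule module_pair.lift_linear[OF _ P \<beta>]) (simp add: module_pair_def)
  have bil: "(\<lambda>a b. pure_tensor K A Q a (\<pi> b)) \<in> bilinear_maps K A A ?T"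
    by (auto intro!: lin_intros)
  have f: "tensor_lift K ?T (\<lambda>a b. pure_tensor K A Q a (\<pi> b)) \<in> linear_maps K (tensor K A A) ?T"
    by (rule module_pair.lift_linear[OF pair_AA _ bil]) simp
  have 1: "tensor_map K A Q (\<lambda>y. y) \<pi> (comult A x) = sw ?T x (\<lambda>a b. pure_tensor K A Q a (\<pi> b))"
    unfolding tensor_map_def using x by (intro lift_comult) (auto intro!: lin_intros)
  have "tensor_swap K A A (comult A x) = sw (tensor K A A) x (\<lambda>a b. pure_tensor K A A b a)"
    unfolding tensor_swap_def using x by (intro lift_comult) (auto intro!: lin_intros)
  then have "tensor_map K A Q (\<lambda>y. y) \<pi> (tensor_swap K A A (comult A x)) =
      sw ?T x (\<lambda>a b. tensor_lift K ?T (\<lambda>a b. pure_tensor K A Q a (\<pi> b)) (pure_tensor K A A b a))"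
    unfolding tensor_map_def using x by (simp only:, intro lin_sw[OF _ _ f]) (auto intro!: lin_intros)
  also have "\<dots> = sw ?T x (\<lambda>a b. pure_tensor K A Q b (\<pi> a))"
    using bil by simp
  finally have "sw ?T x (\<lambda>a b. pure_tensor K A Q a (\<pi> b)) = sw ?T x (\<lambda>a b. pure_tensor K A Q b (\<pi> a))"
    using \<pi>_cocentral x 1 by (simp add: cocentral_def)
  moreover have "tensor_lift K P \<beta> (sw ?T x (\<lambda>a b. pure_tensor K A Q a (\<pi> b))) =
      sw P x (\<lambda>a b. tensor_lift K P \<beta> (pure_tensor K A Q a (\<pi> b)))"
    using x P by (intro lin_sw g) (auto intro!: lin_intros)
  moreover have "tensor_lift K P \<beta> (sw ?T x (\<lambda>a b. pure_tensor K A Q b (\<pi> a))) =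
      sw P x (\<lambda>a b. tensor_lift K P \<beta> (pure_tensor K A Q b (\<pi> a)))"
    using x P by (intro lin_sw g) (auto intro!: lin_intros)
  ultimately show ?thesis
    using P \<beta> by simp
qed

text \<open>Left coinvariants, written exactly as in \<open>hopf_exact\<close>, so that the last
  exactness condition holds by unfolding.\<close>

definition coinv :: "'a set"
  where "coinv = {x \<in> carrier A. tensor_map K Q A \<pi> (\<lambda>y. y) (comult A x) = pure_tensor K Q A \<one>\<^bsub>Q\<^esub> x}"

lemma tensor_map_\<pi>:
  "x \<in> carrier A \<Longrightarrow>
    tensor_map K Q A \<pi> (\<lambda>y. y) (comult A x) = sw (tensor K Q A) x (\<lambda>a b. pure_tensor K Q A (\<pi> a) b)"
  unfolding tensor_map_def by (intro lift_comult) (auto intro!: lin_intros)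

lemma coinvI:
  "x \<in> carrier A \<Longrightarrow> sw (tensor K Q A) x (\<lambda>a b. pure_tensor K Q A (\<pi> a) b) = pure_tensor K Q A \<one>\<^bsub>Q\<^esub> x \<Longrightarrow>
    x \<in> coinv"
  by (simp add: coinv_def tensor_map_\<pi>)

lemma coinv_carrier [simp]: "x \<in> coinv \<Longrightarrow> x \<in> carrier A"
  by (simp add: coinv_def)

lemma coinv_sw:
  assumes P: "module K P" and \<beta>: "\<beta> \<in> bilinear_maps K Q A P" and x: "x \<in> coinv"
  shows "sw P x (\<lambda>a b. \<beta> (\<pi> a) b) = \<beta> \<one>\<^bsub>Q\<^esub> x"
proof -
  have e: "sw (tensor K Q A) x (\<lambda>a b. pure_tensor K Q A (\<pi> a) b) = pure_tensor K Q A \<one>\<^bsub>Q\<^esub> x"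
    using x tensor_map_\<pi>[OF coinv_carrier[OF x]] by (simp only: coinv_def mem_Collect_eq)
  have "tensor_lift K P \<beta> \<in> linear_maps K (tensor K Q A) P"
    by (rule module_pair.lift_linear[OF _ P \<beta>]) (simp add: module_pair_def)
  then have "tensor_lift K P \<beta> (sw (tensor K Q A) x (\<lambda>a b. pure_tensor K Q A (\<pi> a) b)) =
      sw P x (\<lambda>a b. tensor_lift K P \<beta> (pure_tensor K Q A (\<pi> a) b))"
    using P x by (intro lin_sw) (auto intro!: lin_intros)
  also have "\<dots> = sw P x (\<lambda>a b. \<beta> (\<pi> a) b)"
    using P \<beta> by simp
  finally show ?thesis
    using P \<beta> x by (simp add: e)
qed

text \<open>Cocentrality, \<open>x\<^sub>1 \<otimes> \<pi> x\<^sub>2 = x\<^sub>2 \<otimes> \<pi>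
  x\<^sub>1\<close>, reduces right coinvariance to left coinvariance.\<close>

lemma coinv_sw_right:
  assumes P: "module K P" and \<beta>: "\<beta> \<in> bilinear_maps K A Q P" and x: "x \<in> coinv"
  shows "sw P x (\<lambda>a b. \<beta> a (\<pi> b)) = \<beta> x \<one>\<^bsub>Q\<^esub>"
proof -
  note l = bilinear_maps_lin[OF \<beta>] bilinear_mapsD(1,2)[OF \<beta>]
  have "sw P x (\<lambda>a b. \<beta> b (\<pi> a)) = \<beta> x \<one>\<^bsub>Q\<^esub>"
    using P x by (intro coinv_sw[where \<beta> = "\<lambda>a b. \<beta> b a"]) (auto intro!: lin_intros l)
  with cocentral_sw[OF P \<beta> coinv_carrier[OF x]] show ?thesis by (rule trans)
qed

text \<open>Not the coaction itself but its deviation from the trivial coaction, so that the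
  coinvariants become the kernel of a linear map.\<close>

definition coact :: "'a \<Rightarrow> ('k, 'h, 'a) tensor"
  where "coact x = sw (tensor K Q A) x (\<lambda>a b. pure_tensor K Q A (\<pi> a) b) \<ominus>\<^bsub>tensor K Q A\<^esub>
    pure_tensor K Q A \<one>\<^bsub>Q\<^esub> x"

lemma coact_linear: "coact \<in> linear_maps K A (tensor K Q A)"
  unfolding coact_def by (auto intro!: lin_intros module.minus_lin[OF mod_QA])

lemma coinv_iff_coact:
  assumes x: "x \<in> carrier A"
  shows "x \<in> coinv \<longleftrightarrow> coact x = \<zero>\<^bsub>tensor K Q A\<^esub>"
proof -
  have 1: "sw (tensor K Q A) x (\<lambda>a b. pure_tensor K Q A (\<pi> a) b) \<in> carrier (tensor K Q A)"
    using x by (intro sw_closed) (auto intro!: lin_intros)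
  have 2: "pure_tensor K Q A \<one>\<^bsub>Q\<^esub> x \<in> carrier (tensor K Q A)"
    using x by simp
  have "abelian_group (tensor K Q A)"
    using mod_QA by (simp add: module_def)
  from abelian_group.minus_eq_zero_iff[OF this 1 2] x show ?thesis
    by (simp only: coinv_def mem_Collect_eq tensor_map_\<pi>[OF x] coact_def simp_thms)
qed

lemma coinv_eq_ker: "coinv = {x \<in> carrier A. coact x = \<zero>\<^bsub>tensor K Q A\<^esub>}"
  using coinv_iff_coact coinv_carrier by blast

lemma coinv_submodule: "submodule coinv K A"
  unfolding coinv_eq_ker by (rule linear_map_ker_submodule[OF mod_A mod_QA coact_linear])

definition coact_inv :: "('k, 'h, 'a) tensor \<Rightarrow> 'a"
  where "coact_inv = (SOME U. U \<in> linear_maps K (tensor K Q A) A \<and>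
    (\<forall>x \<in> carrier A. coact (U (coact x)) = coact x))"

lemma coact_inv:
  "coact_inv \<in> linear_maps K (tensor K Q A) A"
  "x \<in> carrier A \<Longrightarrow> coact (coact_inv (coact x)) = coact x"
proof -
  have "\<exists>U. U \<in> linear_maps K (tensor K Q A) A \<and> (\<forall>x \<in> carrier A. coact (U (coact x)) = coact x)"
    using generalized_inverse[OF field_axioms mod_A mod_QA coact_linear] by metis
  from someI_ex[OF this] show "coact_inv \<in> linear_maps K (tensor K Q A) A"
    "x \<in> carrier A \<Longrightarrow> coact (coact_inv (coact x)) = coact x"
    unfolding coact_inv_def by auto
qed

text \<open>A linear projection of A onto the coinvariants: \<open>coact\<close> kills the result
  because \<open>coact_inv\<close> is a generalized inverse, and the correction term vanishes on
  coinvariants. It depends on the choice of complements and need not respect products or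
  coproducts.\<close>

definition pr :: "'a \<Rightarrow> 'a"
  where "pr x = x \<ominus>\<^bsub>A\<^esub> coact_inv (coact x)"

lemma pr_linear: "pr \<in> linear_maps K A A"
  unfolding pr_def
  by (auto intro!: minus_lin linear_maps_id linear_maps_comp[OF coact_linear coact_inv(1)])

lemma pr_lin [lin_intros]: "f \<in> linear_maps K Z A \<Longrightarrow> (\<lambda>x. pr (f x)) \<in> linear_maps K Z A"
  by (rule linear_maps_comp[OF _ pr_linear])

lemma pr_closed [simp]: "x \<in> carrier A \<Longrightarrow> pr x \<in> carrier A"
  using pr_linear by (rule linear_mapsD)

lemma pr_coinv [simp]:
  assumes x: "x \<in> carrier A"
  shows "pr x \<in> coinv"
proof -
  have ag: "abelian_group (tensor K Q A)"
    using mod_QA by (simp add: module_def)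
  have c: "coact x \<in> carrier (tensor K Q A)"
    using coact_linear x by (rule linear_mapsD)
  have d: "coact_inv (coact x) \<in> carrier A"
    using coact_inv(1) c by (rule linear_mapsD)
  have "coact (pr x) = coact x \<ominus>\<^bsub>tensor K Q A\<^esub> coact (coact_inv (coact x))"
    unfolding pr_def by (rule linear_map_minus[OF mod_A mod_QA coact_linear x d])
  also have "\<dots> = \<zero>\<^bsub>tensor K Q A\<^esub>"
    unfolding coact_inv(2)[OF x] using abelian_group.minus_eq_zero_iff[OF ag c c] by simp
  finally show ?thesis using x by (simp add: coinv_iff_coact)
qed

lemma pr_id [simp]:
  assumes x: "x \<in> coinv"
  shows "pr x = x"
proof -
  have "coact x = \<zero>\<^bsub>tensor K Q A\<^esub>" using x coinv_eq_ker by blast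
  then show ?thesis
    using x linear_map_zero[OF mod_QA mod_A coact_inv(1)] by (simp add: pr_def a_minus_def)
qed

text \<open>
  The hypothesis says, through trilinear maps, that \<open>id \<otimes> coact\<close> annihilates \<open>w\<close>; since
  \<open>pr = id - coact_inv \<circ> coact\<close>, the map \<open>id \<otimes> pr\<close> fixes \<open>w\<close>.
\<close>

lemma tensor_lift_pr:
  assumes P: "module K P" and \<beta>: "\<beta> \<in> bilinear_maps K A A P" and w: "w \<in> carrier (tensor K A A)"
    and hyp: "\<And>\<delta>. \<delta> \<in> trilinear_maps K A Q A P \<Longrightarrow>
      tensor_lift K P (\<lambda>c y. sw P y (\<lambda>e f. \<delta> c (\<pi> e) f)) w = tensor_lift K P (\<lambda>c y. \<delta> c \<one>\<^bsub>Q\<^esub> y) w"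
  shows "tensor_lift K P (\<lambda>c y. \<beta> c (pr y)) w = tensor_lift K P \<beta> w"
proof -
  interpret P: module K P by fact
  note \<beta>l = bilinear_maps_lin[OF \<beta>] bilinear_mapsD(1,2)[OF \<beta>]
  \<comment> \<open>With this choice \<open>?g c y\<close> minus \<open>?h c y\<close> is
    \<open>\<beta> c (coact_inv (coact y))\<close>, precisely the amount by which \<open>pr\<close>
    changes the integrand; the hypothesis makes its total over \<open>w\<close> vanish.\<close>
  define \<delta> where "\<delta> c q f = \<beta> c (coact_inv (pure_tensor K Q A q f))" for c q f
  have U: "(\<lambda>x. coact_inv (f x)) \<in> linear_maps K Z A" if "f \<in> linear_maps K Z (tensor K Q A)"
    for f and Z :: "('k, 'z, 'zz) module_scheme"
    by (rule linear_maps_comp[OF that coact_inv(1)])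
  have Uc: "coact_inv t \<in> carrier A" if "t \<in> carrier (tensor K Q A)" for t
    using coact_inv(1) that by (rule linear_mapsD)
  have \<delta>: "\<delta> \<in> trilinear_maps K A Q A P"
    unfolding \<delta>_def
    by (intro trilinear_mapsI \<beta>l linear_maps_comp[OF _ coact_inv(1)])
      (auto intro!: lin_intros Uc)
  note \<delta>l = trilinear_maps_lin[OF \<delta>]
  let ?g = "\<lambda>c y. sw P y (\<lambda>e f. \<delta> c (\<pi> e) f)" and ?h = "\<lambda>c y. \<delta> c \<one>\<^bsub>Q\<^esub> y"
  have g: "?g \<in> bilinear_maps K A A P" and h: "?h \<in> bilinear_maps K A A P"
    using P by (auto intro!: lin_intros \<delta>l)
  have gh: "(\<lambda>c y. ?g c y \<ominus>\<^bsub>P\<^esub> ?h c y) \<in> bilinear_maps K A A P"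
    using P by (auto intro!: lin_intros P.minus_lin \<delta>l)
  have eq: "\<beta> c (pr y) = \<beta> c y \<ominus>\<^bsub>P\<^esub> (?g c y \<ominus>\<^bsub>P\<^esub> ?h c y)"
    if c: "c \<in> carrier A" and y: "y \<in> carrier A" for c y
  proof -
    let ?f = "\<lambda>t. \<beta> c (coact_inv t)" and ?u = "sw (tensor K Q A) y (\<lambda>a b. pure_tensor K Q A (\<pi> a) b)"
    have f: "?f \<in> linear_maps K (tensor K Q A) P"
      using c by (intro \<beta>l coact_inv(1))
    have coact_c: "coact y \<in> carrier (tensor K Q A)"
      using coact_linear y by (rule linear_mapsD)
    have "\<beta> c (pr y) = \<beta> c y \<ominus>\<^bsub>P\<^esub> ?f (coact y)"
      using y Uc[OF coact_c] linear_map_minus[OF mod_A P bilinear_mapsD(1)[OF \<beta> c]] by (simp add: pr_def)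
    also have "?f (coact y) = ?f ?u \<ominus>\<^bsub>P\<^esub> ?h c y"
      unfolding coact_def \<delta>_def
      using y by (intro linear_map_minus[OF mod_QA P f]) (auto intro!: sw_closed lin_intros)
    also have "?f ?u = ?g c y"
      unfolding \<delta>_def using y P by (intro lin_sw[OF _ _ f]) (auto intro!: lin_intros)
    finally show ?thesis .
  qed
  note bl = module_pair.lift_linear[OF pair_AA P]
  have closed: "tensor_lift K P \<beta> w \<in> carrier P" "tensor_lift K P ?h w \<in> carrier P"
    using linear_mapsD(1)[OF bl w] \<beta> h by blast+
  have "tensor_lift K P (\<lambda>c y. \<beta> c (pr y)) w =
      tensor_lift K P (\<lambda>c y. \<beta> c y \<ominus>\<^bsub>P\<^esub> (?g c y \<ominus>\<^bsub>P\<^esub> ?h c y)) w"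
    using P w by (intro module_pair.tensor_lift_cong[OF pair_AA]) (auto intro!: lin_intros \<beta>l simp: eq)
  also have "\<dots> = tensor_lift K P \<beta> w \<ominus>\<^bsub>P\<^esub> (tensor_lift K P ?g w \<ominus>\<^bsub>P\<^esub> tensor_lift K P ?h w)"
    by (simp only: module_pair.tensor_lift_minus[OF pair_AA P \<beta> gh w]
        module_pair.tensor_lift_minus[OF pair_AA P g h w])
  also have "\<dots> = tensor_lift K P \<beta> w"
    using closed by (simp add: hyp[OF \<delta>] a_minus_def P.M.r_neg)
  finally show ?thesis .
qed

text \<open>The second leg of the coproduct of a coinvariant is coinvariant:
  \<open>x\<^sub>1 \<otimes> \<pi> x\<^sub>2 \<otimes> x\<^sub>3\<close> equals
  \<open>x\<^sub>1 \<otimes> \<pi> x\<^sub>3 \<otimes> x\<^sub>2\<close> by cocentrality, and right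
  coinvariance turns the last leg under \<open>\<pi>\<close> into the unit.\<close>

lemma coinv_pr_right:
  assumes P: "module K P" and \<beta>: "\<beta> \<in> bilinear_maps K A A P" and x: "x \<in> coinv"
  shows "sw P x (\<lambda>a b. \<beta> a (pr b)) = sw P x \<beta>"
proof -
  note \<beta>l = bilinear_maps_lin[OF \<beta>] bilinear_mapsD(1,2)[OF \<beta>]
  have "tensor_lift K P (\<lambda>c y. \<beta> c (pr y)) (comult A x) = tensor_lift K P \<beta> (comult A x)"
  proof (rule tensor_lift_pr[OF P \<beta>])
    show "comult A x \<in> carrier (tensor K A A)" using x by simp
    fix \<delta> assume \<delta>: "\<delta> \<in> trilinear_maps K A Q A P"
    note \<delta>l = trilinear_maps_lin[OF \<delta>]
    have "tensor_lift K P (\<lambda>c y. sw P y (\<lambda>e f. \<delta> c (\<pi> e) f)) (comult A x) =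
        sw P x (\<lambda>c y. sw P y (\<lambda>e f. \<delta> c (\<pi> e) f))"
      using P x by (intro lift_comult) (auto intro!: lin_intros \<delta>l)
    also have "\<dots> = sw P x (\<lambda>c y. sw P y (\<lambda>e f. \<delta> c (\<pi> f) e))"
      using P by (intro sweedler_cong refl cocentral_sw[symmetric]) (auto intro!: lin_intros \<delta>l)
    also have "\<dots> = sw P x (\<lambda>a f. sw P a (\<lambda>c e. \<delta> c (\<pi> f) e))"
      using P x by (intro sw_coassoc[symmetric]) (auto intro!: lin_intros \<delta>l)
    also have "\<dots> = sw P x (\<lambda>c e. \<delta> c \<one>\<^bsub>Q\<^esub> e)"
      using P x by (intro coinv_sw_right) (auto intro!: lin_intros \<delta>l)
    also have "\<dots> = tensor_lift K P (\<lambda>c y. \<delta> c \<one>\<^bsub>Q\<^esub> y) (comult A x)"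
      using P x by (intro lift_comult[symmetric]) (auto intro!: lin_intros \<delta>l)
    finally show "tensor_lift K P (\<lambda>c y. sw P y (\<lambda>e f. \<delta> c (\<pi> e) f)) (comult A x) = \<dots>" .
  qed
  then show ?thesis
    using P x \<beta> by (subst (asm) (1 2) lift_comult) (auto intro!: lin_intros \<beta>l)
qed

text \<open>Since \<open>tensor_lift_pr\<close> projects the second leg, it is applied to the
  flipped coproduct \<open>w\<close>. Its hypothesis then concerns
  \<open>\<pi> x\<^sub>1 \<otimes> x\<^sub>2 \<otimes> x\<^sub>3\<close>, which is left coinvariance
  after rebracketing.\<close>

lemma coinv_pr_left:
  assumes P: "module K P" and \<beta>: "\<beta> \<in> bilinear_maps K A A P" and x: "x \<in> coinv"
  shows "sw P x (\<lambda>a b. \<beta> (pr a) b) = sw P x \<beta>"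
proof -
  note \<beta>l = bilinear_maps_lin[OF \<beta>] bilinear_mapsD(1,2)[OF \<beta>]
  define w where "w = sw (tensor K A A) x (\<lambda>a b. pure_tensor K A A b a)"
  have w: "w \<in> carrier (tensor K A A)"
    unfolding w_def using x by (intro sw_closed) (auto intro!: lin_intros)
  have lift_w: "tensor_lift K P \<gamma> w = sw P x (\<lambda>a b. \<gamma> b a)" if \<gamma>: "\<gamma> \<in> bilinear_maps K A A P" for \<gamma>
    unfolding w_def using P x \<gamma>
    by (subst lin_sw[OF _ P module_pair.lift_linear[OF pair_AA P \<gamma>]]) (auto intro!: lin_intros)
  have "tensor_lift K P (\<lambda>c y. \<beta> (pr y) c) w = tensor_lift K P (\<lambda>c y. \<beta> y c) w"
  proof (rule tensor_lift_pr[OF P _ w])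
    show "(\<lambda>c y. \<beta> y c) \<in> bilinear_maps K A A P" by (auto intro!: lin_intros \<beta>l)
    fix \<delta> assume \<delta>: "\<delta> \<in> trilinear_maps K A Q A P"
    note \<delta>l = trilinear_maps_lin[OF \<delta>]
    have "tensor_lift K P (\<lambda>c y. sw P y (\<lambda>e f. \<delta> c (\<pi> e) f)) w =
        sw P x (\<lambda>a b. sw P a (\<lambda>e f. \<delta> b (\<pi> e) f))"
      using P by (intro lift_w) (auto intro!: lin_intros \<delta>l)
    also have "\<dots> = sw P x (\<lambda>e y. sw P y (\<lambda>f b. \<delta> b (\<pi> e) f))"
      using P x by (intro sw_coassoc) (auto intro!: lin_intros \<delta>l)
    also have "\<dots> = sw P x (\<lambda>f b. \<delta> b \<one>\<^bsub>Q\<^esub> f)"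
      using P x by (intro coinv_sw) (auto intro!: lin_intros \<delta>l)
    also have "\<dots> = tensor_lift K P (\<lambda>c y. \<delta> c \<one>\<^bsub>Q\<^esub> y) w"
      using P by (intro lift_w[symmetric]) (auto intro!: lin_intros \<delta>l)
    finally show "tensor_lift K P (\<lambda>c y. sw P y (\<lambda>e f. \<delta> c (\<pi> e) f)) w = \<dots>" .
  qed
  then show ?thesis
    by (subst (asm) (1 2) lift_w) (auto intro!: lin_intros \<beta>l)
qed

section \<open>Closure of the coinvariants under the algebra operations, the antipode and the
  adjoint action\<close>

lemma coinv_one: "\<one>\<^bsub>A\<^esub> \<in> coinv"
  by (rule coinvI, simp, subst sw_one) (auto intro!: lin_intros)

lemma coinv_mult:
  assumes x: "x \<in> coinv" and y: "y \<in> coinv"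
  shows "x \<otimes>\<^bsub>A\<^esub> y \<in> coinv"
proof (rule coinvI)
  let ?T = "tensor K Q A"
  show "x \<otimes>\<^bsub>A\<^esub> y \<in> carrier A" using x y by simp
  have "sw ?T (x \<otimes>\<^bsub>A\<^esub> y) (\<lambda>a b. pure_tensor K Q A (\<pi> a) b) =
      sw ?T x (\<lambda>a b. sw ?T y (\<lambda>c d. pure_tensor K Q A (\<pi> (a \<otimes>\<^bsub>A\<^esub> c)) (b \<otimes>\<^bsub>A\<^esub> d)))"
    using x y by (intro sw_mult) (auto intro!: lin_intros)
  also have "\<dots> = sw ?T x (\<lambda>a b. sw ?T y (\<lambda>c d. pure_tensor K Q A (\<pi> a \<otimes>\<^bsub>Q\<^esub> \<pi> c) (b \<otimes>\<^bsub>A\<^esub> d)))"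
    by (simp add: \<pi>_mult)
  also have "\<dots> = sw ?T x (\<lambda>a b. pure_tensor K Q A (\<pi> a \<otimes>\<^bsub>Q\<^esub> \<one>\<^bsub>Q\<^esub>) (b \<otimes>\<^bsub>A\<^esub> y))"
    using x y by (intro sweedler_cong refl coinv_sw) (auto intro!: lin_intros)
  also have "\<dots> = pure_tensor K Q A (\<one>\<^bsub>Q\<^esub> \<otimes>\<^bsub>Q\<^esub> \<one>\<^bsub>Q\<^esub>) (x \<otimes>\<^bsub>A\<^esub> y)"
    using x y by (intro coinv_sw) (auto intro!: lin_intros)
  finally show "sw ?T (x \<otimes>\<^bsub>A\<^esub> y) (\<lambda>a b. pure_tensor K Q A (\<pi> a) b) =
      pure_tensor K Q A \<one>\<^bsub>Q\<^esub> (x \<otimes>\<^bsub>A\<^esub> y)" by simp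
qed

text \<open>The antipode reverses the coproduct, so left coinvariance of \<open>S x\<close> comes
  from right coinvariance of \<open>x\<close>.\<close>

lemma coinv_antipode:
  assumes x: "x \<in> coinv"
  shows "S x \<in> coinv"
proof (rule coinvI)
  let ?T = "tensor K Q A"
  show "S x \<in> carrier A" using x by simp
  have "sw ?T (S x) (\<lambda>a b. pure_tensor K Q A (\<pi> a) b) =
      sw ?T x (\<lambda>a b. pure_tensor K Q A (\<pi> (S b)) (S a))"
    using x by (intro sw_antipode) (auto intro!: lin_intros)
  also have "\<dots> = sw ?T x (\<lambda>a b. pure_tensor K Q A (antipode Q (\<pi> b)) (S a))"
    by (simp add: \<pi>_antipode)
  also have "\<dots> = pure_tensor K Q A (antipode Q \<one>\<^bsub>Q\<^esub>) (S x)"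
    using x by (intro coinv_sw_right) (auto intro!: lin_intros)
  finally show "sw ?T (S x) (\<lambda>a b. pure_tensor K Q A (\<pi> a) b) = pure_tensor K Q A \<one>\<^bsub>Q\<^esub> (S x)" by simp
qed

text \<open>The coproduct of \<open>S x\<^sub>1 c x\<^sub>2\<close> is \<open>S x\<^sub>2 c\<^sub>1
  x\<^sub>3 \<otimes> S x\<^sub>1 c\<^sub>2 x\<^sub>4\<close>. Under \<open>\<pi>\<close> on the
  first leg the factor \<open>c\<^sub>1\<close> disappears by coinvariance, and then
  \<open>S x\<^sub>2 x\<^sub>3\<close> cancels.\<close>

lemma coinv_normal:
  assumes c: "c \<in> coinv" and x: "x \<in> carrier A"
  shows "sw A x (\<lambda>a b. S a \<otimes>\<^bsub>A\<^esub> (c \<otimes>\<^bsub>A\<^esub> b)) \<in> coinv" (is "?n \<in> coinv")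
proof (rule coinvI)
  let ?T = "tensor K Q A"
  let ?B = "\<lambda>a b. pure_tensor K Q A (\<pi> a) b"
  show "?n \<in> carrier A" using c x by (intro sw_closed) (auto intro!: lin_intros)
  have B: "(\<lambda>y. sw ?T y ?B) \<in> linear_maps K A ?T" by (auto intro!: lin_intros)
  have "sw ?T ?n ?B = sw ?T x (\<lambda>a b. sw ?T (S a \<otimes>\<^bsub>A\<^esub> (c \<otimes>\<^bsub>A\<^esub> b)) ?B)"
    using c x by (intro lin_sw[OF _ _ B]) (auto intro!: lin_intros)
  also have "\<dots> = sw ?T x (\<lambda>a b. sw ?T a (\<lambda>a1 a2. sw ?T b (\<lambda>b1 b2.
      pure_tensor K Q A (\<pi> (S a2 \<otimes>\<^bsub>A\<^esub> b1)) (S a1 \<otimes>\<^bsub>A\<^esub> (c \<otimes>\<^bsub>A\<^esub> b2)))))"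
  proof (rule sweedler_cong[OF refl])
    fix a b assume ab: "a \<in> carrier A" "b \<in> carrier A"
    have "sw ?T (S a \<otimes>\<^bsub>A\<^esub> (c \<otimes>\<^bsub>A\<^esub> b)) ?B =
        sw ?T (S a) (\<lambda>p q. sw ?T (c \<otimes>\<^bsub>A\<^esub> b) (\<lambda>r s. ?B (p \<otimes>\<^bsub>A\<^esub> r) (q \<otimes>\<^bsub>A\<^esub> s)))"
      using ab c by (intro sw_mult) (auto intro!: lin_intros)
    also have "\<dots> = sw ?T a (\<lambda>p q. sw ?T (c \<otimes>\<^bsub>A\<^esub> b) (\<lambda>r s. ?B (S q \<otimes>\<^bsub>A\<^esub> r) (S p \<otimes>\<^bsub>A\<^esub> s)))"
      using ab c by (intro sw_antipode) (auto intro!: lin_intros)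
    also have "\<dots> = sw ?T a (\<lambda>p q. sw ?T c (\<lambda>c1 c2. sw ?T b (\<lambda>b1 b2.
        ?B (S q \<otimes>\<^bsub>A\<^esub> (c1 \<otimes>\<^bsub>A\<^esub> b1)) (S p \<otimes>\<^bsub>A\<^esub> (c2 \<otimes>\<^bsub>A\<^esub> b2)))))"
      by (rule sweedler_cong[OF refl], rule sw_mult) (use ab c in \<open>auto intro!: lin_intros\<close>)
    also have "\<dots> = sw ?T a (\<lambda>p q. sw ?T c (\<lambda>c1 c2. sw ?T b (\<lambda>b1 b2.
        pure_tensor K Q A (\<pi> (S q) \<otimes>\<^bsub>Q\<^esub> (\<pi> c1 \<otimes>\<^bsub>Q\<^esub> \<pi> b1)) (S p \<otimes>\<^bsub>A\<^esub> (c2 \<otimes>\<^bsub>A\<^esub> b2)))))"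
      by (simp add: \<pi>_mult)
    also have "\<dots> = sw ?T a (\<lambda>p q. sw ?T b (\<lambda>b1 b2.
        pure_tensor K Q A (\<pi> (S q) \<otimes>\<^bsub>Q\<^esub> (\<one>\<^bsub>Q\<^esub> \<otimes>\<^bsub>Q\<^esub> \<pi> b1)) (S p \<otimes>\<^bsub>A\<^esub> (c \<otimes>\<^bsub>A\<^esub> b2))))"
      by (rule sweedler_cong[OF refl], rule coinv_sw) (use ab c in \<open>auto intro!: lin_intros\<close>)
    also have "\<dots> = sw ?T a (\<lambda>a1 a2. sw ?T b (\<lambda>b1 b2.
        pure_tensor K Q A (\<pi> (S a2 \<otimes>\<^bsub>A\<^esub> b1)) (S a1 \<otimes>\<^bsub>A\<^esub> (c \<otimes>\<^bsub>A\<^esub> b2))))"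
      by (simp add: \<pi>_mult)
    finally show "sw ?T (S a \<otimes>\<^bsub>A\<^esub> (c \<otimes>\<^bsub>A\<^esub> b)) ?B = \<dots>" .
  qed
  also have "\<dots> = sw ?T x (\<lambda>a b. pure_tensor K Q A (\<pi> \<one>\<^bsub>A\<^esub>) (S a \<otimes>\<^bsub>A\<^esub> (c \<otimes>\<^bsub>A\<^esub> b)))"
    using x c by (intro sw_cancel_left_middle) (auto intro!: lin_intros)
  also have "\<dots> = pure_tensor K Q A (\<pi> \<one>\<^bsub>A\<^esub>) ?n"
    using x c by (intro lin_sw[symmetric]) (auto intro!: lin_intros)
  finally show "sw ?T ?n ?B = pure_tensor K Q A \<one>\<^bsub>Q\<^esub> ?n" by simp
qed

text \<open>Cocentrality applied to the first two of three legs; coassociativity brackets these two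
  together and afterwards undoes it.\<close>

lemma cocentral_sw_left:
  assumes P: "module K P" and \<gamma>: "\<gamma> \<in> trilinear_maps K A Q A P" and x: "x \<in> carrier A"
  shows "sw P x (\<lambda>a b. sw P b (\<lambda>c d. \<gamma> a (\<pi> c) d)) = sw P x (\<lambda>a b. sw P b (\<lambda>c d. \<gamma> c (\<pi> a) d))"
proof -
  note l = trilinear_maps_lin[OF \<gamma>]
  have "sw P x (\<lambda>a b. sw P b (\<lambda>c d. \<gamma> a (\<pi> c) d)) = sw P x (\<lambda>b d. sw P b (\<lambda>a c. \<gamma> a (\<pi> c) d))"
    using P x by (intro sw_coassoc[symmetric]) (auto intro!: lin_intros l)
  also have "\<dots> = sw P x (\<lambda>b d. sw P b (\<lambda>a c. \<gamma> c (\<pi> a) d))"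
    by (rule sweedler_cong[OF refl], rule cocentral_sw) (use P in \<open>auto intro!: lin_intros l\<close>)
  also have "\<dots> = sw P x (\<lambda>a b. sw P b (\<lambda>c d. \<gamma> c (\<pi> a) d))"
    using P x by (intro sw_coassoc) (auto intro!: lin_intros l)
  finally show ?thesis .
qed

text \<open>The second leg of the coadjoint coaction \<open>x\<^sub>2 \<otimes> S x\<^sub>1 x\<^sub>3\<close> is coinvariant.\<close>

lemma coadjoint_pr:
  assumes P: "module K P" and \<beta>: "\<beta> \<in> bilinear_maps K A A P" and x: "x \<in> carrier A"
  shows "sw P x (\<lambda>a b. sw P b (\<lambda>c d. \<beta> c (pr (S a \<otimes>\<^bsub>A\<^esub> d)))) =
    sw P x (\<lambda>a b. sw P b (\<lambda>c d. \<beta> c (S a \<otimes>\<^bsub>A\<^esub> d)))"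
proof -
  let ?T = "tensor K A A"
  note \<beta>l = bilinear_maps_lin[OF \<beta>] bilinear_mapsD(1,2)[OF \<beta>]
  define w where "w = sw ?T x (\<lambda>a b. sw ?T b (\<lambda>c d. pure_tensor K A A c (S a \<otimes>\<^bsub>A\<^esub> d)))"
  have w: "w \<in> carrier ?T"
    unfolding w_def using x by (intro sw_closed) (auto intro!: lin_intros)
  have lift_w: "tensor_lift K P \<gamma> w = sw P x (\<lambda>a b. sw P b (\<lambda>c d. \<gamma> c (S a \<otimes>\<^bsub>A\<^esub> d)))"
    if \<gamma>: "\<gamma> \<in> bilinear_maps K A A P" for \<gamma>
  proof -
    note lw = lin_sw[OF _ P module_pair.lift_linear[OF pair_AA P \<gamma>]]
    have "tensor_lift K P \<gamma> w =
        sw P x (\<lambda>a b. tensor_lift K P \<gamma> (sw ?T b (\<lambda>c d. pure_tensor K A A c (S a \<otimes>\<^bsub>A\<^esub> d))))"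
      unfolding w_def using x by (intro lw) (auto intro!: lin_intros)
    also have "\<dots> = sw P x (\<lambda>a b. sw P b (\<lambda>c d. tensor_lift K P \<gamma> (pure_tensor K A A c (S a \<otimes>\<^bsub>A\<^esub> d))))"
      by (rule sweedler_cong[OF refl], rule lw) (auto intro!: lin_intros)
    also have "\<dots> = sw P x (\<lambda>a b. sw P b (\<lambda>c d. \<gamma> c (S a \<otimes>\<^bsub>A\<^esub> d)))"
      using P \<gamma> by simp
    finally show ?thesis .
  qed
  have "tensor_lift K P (\<lambda>c y. \<beta> c (pr y)) w = tensor_lift K P \<beta> w"
  proof (rule tensor_lift_pr[OF P \<beta> w])
    fix \<delta> assume \<delta>: "\<delta> \<in> trilinear_maps K A Q A P"
    note \<delta>l = trilinear_maps_lin[OF \<delta>]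
    have "tensor_lift K P (\<lambda>c y. sw P y (\<lambda>e f. \<delta> c (\<pi> e) f)) w =
        sw P x (\<lambda>a b. sw P b (\<lambda>c d. sw P (S a \<otimes>\<^bsub>A\<^esub> d) (\<lambda>e f. \<delta> c (\<pi> e) f)))"
      using P by (intro lift_w) (auto intro!: lin_intros \<delta>l)
    also have "\<dots> = sw P x (\<lambda>a b. sw P b (\<lambda>c d. sw P a (\<lambda>a1 a2. sw P d (\<lambda>d1 d2.
        \<delta> c (\<pi> (S a2) \<otimes>\<^bsub>Q\<^esub> \<pi> d1) (S a1 \<otimes>\<^bsub>A\<^esub> d2)))))"
    proof (rule sweedler_cong[OF refl], rule sweedler_cong[OF refl])
      fix a b c d assume c: "a \<in> carrier A" "b \<in> carrier A" "c \<in> carrier A" "d \<in> carrier A"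
      have "sw P (S a \<otimes>\<^bsub>A\<^esub> d) (\<lambda>e f. \<delta> c (\<pi> e) f) =
          sw P (S a) (\<lambda>p q. sw P d (\<lambda>r s. \<delta> c (\<pi> (p \<otimes>\<^bsub>A\<^esub> r)) (q \<otimes>\<^bsub>A\<^esub> s)))"
        using c P by (intro sw_mult) (auto intro!: lin_intros \<delta>l)
      also have "\<dots> = sw P a (\<lambda>p q. sw P d (\<lambda>r s. \<delta> c (\<pi> (S q \<otimes>\<^bsub>A\<^esub> r)) (S p \<otimes>\<^bsub>A\<^esub> s)))"
        using c P by (intro sw_antipode) (auto intro!: lin_intros \<delta>l)
      finally show "sw P (S a \<otimes>\<^bsub>A\<^esub> d) (\<lambda>e f. \<delta> c (\<pi> e) f) = sw P a (\<lambda>a1 a2. sw P d (\<lambda>d1 d2.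
          \<delta> c (\<pi> (S a2) \<otimes>\<^bsub>Q\<^esub> \<pi> d1) (S a1 \<otimes>\<^bsub>A\<^esub> d2)))"
        by (simp add: \<pi>_mult)
    qed
    also have "\<dots> = sw P x (\<lambda>a b. sw P a (\<lambda>a1 a2. sw P b (\<lambda>c d. sw P d (\<lambda>d1 d2.
        \<delta> c (\<pi> (S a2) \<otimes>\<^bsub>Q\<^esub> \<pi> d1) (S a1 \<otimes>\<^bsub>A\<^esub> d2)))))"
      by (rule sweedler_cong[OF refl], rule sw_swap) (use P in \<open>auto intro!: lin_intros \<delta>l\<close>)
    \<comment> \<open>With five legs, the middle entry so far is
      \<open>\<pi> (S x\<^sub>2) \<pi> (x\<^sub>4)\<close> while \<open>x\<^sub>3\<close> stands in
      the first slot. Cocentrality exchanges \<open>x\<^sub>3\<close> and \<open>x\<^sub>4\<close>,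
      making \<open>S x\<^sub>2\<close> and \<open>x\<^sub>3\<close> neighbours that cancel.\<close>
    also have "\<dots> = sw P x (\<lambda>a b. sw P a (\<lambda>a1 a2. sw P b (\<lambda>c d. sw P d (\<lambda>d1 d2.
        \<delta> d1 (\<pi> (S a2) \<otimes>\<^bsub>Q\<^esub> \<pi> c) (S a1 \<otimes>\<^bsub>A\<^esub> d2)))))"
      by (rule sweedler_cong[OF refl], rule sweedler_cong[OF refl], rule cocentral_sw_left)
        (use P in \<open>auto intro!: lin_intros \<delta>l\<close>)
    also have "\<dots> = sw P x (\<lambda>a b. sw P a (\<lambda>a1 a2. sw P b (\<lambda>c d. sw P d (\<lambda>d1 d2.
        \<delta> d1 (\<pi> (S a2 \<otimes>\<^bsub>A\<^esub> c)) (S a1 \<otimes>\<^bsub>A\<^esub> d2)))))"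
      by (simp add: \<pi>_mult)
    also have "\<dots> = sw P x (\<lambda>a b. sw P b (\<lambda>d1 d2. \<delta> d1 (\<pi> \<one>\<^bsub>A\<^esub>) (S a \<otimes>\<^bsub>A\<^esub> d2)))"
      using P x by (intro sw_cancel_left_middle) (auto intro!: lin_intros \<delta>l)
    also have "\<dots> = tensor_lift K P (\<lambda>c y. \<delta> c \<one>\<^bsub>Q\<^esub> y) w"
      using P by (subst lift_w) (auto intro!: lin_intros \<delta>l)
    finally show "tensor_lift K P (\<lambda>c y. sw P y (\<lambda>e f. \<delta> c (\<pi> e) f)) w = \<dots>" .
  qed
  then show ?thesis
    using \<beta> by (subst (asm) (1 2) lift_w) (auto intro!: lin_intros \<beta>l)
qed

end

section \<open>The Hopf subalgebra of coinvariants\<close>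

lemma tensor_mod_record_cong:
  assumes "carrier M = carrier M'" "add M = add M'" "smult M = smult M'"
    and "carrier N = carrier N'" "add N = add N'" "smult N = smult N'"
  shows "pure_tensor K M N = pure_tensor K M' N'" "tensor_mod K M N = tensor_mod K M' N'"
proof -
  have *: "tensor_rel K M N = tensor_rel K M' N'"
    by (simp add: tensor_rel_def bilinear_rels_def assms)
  show "pure_tensor K M N = pure_tensor K M' N'"
    by (intro ext) (simp add: pure_tensor_def * assms)
  show "tensor_mod K M N = tensor_mod K M' N'"
    by (simp add: tensor_mod_def * assms)
qed

lemma sweedler_tensor_mod: "sweedler K A (tensor_mod K M N) = sweedler K A (tensor K M N)"
  unfolding sweedler_def tensor_lift_tensor_mod tensor_mod_fields ..

context cocentral_hom begin

text \<open>The coproduct of \<open>coinv_hopf\<close> has to land in the tensor square of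
  \<open>coinv_hopf\<close> itself. This record breaks the circularity: by
  \<open>tensor_mod_record_cong\<close> tensors do not depend on the \<open>comult\<close>
  field.\<close>

definition coinv_space :: "('k, 'a) hopf"
  where "coinv_space = A\<lparr>carrier := coinv\<rparr>"

text \<open>Tensors over C and over A are cosets of different submodules, so the coproduct of A
  cannot merely be restricted; \<open>pr\<close> in both legs transports it.\<close>

definition coinv_hopf :: "('k, 'a) hopf"
  where "coinv_hopf = coinv_space\<lparr>comult := \<lambda>x. sw (tensor_mod K coinv_space coinv_space) x
    (\<lambda>a b. pure_tensor K coinv_space coinv_space (pr a) (pr b))\<rparr>"

abbreviation "C \<equiv> coinv_hopf"

lemma C_fields:
  "carrier C = coinv" "add C = add A" "zero C = zero A" "smult C = smult A"
  "monoid.mult C = monoid.mult A" "one C = one A" "counit C = counit A" "antipode C = antipode A"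
  by (simp_all add: coinv_hopf_def coinv_space_def)

lemma comult_C:
  "comult C x = sw (tensor K C C) x (\<lambda>a b. pure_tensor K C C (pr a) (pr b))"
proof -
  have eqs: "pure_tensor K C C = pure_tensor K coinv_space coinv_space"
    "tensor_mod K C C = tensor_mod K coinv_space coinv_space"
    by (intro tensor_mod_record_cong; simp add: coinv_hopf_def)+
  show ?thesis unfolding sweedler_tensor_mod[symmetric] eqs by (simp add: coinv_hopf_def)
qed

lemma mod_C [simp, intro]: "module K C"
  by (rule module_cong[OF submodule.submodule_is_module[OF coinv_submodule mod_A]])
    (simp_all add: C_fields)

lemma mod_CC [simp, intro]: "module K (tensor K C C)" by (simp add: tensor_is_module)

lemma pair_CC: "module_pair K C C" by (simp add: module_pair_def)

section \<open>The Hopf algebra axioms for the coinvariants\<close>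

lemma assoc_algebra_C: "assoc_algebra K C"
proof -
  interpret C: module K C by simp
  have "ring C"
  proof (rule ringI)
    show "abelian_group C" by (rule C.M.abelian_group_axioms)
    show "Group.monoid C"
      by (rule monoidI) (auto simp: C_fields coinv_mult coinv_one A.m_assoc)
  qed (auto simp: C_fields A.l_distr A.r_distr)
  then show ?thesis
    unfolding assoc_algebra_def
    by (auto simp: assoc_algebra_axioms_def C_fields smult_mult_left smult_mult_right)
qed

lemma pr_C: "x \<in> carrier A \<Longrightarrow> pr x \<in> carrier C"
  by (simp add: C_fields)

lemma pr_lin_C [lin_intros]: "f \<in> linear_maps K Z A \<Longrightarrow> (\<lambda>x. pr (f x)) \<in> linear_maps K Z C"
  using pr_lin[of f Z] by (auto simp: linear_maps_def Pi_def C_fields)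

lemma linear_C_A: "(\<lambda>x. x) \<in> linear_maps K C A"
  by (auto simp: linear_maps_def C_fields)

lemma linear_A_C: "f \<in> linear_maps K A P \<Longrightarrow> f \<in> linear_maps K C P"
  by (auto simp: linear_maps_def C_fields)

text \<open>This is the inclusion of the coproduct of C in C \<otimes> C, in the form through which
  axioms pass from A to C: projections applied to the legs of a coinvariant may be dropped.\<close>

lemma coinv_pr_both:
  assumes P: "module K P" and \<beta>: "\<beta> \<in> bilinear_maps K A A P" and x: "x \<in> coinv"
  shows "sw P x (\<lambda>a b. \<beta> (pr a) (pr b)) = sw P x \<beta>"
proof -
  note l = bilinear_maps_lin[OF \<beta>] bilinear_mapsD(1,2)[OF \<beta>]
  have "sw P x (\<lambda>a b. \<beta> (pr a) (pr b)) = sw P x (\<lambda>a b. \<beta> a (pr b))"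
    using P x by (intro coinv_pr_left[where \<beta> = "\<lambda>a b. \<beta> a (pr b)"]) (auto intro!: lin_intros l)
  also have "\<dots> = sw P x \<beta>"
    by (rule coinv_pr_right[OF P \<beta> x])
  finally show ?thesis .
qed

lemma lift_comult_C:
  assumes P: "module K P" and \<beta>: "\<beta> \<in> bilinear_maps K C C P" and x: "x \<in> carrier A"
  shows "tensor_lift K P \<beta> (comult C x) = sw P x (\<lambda>a b. \<beta> (pr a) (pr b))"
proof -
  have "tensor_lift K P \<beta> (comult C x) =
      sw P x (\<lambda>a b. tensor_lift K P \<beta> (pure_tensor K C C (pr a) (pr b)))"
    unfolding comult_C using P x
    by (intro lin_sw module_pair.lift_linear[OF pair_CC P \<beta>]) (auto intro!: lin_intros pr_C)
  then show ?thesis using P \<beta> by (simp add: pr_C)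
qed

lemma sw_C_A:
  assumes "\<beta> \<in> bilinear_maps K A A C" "x \<in> carrier A"
  shows "sw C x \<beta> = sw A x \<beta>"
  using lin_sw[OF _ _ linear_C_A assms] by simp

lemma comult_C_linear: "comult C \<in> linear_maps K C (tensor K C C)"
proof -
  have "(\<lambda>x. comult C x) \<in> linear_maps K A (tensor K C C)"
    unfolding comult_C by (auto intro!: lin_intros pr_C)
  from linear_A_C[OF this] show ?thesis .
qed

lemma comult_C_mult:
  assumes x: "x \<in> coinv" and y: "y \<in> coinv"
  shows "comult C (x \<otimes>\<^bsub>A\<^esub> y) = comult C x \<otimes>\<^bsub>tensor K C C\<^esub> comult C y"
proof -
  let ?T = "tensor K C C"
  interpret C: assoc_algebra K C by (rule assoc_algebra_C)
  note [simp] = pr_C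
  have xA: "x \<in> carrier A" and yA: "y \<in> carrier A" using x y by auto
  have "comult C x \<otimes>\<^bsub>?T\<^esub> comult C y = tensor_lift K ?T (\<lambda>a b. tensor_lift K ?T (\<lambda>c d.
      pure_tensor K C C (a \<otimes>\<^bsub>C\<^esub> c) (b \<otimes>\<^bsub>C\<^esub> d)) (comult C y)) (comult C x)"
    by (rule tensor_mult)
  also have "\<dots> = sw ?T x (\<lambda>a b. tensor_lift K ?T (\<lambda>c d.
      pure_tensor K C C (pr a \<otimes>\<^bsub>C\<^esub> c) (pr b \<otimes>\<^bsub>C\<^esub> d)) (comult C y))"
    using xA y linear_mapsD(1)[OF comult_C_linear, of y]
    by (intro lift_comult_C) (auto intro!: lin_intros simp: C_fields(1))
  also have "\<dots> = sw ?T x (\<lambda>a b. sw ?T y (\<lambda>c d.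
      pure_tensor K C C (pr a \<otimes>\<^bsub>C\<^esub> pr c) (pr b \<otimes>\<^bsub>C\<^esub> pr d)))"
    by (rule sweedler_cong[OF refl], rule lift_comult_C) (use yA in \<open>auto intro!: lin_intros\<close>)
  \<comment> \<open>Products of coinvariants are coinvariant, so an outer \<open>pr\<close> may be
    added. The integrand is then meaningful on all of A, where \<open>coinv_pr_both\<close> can
    remove the inner projections, first for \<open>y\<close> and then for \<open>x\<close>.\<close>
  also have "\<dots> = sw ?T x (\<lambda>a b. sw ?T y (\<lambda>c d.
      pure_tensor K C C (pr (pr a \<otimes>\<^bsub>A\<^esub> pr c)) (pr (pr b \<otimes>\<^bsub>A\<^esub> pr d))))"
    by (simp add: C_fields coinv_mult)
  also have "\<dots> = sw ?T x (\<lambda>a b. sw ?T y (\<lambda>c d.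
      pure_tensor K C C (pr (pr a \<otimes>\<^bsub>A\<^esub> c)) (pr (pr b \<otimes>\<^bsub>A\<^esub> d))))"
    by (rule sweedler_cong[OF refl],
        rule coinv_pr_both[where \<beta> = "\<lambda>c d. pure_tensor K C C (pr (pr _ \<otimes>\<^bsub>A\<^esub> c)) (pr (pr _ \<otimes>\<^bsub>A\<^esub> d))"])
      (use y in \<open>auto intro!: lin_intros\<close>)
  also have "\<dots> = sw ?T x (\<lambda>a b. sw ?T y (\<lambda>c d. pure_tensor K C C (pr (a \<otimes>\<^bsub>A\<^esub> c)) (pr (b \<otimes>\<^bsub>A\<^esub> d))))"
    using x yA by (intro coinv_pr_both[where
        \<beta> = "\<lambda>a b. sw ?T y (\<lambda>c d. pure_tensor K C C (pr (a \<otimes>\<^bsub>A\<^esub> c)) (pr (b \<otimes>\<^bsub>A\<^esub> d)))"])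
      (auto intro!: lin_intros)
  also have "\<dots> = comult C (x \<otimes>\<^bsub>A\<^esub> y)"
    unfolding comult_C using xA yA by (intro sw_mult[symmetric]) (auto intro!: lin_intros)
  finally show ?thesis ..
qed

text \<open>Either side is the iterated coproduct of A with \<open>pr\<close> in all three legs, up
  to one further \<open>pr\<close> on the leg that is split again. \<open>coinv_pr_left\<close> and
  \<open>coinv_pr_right\<close> account for it; the formula for \<open>comult C\<close> is linear on
  all of A, so unprojected legs may occur in between.\<close>

lemma coassoc_C:
  assumes x: "x \<in> coinv"
  shows "tensor_assoc K C C C (tensor_map K (tensor K C C) C (comult C) (\<lambda>y. y) (comult C x)) =
    tensor_map K C (tensor K C C) (\<lambda>y. y) (comult C) (comult C x)"
proof -
  let ?T = "tensor K C C"
  let ?L = "tensor K ?T C" and ?R = "tensor K C ?T"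
  note [simp] = pr_C
  have xA: "x \<in> carrier A" using x by simp
  have mods: "module K ?L" "module K ?R" by (simp_all add: tensor_is_module)
  have comult_lin: "(\<lambda>y. comult C (f y)) \<in> linear_maps K Z ?T"
    if "f \<in> linear_maps K Z C" for f and Z :: "('k, 'a) hopf"
    by (rule linear_maps_comp[OF that comult_C_linear])
  have comult_closed [simp]: "comult C y \<in> carrier ?T" if "y \<in> carrier C" for y
    using comult_C_linear that by (rule linear_mapsD)
  have comult_pr_lin: "(\<lambda>y. comult C y) \<in> linear_maps K A ?T"
    unfolding comult_C by (auto intro!: lin_intros)
  let ?as = "tensor_assoc K C C C"
  have bil: "(\<lambda>u z. tensor_lift K ?R (\<lambda>x y. pure_tensor K C ?T x (pure_tensor K C C y z)) u)
      \<in> bilinear_maps K ?T C ?R"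
    using mods by (auto intro!: lin_intros)
  have as: "?as \<in> linear_maps K ?L ?R"
    unfolding tensor_assoc_def
    using module_pair.lift_linear[OF _ mods(2) bil] by (simp add: module_pair_def)
  have as_pure: "?as (pure_tensor K ?T C u z) =
      tensor_lift K ?R (\<lambda>x y. pure_tensor K C ?T x (pure_tensor K C C y z)) u"
    if "u \<in> carrier ?T" "z \<in> carrier C" for u z
    unfolding tensor_assoc_def using that bil mods by simp
  let ?\<gamma> = "\<lambda>a b c. pure_tensor K C ?T (pr a) (pure_tensor K C C (pr b) (pr c))"
  have "tensor_map K ?T C (comult C) (\<lambda>y. y) (comult C x) =
      sw ?L x (\<lambda>a b. pure_tensor K ?T C (comult C (pr a)) (pr b))"
    unfolding tensor_map_def using mods xA
    by (intro lift_comult_C) (auto intro!: lin_intros comult_lin)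
  then have "?as (tensor_map K ?T C (comult C) (\<lambda>y. y) (comult C x)) =
      ?as (sw ?L x (\<lambda>a b. pure_tensor K ?T C (comult C (pr a)) (pr b)))"
    by (rule arg_cong)
  also have "\<dots> = sw ?R x (\<lambda>a b. ?as (pure_tensor K ?T C (comult C (pr a)) (pr b)))"
    using mods xA by (intro lin_sw as) (auto intro!: lin_intros comult_lin)
  also have "\<dots> = sw ?R x (\<lambda>a b. tensor_lift K ?R
      (\<lambda>x y. pure_tensor K C ?T x (pure_tensor K C C y (pr b))) (comult C (pr a)))"
    by (intro sweedler_cong refl as_pure) auto
  also have "\<dots> = sw ?R x (\<lambda>a b. sw ?R (pr a) (\<lambda>c d. ?\<gamma> c d b))"
    by (rule sweedler_cong[OF refl], rule lift_comult_C) (use mods in \<open>auto intro!: lin_intros\<close>)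
  also have "\<dots> = sw ?R x (\<lambda>a b. sw ?R a (\<lambda>c d. ?\<gamma> c d b))"
    using mods x by (intro coinv_pr_left) (auto intro!: lin_intros)
  also have "\<dots> = sw ?R x (\<lambda>a b. sw ?R b (\<lambda>c d. ?\<gamma> a c d))"
    using mods xA by (intro sw_coassoc) (auto intro!: lin_intros)
  also have "\<dots> = sw ?R x (\<lambda>a b. pure_tensor K C ?T (pr a) (comult C b))"
    unfolding comult_C
    by (rule sweedler_cong[OF refl], rule lin_sw[symmetric, where P = ?T])
      (use mods in \<open>auto intro!: lin_intros\<close>)
  also have "\<dots> = sw ?R x (\<lambda>a b. pure_tensor K C ?T (pr a) (comult C (pr b)))"
    using mods x
    by (intro coinv_pr_right[symmetric]) (auto intro!: lin_intros linear_maps_comp[OF _ comult_pr_lin] linear_mapsD(1)[OF comult_pr_lin])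
  also have "\<dots> = tensor_map K C ?T (\<lambda>y. y) (comult C) (comult C x)"
    unfolding tensor_map_def using mods xA
    by (intro lift_comult_C[symmetric]) (auto intro!: lin_intros comult_lin)
  finally show ?thesis .
qed

lemma hopf_algebra_C: "hopf_algebra K C"
proof -
  interpret C: assoc_algebra K C by (rule assoc_algebra_C)
  note [simp] = pr_C
  let ?T = "tensor K C C"
  have cc: "x \<in> carrier C \<longleftrightarrow> x \<in> coinv" for x by (simp add: C_fields)
  have antipode_lin_C: "(\<lambda>x. S (f x)) \<in> linear_maps K Z C" if f: "f \<in> linear_maps K Z C"
    for f and Z :: "('k, 'a) hopf"
  proof -
    have "(\<lambda>x. S (f x)) \<in> linear_maps K Z A"
      by (intro antipode_lin linear_maps_comp[OF f linear_C_A])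
    then show ?thesis
      using f by (auto simp: linear_maps_def Pi_def C_fields coinv_antipode)
  qed
  have counit_lin_C: "(\<lambda>x. \<epsilon> (f x) \<odot>\<^bsub>P\<^esub> v) \<in> linear_maps K Z P"
    if "module K P" "f \<in> linear_maps K Z C" "v \<in> carrier P" for f v
      and P Z :: "('k, 'a) hopf"
    by (rule counit_lin[OF that(1) linear_maps_comp[OF that(2) linear_C_A] that(3)])
  show ?thesis
  proof (unfold_locales)
    show "comult C \<in> ring_hom C ?T"
    proof (rule ring_hom_memI)
      show "x \<in> carrier C \<Longrightarrow> comult C x \<in> carrier ?T" for x
        using comult_C_linear by (rule linear_mapsD)
      show "x \<in> carrier C \<Longrightarrow> y \<in> carrier C \<Longrightarrow>
          comult C (x \<otimes>\<^bsub>C\<^esub> y) = comult C x \<otimes>\<^bsub>?T\<^esub> comult C y" for x y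
        by (simp add: C_fields comult_C_mult)
      show "x \<in> carrier C \<Longrightarrow> y \<in> carrier C \<Longrightarrow>
          comult C (x \<oplus>\<^bsub>C\<^esub> y) = comult C x \<oplus>\<^bsub>?T\<^esub> comult C y" for x y
        using comult_C_linear by (rule linear_mapsD)
      have "comult C \<one>\<^bsub>A\<^esub> = pure_tensor K C C (pr \<one>\<^bsub>A\<^esub>) (pr \<one>\<^bsub>A\<^esub>)"
        unfolding comult_C by (intro sw_one) (auto intro!: lin_intros)
      then show "comult C \<one>\<^bsub>C\<^esub> = \<one>\<^bsub>?T\<^esub>"
        by (simp add: tensor_one C_fields coinv_one)
    qed
    show "comult C \<in> linear_maps K C ?T" by (rule comult_C_linear)
    show "counit C \<in> ring_hom C K"
      by (rule ring_hom_memI) (auto simp: C_fields)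
    show "antipode C \<in> linear_maps K C C"
      using antipode_lin_C[OF linear_maps_id] by (simp add: C_fields(8))
    show "counit C (c \<odot>\<^bsub>C\<^esub> x) = c \<otimes>\<^bsub>K\<^esub> counit C x"
      if "c \<in> carrier K" "x \<in> carrier C" for c x
      using that by (simp add: C_fields counit_smult)
  next
    fix x assume "x \<in> carrier C"
    then have x: "x \<in> coinv" and xA: "x \<in> carrier A" by (auto simp: C_fields)
    show "tensor_assoc K C C C (tensor_map K ?T C (comult C) (\<lambda>y. y) (comult C x)) =
        tensor_map K C ?T (\<lambda>y. y) (comult C) (comult C x)"
      by (rule coassoc_C[OF x])
    \<comment> \<open>The counit and antipode axioms share one route: expand
      \<open>comult C\<close>, read the sum in A instead of C, drop the projections, and use the
      corresponding axiom of A.\<close>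
    have "tensor_lift K C (\<lambda>y z. \<epsilon> y \<odot>\<^bsub>C\<^esub> z) (comult C x) = sw C x (\<lambda>a b. \<epsilon> (pr a) \<odot>\<^bsub>C\<^esub> pr b)"
      using xA by (intro lift_comult_C) (auto intro!: lin_intros counit_lin_C simp: cc)
    also have "\<dots> = sw A x (\<lambda>a b. \<epsilon> (pr a) \<odot>\<^bsub>C\<^esub> pr b)"
      using xA by (intro sw_C_A) (auto intro!: lin_intros)
    also have "\<dots> = sw A x (\<lambda>a b. \<epsilon> (pr a) \<odot>\<^bsub>A\<^esub> pr b)"
      by (simp add: C_fields)
    also have "\<dots> = sw A x (\<lambda>a b. \<epsilon> a \<odot>\<^bsub>A\<^esub> b)"
      using x by (intro coinv_pr_both) (auto intro!: lin_intros)
    also have "\<dots> = x"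
      using xA by (intro sw_counit_left) (auto intro!: lin_intros)
    finally show "tensor_lift K C (\<lambda>y z. counit C y \<odot>\<^bsub>C\<^esub> z) (comult C x) = x"
      by (simp only: C_fields(7))
    have "tensor_lift K C (\<lambda>y z. \<epsilon> z \<odot>\<^bsub>C\<^esub> y) (comult C x) = sw C x (\<lambda>a b. \<epsilon> (pr b) \<odot>\<^bsub>C\<^esub> pr a)"
      using xA by (intro lift_comult_C) (auto intro!: lin_intros counit_lin_C simp: cc)
    also have "\<dots> = sw A x (\<lambda>a b. \<epsilon> (pr b) \<odot>\<^bsub>C\<^esub> pr a)"
      using xA by (intro sw_C_A) (auto intro!: lin_intros)
    also have "\<dots> = sw A x (\<lambda>a b. \<epsilon> (pr b) \<odot>\<^bsub>A\<^esub> pr a)"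
      by (simp add: C_fields)
    also have "\<dots> = sw A x (\<lambda>a b. \<epsilon> b \<odot>\<^bsub>A\<^esub> a)"
      using x by (intro coinv_pr_both) (auto intro!: lin_intros)
    also have "\<dots> = x"
      using xA by (intro sw_counit_right) (auto intro!: lin_intros)
    finally show "tensor_lift K C (\<lambda>y z. counit C z \<odot>\<^bsub>C\<^esub> y) (comult C x) = x"
      by (simp only: C_fields(7))
    have "tensor_lift K C (\<lambda>y z. S y \<otimes>\<^bsub>C\<^esub> z) (comult C x) = sw C x (\<lambda>a b. S (pr a) \<otimes>\<^bsub>C\<^esub> pr b)"
      using xA by (intro lift_comult_C)
        (auto intro!: lin_intros antipode_lin_C simp: C_fields(1) coinv_antipode)
    also have "\<dots> = sw A x (\<lambda>a b. S (pr a) \<otimes>\<^bsub>C\<^esub> pr b)"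
      using xA by (intro sw_C_A)
        (auto intro!: lin_intros antipode_lin_C simp: C_fields(1) coinv_antipode)
    also have "\<dots> = sw A x (\<lambda>a b. S (pr a) \<otimes>\<^bsub>A\<^esub> pr b)"
      by (simp add: C_fields)
    also have "\<dots> = sw A x (\<lambda>a b. S a \<otimes>\<^bsub>A\<^esub> b)"
      using x by (intro coinv_pr_both) (auto intro!: lin_intros)
    also have "\<dots> = \<epsilon> x \<odot>\<^bsub>A\<^esub> \<one>\<^bsub>A\<^esub>"
      using xA by (intro sw_antipode_left) (auto intro!: lin_intros)
    finally show "tensor_lift K C (\<lambda>y z. antipode C y \<otimes>\<^bsub>C\<^esub> z) (comult C x) =
        counit C x \<odot>\<^bsub>C\<^esub> \<one>\<^bsub>C\<^esub>"
      by (simp only: C_fields(4,6,7,8))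
    have "tensor_lift K C (\<lambda>y z. y \<otimes>\<^bsub>C\<^esub> S z) (comult C x) = sw C x (\<lambda>a b. pr a \<otimes>\<^bsub>C\<^esub> S (pr b))"
      using xA by (intro lift_comult_C)
        (auto intro!: lin_intros antipode_lin_C simp: C_fields(1) coinv_antipode)
    also have "\<dots> = sw A x (\<lambda>a b. pr a \<otimes>\<^bsub>C\<^esub> S (pr b))"
      using xA by (intro sw_C_A)
        (auto intro!: lin_intros antipode_lin_C simp: C_fields(1) coinv_antipode)
    also have "\<dots> = sw A x (\<lambda>a b. pr a \<otimes>\<^bsub>A\<^esub> S (pr b))"
      by (simp add: C_fields)
    also have "\<dots> = sw A x (\<lambda>a b. a \<otimes>\<^bsub>A\<^esub> S b)"
      using x by (intro coinv_pr_both) (auto intro!: lin_intros)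
    also have "\<dots> = \<epsilon> x \<odot>\<^bsub>A\<^esub> \<one>\<^bsub>A\<^esub>"
      using xA by (intro sw_antipode_right) (auto intro!: lin_intros)
    finally show "tensor_lift K C (\<lambda>y z. y \<otimes>\<^bsub>C\<^esub> antipode C z) (comult C x) =
        counit C x \<odot>\<^bsub>C\<^esub> \<one>\<^bsub>C\<^esub>"
      by (simp only: C_fields(4,6,7,8))
  qed
qed

lemma inclusion_hopf_hom: "(\<lambda>x. x) \<in> hopf_hom K C A"
proof -
  have "comult A x = tensor_map K A A (\<lambda>x. x) (\<lambda>x. x) (comult C x)" if x: "x \<in> coinv" for x
  proof -
    have "tensor_map K A A (\<lambda>x. x) (\<lambda>x. x) (comult C x) =
        sw (tensor K A A) x (\<lambda>a b. pure_tensor K A A (pr a) (pr b))"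
      unfolding tensor_map_def using x
      by (intro lift_comult_C) (auto intro!: lin_intros linear_C_A simp: C_fields)
    also have "\<dots> = sw (tensor K A A) x (\<lambda>a b. pure_tensor K A A a b)"
      using x by (intro coinv_pr_both) (auto intro!: lin_intros)
    finally show ?thesis using x by (simp add: comult_eq_sw)
  qed
  then show ?thesis
    by (auto simp: hopf_hom_def C_fields linear_C_A intro!: ring_hom_memI)
qed

end

section \<open>Quotients by Hopf ideals\<close>

text \<open>The coideal condition, usually that the coproduct of I lies in I \<otimes> A + A
  \<otimes> I, is expressed as vanishing in A/I \<otimes> A/I. This avoids describing the kernel of
  a tensor product of maps. The bare quotient module is used because the Hopf structure on the
  quotient comes only afterwards.\<close>

locale hopf_ideal = hopf_algebra K A + I: ideal I A
  for K :: "('k, 'x) ring_scheme" (structure) and A :: "('k, 'a) hopf" (structure)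
    and I :: "'a set" +
  assumes I_smult: "c \<in> carrier K \<Longrightarrow> x \<in> I \<Longrightarrow> c \<odot>\<^bsub>A\<^esub> x \<in> I"
    and I_comult: "x \<in> I \<Longrightarrow>
      sw (tensor K (quot_module A I) (quot_module A I)) x
        (\<lambda>a b. pure_tensor K (quot_module A I) (quot_module A I) (I +>\<^bsub>A\<^esub> a) (I +>\<^bsub>A\<^esub> b)) =
      \<zero>\<^bsub>tensor K (quot_module A I) (quot_module A I)\<^esub>"
    and I_counit: "x \<in> I \<Longrightarrow> \<epsilon> x = \<zero>\<^bsub>K\<^esub>"
    and I_antipode: "x \<in> I \<Longrightarrow> S x \<in> I"
begin

text \<open>Coproduct, counit and antipode are evaluated at a chosen representative; the ideal
  conditions make the choice immaterial. As for the coinvariants, the coproduct is written over a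
  record that does not mention it.\<close>

definition quot_hopf :: "('k, 'a set) hopf"
  where "quot_hopf =
    \<lparr>carrier = a_rcosets\<^bsub>A\<^esub> I, monoid.mult = rcoset_mult A I, one = I +>\<^bsub>A\<^esub> \<one>\<^bsub>A\<^esub>,
      zero = I, add = set_add A, smult = smult (quot_module A I),
      comult = (\<lambda>Y. sw (tensor_mod K (quot_module A I) (quot_module A I)) (SOME x. x \<in> Y)
        (\<lambda>a b. pure_tensor K (quot_module A I) (quot_module A I) (I +>\<^bsub>A\<^esub> a) (I +>\<^bsub>A\<^esub> b))),
      counit = (\<lambda>Y. \<epsilon> (SOME x. x \<in> Y)),
      antipode = (\<lambda>Y. I +>\<^bsub>A\<^esub> S (SOME x. x \<in> Y))\<rparr>"

abbreviation "B \<equiv> quot_hopf"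
abbreviation r :: "'a \<Rightarrow> 'a set" where "r x \<equiv> I +>\<^bsub>A\<^esub> x"

lemma I_submodule: "submodule I K A"
  by (rule submoduleI) (auto simp: I_smult I.a_closed I.a_inv_closed I.Icarr)

lemmas coset_add = quot_module_coset_add[OF I_submodule]
  and coset_smult = quot_module_coset_smult[OF I_submodule]
  and coset_closed = quot_module_coset_closed[OF I_submodule]

lemma B_fields:
  "carrier B = carrier (quot_module A I)" "add B = add (quot_module A I)"
  "zero B = zero (quot_module A I)" "smult B = smult (quot_module A I)"
  by (simp_all add: quot_hopf_def quot_module_simps)

lemma mod_B [simp, intro]: "module K B"
  by (rule module_cong[OF quot_module_is_module[OF I_submodule]]) (simp_all add: B_fields)

lemma mod_BB [simp, intro]: "module K (tensor K B B)" by (simp add: tensor_is_module)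

lemma mod_AB [simp, intro]: "module K (tensor K A B)" by (simp add: tensor_is_module)

lemma pair_BB: "module_pair K B B" by (simp add: module_pair_def)

lemma r_closed [simp]: "x \<in> carrier A \<Longrightarrow> r x \<in> carrier B"
  by (simp add: B_fields coset_closed)

lemma B_cases:
  assumes "Y \<in> carrier B"
  obtains x where "x \<in> carrier A" "Y = r x"
  using assms quot_module_carrierE by (auto simp: B_fields)

lemma r_add: "x \<in> carrier A \<Longrightarrow> y \<in> carrier A \<Longrightarrow> r x \<oplus>\<^bsub>B\<^esub> r y = r (x \<oplus>\<^bsub>A\<^esub> y)"
  by (simp add: B_fields coset_add)

lemma r_smult: "c \<in> carrier K \<Longrightarrow> x \<in> carrier A \<Longrightarrow> c \<odot>\<^bsub>B\<^esub> r x = r (c \<odot>\<^bsub>A\<^esub> x)"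
  by (simp add: B_fields coset_smult)

lemma r_mult: "x \<in> carrier A \<Longrightarrow> y \<in> carrier A \<Longrightarrow> r x \<otimes>\<^bsub>B\<^esub> r y = r (x \<otimes>\<^bsub>A\<^esub> y)"
  by (simp add: quot_hopf_def I.rcoset_mult_add)

lemma r_one: "\<one>\<^bsub>B\<^esub> = r \<one>\<^bsub>A\<^esub>"
  by (simp add: quot_hopf_def)

lemma r_linear: "r \<in> linear_maps K A B"
  by (rule linear_mapsI) (simp_all add: r_add r_smult)

lemma r_lin [lin_intros]: "f \<in> linear_maps K Z A \<Longrightarrow> (\<lambda>x. r (f x)) \<in> linear_maps K Z B"
  by (rule linear_maps_comp[OF _ r_linear])

lemma linear_B:
  assumes "(\<lambda>x. f (r x)) \<in> linear_maps K A P"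
  shows "f \<in> linear_maps K B P"
  by (rule linear_mapsI) (auto elim!: B_cases simp: r_add r_smult linear_mapsD[OF assms])

lemma coset_some:
  assumes "x \<in> carrier A"
  obtains h where "h \<in> I" "(SOME y. y \<in> r x) = h \<oplus>\<^bsub>A\<^esub> x"
proof -
  have "x \<in> r x" using I.a_rcos_self assms by simp
  then have "(SOME y. y \<in> r x) \<in> r x" by (rule someI)
  then show thesis using that by (auto simp: a_r_coset_def')
qed

text \<open>The chosen representative differs from \<open>x\<close> by an element of the ideal,
  which \<open>f\<close> kills.\<close>

lemma some_coset:
  assumes f: "f \<in> linear_maps K A P" and P: "module K P"
    and 0: "\<And>h. h \<in> I \<Longrightarrow> f h = \<zero>\<^bsub>P\<^esub>" and x: "x \<in> carrier A"
  shows "f (SOME y. y \<in> r x) = f x"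
proof -
  interpret P: module K P by fact
  obtain h where "h \<in> I" "(SOME y. y \<in> r x) = h \<oplus>\<^bsub>A\<^esub> x" by (rule coset_some[OF x])
  then show ?thesis using x I.Icarr by (simp add: linear_mapsD[OF f] 0)
qed

lemma comult_B:
  assumes x: "x \<in> carrier A"
  shows "comult B (r x) = sw (tensor K B B) x (\<lambda>a b. pure_tensor K B B (r a) (r b))"
proof -
  let ?M = "quot_module A I"
  let ?f = "\<lambda>x. sw (tensor K B B) x (\<lambda>a b. pure_tensor K B B (r a) (r b))"
  have eqs: "pure_tensor K ?M ?M = pure_tensor K B B" "tensor_mod K ?M ?M = tensor_mod K B B"
    by (rule tensor_mod_record_cong; simp add: B_fields)+
  have zero: "\<zero>\<^bsub>tensor K ?M ?M\<^esub> = \<zero>\<^bsub>tensor K B B\<^esub>"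
    unfolding tensor_mod_fields[symmetric] eqs ..
  have "comult B (r x) = ?f (SOME y. y \<in> r x)"
    unfolding sweedler_tensor_mod[symmetric] eqs[symmetric] by (simp add: quot_hopf_def)
  also have "\<dots> = ?f x"
  proof (rule some_coset[OF _ mod_BB _ x])
    show "?f \<in> linear_maps K A (tensor K B B)" by (auto intro!: lin_intros)
    show "h \<in> I \<Longrightarrow> ?f h = \<zero>\<^bsub>tensor K B B\<^esub>" for h
      using I_comult[of h] unfolding sweedler_tensor_mod[symmetric] eqs zero .
  qed
  finally show ?thesis .
qed

lemma counit_B: "x \<in> carrier A \<Longrightarrow> counit B (r x) = \<epsilon> x"
proof -
  assume x: "x \<in> carrier A"
  obtain h where "h \<in> I" "(SOME y. y \<in> r x) = h \<oplus>\<^bsub>A\<^esub> x" by (rule coset_some[OF x])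
  then show ?thesis using x I.Icarr by (simp add: quot_hopf_def I_counit)
qed

lemma antipode_B:
  assumes x: "x \<in> carrier A"
  shows "antipode B (r x) = r (S x)"
proof -
  have "r (S (SOME y. y \<in> r x)) = r (S x)"
  proof (rule some_coset[OF _ mod_B _ x])
    show "(\<lambda>x. r (S x)) \<in> linear_maps K A B" by (auto intro!: lin_intros)
    show "h \<in> I \<Longrightarrow> r (S h) = \<zero>\<^bsub>B\<^esub>" for h
      using I.a_rcos_const[OF I_antipode] by (simp add: quot_hopf_def)
  qed
  then show ?thesis by (simp add: quot_hopf_def)
qed

section \<open>The Hopf algebra axioms for the quotient\<close>

lemma assoc_algebra_B: "assoc_algebra K B"
proof -
  interpret B: module K B by simp
  have "ring B"
  proof (rule ringI)
    show "abelian_group B" by (rule B.M.abelian_group_axioms)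
    show "Group.monoid B"
      by (rule monoidI) (auto elim!: B_cases simp: r_one r_mult A.m_assoc)
  qed (auto elim!: B_cases simp: r_mult r_add A.l_distr A.r_distr)
  then show ?thesis
    unfolding assoc_algebra_def
    by (auto elim!: B_cases simp: assoc_algebra_axioms_def r_mult r_smult smult_mult_left smult_mult_right)
qed

lemma comult_B_linear: "comult B \<in> linear_maps K B (tensor K B B)"
proof (rule linear_B)
  have "(\<lambda>x. sw (tensor K B B) x (\<lambda>a b. pure_tensor K B B (r a) (r b))) \<in> linear_maps K A (tensor K B B)"
    by (auto intro!: lin_intros)
  then show "(\<lambda>x. comult B (r x)) \<in> linear_maps K A (tensor K B B)"
    by (subst linear_maps_cong) (auto simp: comult_B)
qed

lemma antipode_B_linear: "antipode B \<in> linear_maps K B B"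
proof (rule linear_B)
  have "(\<lambda>x. r (S x)) \<in> linear_maps K A B"
    by (auto intro!: lin_intros)
  then show "(\<lambda>x. antipode B (r x)) \<in> linear_maps K A B"
    by (subst linear_maps_cong) (auto simp: antipode_B)
qed

text \<open>Every element of the quotient is some \<open>r x\<close>, so each coalgebra axiom
  becomes a Sweedler sum over \<open>x\<close> in A, where the axiom is already available.\<close>

lemma lift_comult_B:
  assumes P: "module K P" and \<beta>: "\<beta> \<in> bilinear_maps K B B P" and x: "x \<in> carrier A"
  shows "tensor_lift K P \<beta> (comult B (r x)) = sw P x (\<lambda>a b. \<beta> (r a) (r b))"
proof -
  have "tensor_lift K P \<beta> (comult B (r x)) =
      sw P x (\<lambda>a b. tensor_lift K P \<beta> (pure_tensor K B B (r a) (r b)))"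
    unfolding comult_B[OF x] using P x
    by (intro lin_sw module_pair.lift_linear[OF pair_BB P \<beta>]) (auto intro!: lin_intros)
  then show ?thesis using P \<beta> by simp
qed

lemma comult_B_mult:
  assumes x: "x \<in> carrier A" and y: "y \<in> carrier A"
  shows "comult B (r (x \<otimes>\<^bsub>A\<^esub> y)) = comult B (r x) \<otimes>\<^bsub>tensor K B B\<^esub> comult B (r y)"
proof -
  let ?T = "tensor K B B"
  interpret B: assoc_algebra K B by (rule assoc_algebra_B)
  have "comult B (r x) \<otimes>\<^bsub>?T\<^esub> comult B (r y) = tensor_lift K ?T (\<lambda>a b. tensor_lift K ?T (\<lambda>c d.
      pure_tensor K B B (a \<otimes>\<^bsub>B\<^esub> c) (b \<otimes>\<^bsub>B\<^esub> d)) (comult B (r y))) (comult B (r x))"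
    by (rule tensor_mult)
  also have "\<dots> = sw ?T x (\<lambda>a b. tensor_lift K ?T (\<lambda>c d.
      pure_tensor K B B (r a \<otimes>\<^bsub>B\<^esub> c) (r b \<otimes>\<^bsub>B\<^esub> d)) (comult B (r y)))"
    using x y linear_mapsD(1)[OF comult_B_linear, of "r y"]
    by (intro lift_comult_B) (auto intro!: lin_intros)
  also have "\<dots> = sw ?T x (\<lambda>a b. sw ?T y (\<lambda>c d.
      pure_tensor K B B (r a \<otimes>\<^bsub>B\<^esub> r c) (r b \<otimes>\<^bsub>B\<^esub> r d)))"
    by (rule sweedler_cong[OF refl], rule lift_comult_B) (use y in \<open>auto intro!: lin_intros\<close>)
  also have "\<dots> = sw ?T x (\<lambda>a b. sw ?T y (\<lambda>c d. pure_tensor K B B (r (a \<otimes>\<^bsub>A\<^esub> c)) (r (b \<otimes>\<^bsub>A\<^esub> d))))"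
    by (simp add: r_mult)
  also have "\<dots> = sw ?T (x \<otimes>\<^bsub>A\<^esub> y) (\<lambda>a b. pure_tensor K B B (r a) (r b))"
    using x y by (intro sw_mult[symmetric]) (auto intro!: lin_intros)
  also have "\<dots> = comult B (r (x \<otimes>\<^bsub>A\<^esub> y))"
    using x y by (simp add: comult_B)
  finally show ?thesis ..
qed

lemma coassoc_B:
  assumes x: "x \<in> carrier A"
  shows "tensor_assoc K B B B (tensor_map K (tensor K B B) B (comult B) (\<lambda>y. y) (comult B (r x))) =
    tensor_map K B (tensor K B B) (\<lambda>y. y) (comult B) (comult B (r x))"
proof -
  let ?T = "tensor K B B"
  let ?L = "tensor K ?T B" and ?R = "tensor K B ?T"
  have mods: "module K ?L" "module K ?R" by (simp_all add: tensor_is_module)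
  have comult_closed [simp]: "comult B y \<in> carrier ?T" if "y \<in> carrier B" for y
    using comult_B_linear that by (rule linear_mapsD)
  let ?as = "tensor_assoc K B B B"
  have bil: "(\<lambda>u z. tensor_lift K ?R (\<lambda>x y. pure_tensor K B ?T x (pure_tensor K B B y z)) u)
      \<in> bilinear_maps K ?T B ?R"
    using mods by (auto intro!: lin_intros)
  have as: "?as \<in> linear_maps K ?L ?R"
    unfolding tensor_assoc_def
    using module_pair.lift_linear[OF _ mods(2) bil] by (simp add: module_pair_def)
  have as_pure: "?as (pure_tensor K ?T B u z) =
      tensor_lift K ?R (\<lambda>x y. pure_tensor K B ?T x (pure_tensor K B B y z)) u"
    if "u \<in> carrier ?T" "z \<in> carrier B" for u z
    unfolding tensor_assoc_def using that bil mods by simp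
  let ?\<gamma> = "\<lambda>a b c. pure_tensor K B ?T (r a) (pure_tensor K B B (r b) (r c))"
  have "tensor_map K ?T B (comult B) (\<lambda>y. y) (comult B (r x)) =
      sw ?L x (\<lambda>a b. pure_tensor K ?T B (comult B (r a)) (r b))"
    unfolding tensor_map_def using mods x
    by (intro lift_comult_B) (auto intro!: lin_intros linear_maps_comp[OF _ comult_B_linear])
  then have "?as (tensor_map K ?T B (comult B) (\<lambda>y. y) (comult B (r x))) =
      ?as (sw ?L x (\<lambda>a b. pure_tensor K ?T B (comult B (r a)) (r b)))"
    by (rule arg_cong)
  also have "\<dots> = sw ?R x (\<lambda>a b. ?as (pure_tensor K ?T B (comult B (r a)) (r b)))"
    using mods x by (intro lin_sw as) (auto intro!: lin_intros linear_maps_comp[OF _ comult_B_linear])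
  also have "\<dots> = sw ?R x (\<lambda>a b. tensor_lift K ?R
      (\<lambda>x y. pure_tensor K B ?T x (pure_tensor K B B y (r b))) (comult B (r a)))"
    by (intro sweedler_cong refl as_pure) auto
  also have "\<dots> = sw ?R x (\<lambda>a b. sw ?R a (\<lambda>c d. ?\<gamma> c d b))"
    by (rule sweedler_cong[OF refl], rule lift_comult_B) (use mods in \<open>auto intro!: lin_intros\<close>)
  also have "\<dots> = sw ?R x (\<lambda>a b. sw ?R b (\<lambda>c d. ?\<gamma> a c d))"
    using mods x by (intro sw_coassoc) (auto intro!: lin_intros)
  also have "\<dots> = sw ?R x (\<lambda>a b. pure_tensor K B ?T (r a) (sw ?T b (\<lambda>c d. pure_tensor K B B (r c) (r d))))"
    by (rule sweedler_cong[OF refl], rule lin_sw[symmetric, where P = ?T])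
      (use mods in \<open>auto intro!: lin_intros\<close>)
  also have "\<dots> = sw ?R x (\<lambda>a b. pure_tensor K B ?T (r a) (comult B (r b)))"
    by (simp add: comult_B)
  also have "\<dots> = tensor_map K B ?T (\<lambda>y. y) (comult B) (comult B (r x))"
    unfolding tensor_map_def using mods x
    by (intro lift_comult_B[symmetric]) (auto intro!: lin_intros linear_maps_comp[OF _ comult_B_linear])
  finally show ?thesis .
qed

lemma counit_B_lin:
  assumes P: "module K P" and f: "f \<in> linear_maps K Z B" and v: "v \<in> carrier P"
  shows "(\<lambda>x. counit B (f x) \<odot>\<^bsub>P\<^esub> v) \<in> linear_maps K Z P"
proof -
  have "(\<lambda>x. \<epsilon> x \<odot>\<^bsub>P\<^esub> v) \<in> linear_maps K A P"
    using P v by (auto intro!: lin_intros)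
  then have "(\<lambda>x. counit B (r x) \<odot>\<^bsub>P\<^esub> v) \<in> linear_maps K A P"
    by (subst linear_maps_cong) (auto simp: counit_B)
  then have "(\<lambda>y. counit B y \<odot>\<^bsub>P\<^esub> v) \<in> linear_maps K B P"
    by (rule linear_B)
  from linear_maps_comp[OF f this] show ?thesis .
qed

lemma hopf_algebra_B: "hopf_algebra K B"
proof -
  interpret B: assoc_algebra K B by (rule assoc_algebra_B)
  let ?T = "tensor K B B"
  show ?thesis
  proof (unfold_locales)
    show "comult B \<in> ring_hom B ?T"
    proof (rule ring_hom_memI)
      show "x \<in> carrier B \<Longrightarrow> comult B x \<in> carrier ?T" for x
        using comult_B_linear by (rule linear_mapsD)
      show "x \<in> carrier B \<Longrightarrow> y \<in> carrier B \<Longrightarrow>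
          comult B (x \<otimes>\<^bsub>B\<^esub> y) = comult B x \<otimes>\<^bsub>?T\<^esub> comult B y" for x y
        by (auto elim!: B_cases simp: r_mult comult_B_mult)
      show "x \<in> carrier B \<Longrightarrow> y \<in> carrier B \<Longrightarrow>
          comult B (x \<oplus>\<^bsub>B\<^esub> y) = comult B x \<oplus>\<^bsub>?T\<^esub> comult B y" for x y
        using comult_B_linear by (rule linear_mapsD)
      show "comult B \<one>\<^bsub>B\<^esub> = \<one>\<^bsub>?T\<^esub>"
        unfolding r_one tensor_one
        by (subst comult_B, simp, intro sw_one) (auto intro!: lin_intros)
    qed
    show "comult B \<in> linear_maps K B ?T" by (rule comult_B_linear)
    show "counit B \<in> ring_hom B K"
      by (rule ring_hom_memI) (auto elim!: B_cases simp: counit_B r_mult r_add r_one)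
    show "antipode B \<in> linear_maps K B B" by (rule antipode_B_linear)
    show "counit B (c \<odot>\<^bsub>B\<^esub> x) = c \<otimes>\<^bsub>K\<^esub> counit B x"
      if "c \<in> carrier K" "x \<in> carrier B" for c x
      using that by (auto elim!: B_cases simp: counit_B r_smult counit_smult)
  next
    fix Y assume "Y \<in> carrier B"
    then obtain x where x: "x \<in> carrier A" and Y: "Y = r x" by (rule B_cases)
    show "tensor_assoc K B B B (tensor_map K ?T B (comult B) (\<lambda>y. y) (comult B Y)) =
        tensor_map K B ?T (\<lambda>y. y) (comult B) (comult B Y)"
      unfolding Y by (rule coassoc_B[OF x])
    have "tensor_lift K B (\<lambda>y z. counit B y \<odot>\<^bsub>B\<^esub> z) (comult B Y) =
        sw B x (\<lambda>a b. counit B (r a) \<odot>\<^bsub>B\<^esub> r b)"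
      unfolding Y using x by (intro lift_comult_B) (auto intro!: lin_intros counit_B_lin elim!: B_cases simp: counit_B)
    also have "\<dots> = sw B x (\<lambda>a b. \<epsilon> a \<odot>\<^bsub>B\<^esub> r b)"
      by (simp add: counit_B)
    also have "\<dots> = Y"
      unfolding Y using x by (intro sw_counit_left r_linear) auto
    finally show "tensor_lift K B (\<lambda>y z. counit B y \<odot>\<^bsub>B\<^esub> z) (comult B Y) = Y" .
    have "tensor_lift K B (\<lambda>y z. counit B z \<odot>\<^bsub>B\<^esub> y) (comult B Y) =
        sw B x (\<lambda>a b. counit B (r b) \<odot>\<^bsub>B\<^esub> r a)"
      unfolding Y using x by (intro lift_comult_B) (auto intro!: lin_intros counit_B_lin elim!: B_cases simp: counit_B)
    also have "\<dots> = sw B x (\<lambda>a b. \<epsilon> b \<odot>\<^bsub>B\<^esub> r a)"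
      by (simp add: counit_B)
    also have "\<dots> = Y"
      unfolding Y using x by (intro sw_counit_right r_linear) auto
    finally show "tensor_lift K B (\<lambda>y z. counit B z \<odot>\<^bsub>B\<^esub> y) (comult B Y) = Y" .
    have "tensor_lift K B (\<lambda>y z. antipode B y \<otimes>\<^bsub>B\<^esub> z) (comult B Y) =
        sw B x (\<lambda>a b. antipode B (r a) \<otimes>\<^bsub>B\<^esub> r b)"
      unfolding Y using x linear_mapsD(1)[OF antipode_B_linear]
      by (intro lift_comult_B) (auto intro!: lin_intros linear_maps_comp[OF _ antipode_B_linear])
    also have "\<dots> = sw B x (\<lambda>a b. r (S a \<otimes>\<^bsub>A\<^esub> b))"
      by (simp add: antipode_B r_mult)
    also have "\<dots> = counit B Y \<odot>\<^bsub>B\<^esub> \<one>\<^bsub>B\<^esub>"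
      unfolding Y counit_B[OF x] r_one using x by (intro sw_antipode_left r_linear) auto
    finally show "tensor_lift K B (\<lambda>y z. antipode B y \<otimes>\<^bsub>B\<^esub> z) (comult B Y) =
        counit B Y \<odot>\<^bsub>B\<^esub> \<one>\<^bsub>B\<^esub>" .
    have "tensor_lift K B (\<lambda>y z. y \<otimes>\<^bsub>B\<^esub> antipode B z) (comult B Y) =
        sw B x (\<lambda>a b. r a \<otimes>\<^bsub>B\<^esub> antipode B (r b))"
      unfolding Y using x linear_mapsD(1)[OF antipode_B_linear]
      by (intro lift_comult_B) (auto intro!: lin_intros linear_maps_comp[OF _ antipode_B_linear])
    also have "\<dots> = sw B x (\<lambda>a b. r (a \<otimes>\<^bsub>A\<^esub> S b))"
      by (simp add: antipode_B r_mult)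
    also have "\<dots> = counit B Y \<odot>\<^bsub>B\<^esub> \<one>\<^bsub>B\<^esub>"
      unfolding Y counit_B[OF x] r_one using x by (intro sw_antipode_right r_linear) auto
    finally show "tensor_lift K B (\<lambda>y z. y \<otimes>\<^bsub>B\<^esub> antipode B z) (comult B Y) =
        counit B Y \<odot>\<^bsub>B\<^esub> \<one>\<^bsub>B\<^esub>" .
  qed
qed

lemma r_hopf_hom: "r \<in> hopf_hom K A B"
proof -
  have "comult B (r x) = tensor_map K B B r r (comult A x)" if x: "x \<in> carrier A" for x
    unfolding tensor_map_def comult_B[OF x]
    using x by (intro lift_comult[symmetric]) (auto intro!: lin_intros)
  then show ?thesis
    by (auto simp: hopf_hom_def r_linear counit_B antipode_B r_mult r_add r_one intro!: ring_hom_memI)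
qed

lemma cocentral_r:
  assumes "\<And>x. x \<in> carrier A \<Longrightarrow> sw (tensor K A B) x (\<lambda>a b. pure_tensor K A B a (r b)) =
    sw (tensor K A B) x (\<lambda>a b. pure_tensor K A B b (r a))"
  shows "cocentral K A B r"
  unfolding cocentral_def
proof
  fix x assume x: "x \<in> carrier A"
  let ?T = "tensor K A B"
  have bil: "(\<lambda>a b. pure_tensor K A B a (r b)) \<in> bilinear_maps K A A ?T"
    by (auto intro!: lin_intros)
  have f: "tensor_lift K ?T (\<lambda>a b. pure_tensor K A B a (r b)) \<in> linear_maps K (tensor K A A) ?T"
    by (rule module_pair.lift_linear[OF pair_AA _ bil]) simp
  have "tensor_map K A B (\<lambda>y. y) r (comult A x) = sw ?T x (\<lambda>a b. pure_tensor K A B a (r b))"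
    unfolding tensor_map_def using x by (intro lift_comult) (auto intro!: lin_intros)
  also have "\<dots> = sw ?T x (\<lambda>a b. pure_tensor K A B b (r a))"
    by (rule assms[OF x])
  also have "\<dots> = sw ?T x (\<lambda>a b. tensor_lift K ?T (\<lambda>a b. pure_tensor K A B a (r b)) (pure_tensor K A A b a))"
    using bil by simp
  also have "\<dots> = tensor_map K A B (\<lambda>y. y) r (sw (tensor K A A) x (\<lambda>a b. pure_tensor K A A b a))"
    unfolding tensor_map_def using x by (intro lin_sw[OF _ _ f, symmetric]) (auto intro!: lin_intros)
  also have "sw (tensor K A A) x (\<lambda>a b. pure_tensor K A A b a) = tensor_swap K A A (comult A x)"
    unfolding tensor_swap_def using x by (intro lift_comult[symmetric]) (auto intro!: lin_intros)
  finally show "tensor_map K A B (\<lambda>y. y) r (comult A x) =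
      tensor_map K A B (\<lambda>y. y) r (tensor_swap K A A (comult A x))" .
qed

end

section \<open>The exact sequence of the cocenter\<close>

text \<open>The vector \<open>v\<close> carries the scalars, since a Sweedler sum must take its
  values in a module.\<close>

lemma (in hopf_algebra) counit_sw:
  assumes "\<beta> \<in> bilinear_maps K A A A" "x \<in> carrier A" "module K P" "v \<in> carrier P"
  shows "\<epsilon> (sw A x \<beta>) \<odot>\<^bsub>P\<^esub> v = sw P x (\<lambda>a b. \<epsilon> (\<beta> a b) \<odot>\<^bsub>P\<^esub> v)"
  using assms by (intro lin_sw) (auto intro!: lin_intros)

lemma (in hopf_algebra) sw_zero:
  assumes P: "module K P" and x: "x \<in> carrier A"
  shows "sw P x (\<lambda>a b. \<zero>\<^bsub>P\<^esub>) = \<zero>\<^bsub>P\<^esub>"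
proof -
  interpret P: module K P by fact
  have "(\<lambda>y. \<zero>\<^bsub>P\<^esub>) \<in> linear_maps K A P" by (rule P.zero_lin)
  from sw_counit_left[OF P this x] show ?thesis by simp
qed

lemma (in hopf_algebra) sw_in_submodule:
  assumes P: "module K P" and \<beta>: "\<beta> \<in> bilinear_maps K A A P" and H: "submodule H K P"
    and "\<And>a b. a \<in> carrier A \<Longrightarrow> b \<in> carrier A \<Longrightarrow> \<beta> a b \<in> H" and x: "x \<in> carrier A"
  shows "sw P x \<beta> \<in> H"
  unfolding sw_eq_lift[OF P \<beta> x]
  by (rule module_pair.tensor_lift_in_submodule[OF pair_AA P \<beta> H]) (use assms in auto)

section \<open>The ideal generated by the augmented coinvariants\<close>

context cocentral_hom begin

definition coinv_aug :: "'a set"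
  where "coinv_aug = coinv \<inter> {x \<in> carrier A. \<epsilon> x = \<zero>\<^bsub>K\<^esub>}"

text \<open>By construction only a left ideal, in the form demanded by \<open>hopf_exact\<close>;
  that it is two-sided depends on \<open>coinv_aug_right\<close>.\<close>

definition aug_ideal :: "'a set"
  where "aug_ideal = carrier A \<cdot>\<^bsub>A\<^esub> coinv_aug"

lemma coinv_augD: "c \<in> coinv_aug \<Longrightarrow> c \<in> coinv" "c \<in> coinv_aug \<Longrightarrow> \<epsilon> c = \<zero>\<^bsub>K\<^esub>"
  "c \<in> coinv_aug \<Longrightarrow> c \<in> carrier A"
  by (auto simp: coinv_aug_def)

lemma coinv_augI: "c \<in> coinv \<Longrightarrow> \<epsilon> c = \<zero>\<^bsub>K\<^esub> \<Longrightarrow> c \<in> coinv_aug"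
  by (simp add: coinv_aug_def)

lemma aug_ideal_carrier: "x \<in> aug_ideal \<Longrightarrow> x \<in> carrier A"
  unfolding aug_ideal_def by (induct rule: ideal_prod.induct) (auto simp: coinv_augD)

lemma aug_ideal_induct [consumes 1, case_names mult add]:
  assumes "x \<in> aug_ideal"
    and "\<And>a c. a \<in> carrier A \<Longrightarrow> c \<in> coinv_aug \<Longrightarrow> Pr (a \<otimes>\<^bsub>A\<^esub> c)"
    and "\<And>x y. x \<in> aug_ideal \<Longrightarrow> y \<in> aug_ideal \<Longrightarrow> Pr x \<Longrightarrow> Pr y \<Longrightarrow> Pr (x \<oplus>\<^bsub>A\<^esub> y)"
  shows "Pr x"
  using assms unfolding aug_ideal_def by (induct rule: ideal_prod.induct) auto

lemma aug_ideal_add: "x \<in> aug_ideal \<Longrightarrow> y \<in> aug_ideal \<Longrightarrow> x \<oplus>\<^bsub>A\<^esub> y \<in> aug_ideal"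
  unfolding aug_ideal_def by (rule ideal_prod.sum)

lemma aug_ideal_prod: "a \<in> carrier A \<Longrightarrow> c \<in> coinv_aug \<Longrightarrow> a \<otimes>\<^bsub>A\<^esub> c \<in> aug_ideal"
  unfolding aug_ideal_def by (rule ideal_prod.prod)

lemma aug_ideal_left: "x \<in> aug_ideal \<Longrightarrow> a \<in> carrier A \<Longrightarrow> a \<otimes>\<^bsub>A\<^esub> x \<in> aug_ideal"
  by (induct rule: aug_ideal_induct)
    (auto simp: A.m_assoc[symmetric] aug_ideal_prod coinv_augD A.r_distr aug_ideal_carrier aug_ideal_add)

lemma aug_ideal_smult:
  assumes "c \<in> carrier K" "x \<in> aug_ideal"
  shows "c \<odot>\<^bsub>A\<^esub> x \<in> aug_ideal"
  using aug_ideal_left[OF assms(2), of "c \<odot>\<^bsub>A\<^esub> \<one>\<^bsub>A\<^esub>"] assms aug_ideal_carrier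
  by (simp add: smult_mult_left)

lemma zero_coinv_aug: "\<zero>\<^bsub>A\<^esub> \<in> coinv_aug"
proof (rule coinv_augI)
  show "\<zero>\<^bsub>A\<^esub> \<in> coinv"
    using coinv_submodule submodule_abelian_subgroup abelian_subgroup.axioms(1)
      additive_subgroup.zero_closed by metis
  have "\<epsilon> (\<zero>\<^bsub>K\<^esub> \<odot>\<^bsub>A\<^esub> \<one>\<^bsub>A\<^esub>) = \<zero>\<^bsub>K\<^esub>" by (subst counit_smult) auto
  then show "\<epsilon> \<zero>\<^bsub>A\<^esub> = \<zero>\<^bsub>K\<^esub>" by simp
qed

lemma aug_ideal_submodule: "submodule aug_ideal K A"
proof (rule submoduleI)
  show "\<zero>\<^bsub>A\<^esub> \<in> aug_ideal"
    using aug_ideal_prod[OF A.one_closed zero_coinv_aug] by simp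
  show "\<ominus>\<^bsub>A\<^esub> a \<in> aug_ideal" if "a \<in> aug_ideal" for a
    using aug_ideal_smult[OF _ that, of "\<ominus>\<^bsub>K\<^esub> \<one>\<^bsub>K\<^esub>"] aug_ideal_carrier[OF that]
    by (simp add: smult_l_minus)
qed (auto simp: aug_ideal_carrier aug_ideal_add aug_ideal_smult)

text \<open>Right multiplication rests on \<open>c x = x\<^sub>1 (S x\<^sub>2 c x\<^sub>3)\<close> and the normality of the coinvariants.\<close>

lemma coinv_aug_right:
  assumes c: "c \<in> coinv_aug" and x: "x \<in> carrier A"
  shows "c \<otimes>\<^bsub>A\<^esub> x \<in> aug_ideal"
proof -
  note cA = coinv_augD(3)[OF c]
  let ?n = "\<lambda>b. sw A b (\<lambda>d e. S d \<otimes>\<^bsub>A\<^esub> (c \<otimes>\<^bsub>A\<^esub> e))"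
  have n: "?n b \<in> coinv_aug" if b: "b \<in> carrier A" for b
  proof (rule coinv_augI)
    show "?n b \<in> coinv" by (rule coinv_normal[OF coinv_augD(1)[OF c] b])
    \<comment> \<open>Every summand contains the factor \<open>\<epsilon> c\<close>, which is zero.
      The scalar is attached to the unit for the computation and freed by applying
      \<open>\<epsilon>\<close> once more.\<close>
    have "\<epsilon> (?n b) \<odot>\<^bsub>A\<^esub> \<one>\<^bsub>A\<^esub> = sw A b (\<lambda>d e. \<epsilon> (S d \<otimes>\<^bsub>A\<^esub> (c \<otimes>\<^bsub>A\<^esub> e)) \<odot>\<^bsub>A\<^esub> \<one>\<^bsub>A\<^esub>)"
      using b cA by (intro counit_sw) (auto intro!: lin_intros)
    also have "\<dots> = \<zero>\<^bsub>A\<^esub>"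
      using b cA by (simp add: coinv_augD(2)[OF c] sw_zero)
    finally have "\<epsilon> (\<epsilon> (?n b) \<odot>\<^bsub>A\<^esub> \<one>\<^bsub>A\<^esub>) = \<epsilon> \<zero>\<^bsub>A\<^esub>" by simp
    moreover have "?n b \<in> carrier A"
      using b cA by (intro sw_closed) (auto intro!: lin_intros)
    ultimately show "\<epsilon> (?n b) = \<zero>\<^bsub>K\<^esub>"
      using coinv_augD(2)[OF zero_coinv_aug] by (simp add: counit_smult)
  qed
  have "sw A x (\<lambda>a b. a \<otimes>\<^bsub>A\<^esub> ?n b) \<in> aug_ideal"
    using x cA by (intro sw_in_submodule aug_ideal_submodule aug_ideal_prod n) (auto intro!: lin_intros sw_closed)
  also have "sw A x (\<lambda>a b. a \<otimes>\<^bsub>A\<^esub> ?n b) =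
      sw A x (\<lambda>a b. sw A b (\<lambda>d e. a \<otimes>\<^bsub>A\<^esub> (S d \<otimes>\<^bsub>A\<^esub> (c \<otimes>\<^bsub>A\<^esub> e))))"
    by (rule sweedler_cong[OF refl], rule lin_sw) (use cA in \<open>auto intro!: lin_intros\<close>)
  also have "\<dots> = sw A x (\<lambda>a b. sw A b (\<lambda>d e. a \<otimes>\<^bsub>A\<^esub> S d \<otimes>\<^bsub>A\<^esub> (c \<otimes>\<^bsub>A\<^esub> e)))"
    using cA by (simp add: A.m_assoc)
  also have "\<dots> = \<one>\<^bsub>A\<^esub> \<otimes>\<^bsub>A\<^esub> (c \<otimes>\<^bsub>A\<^esub> x)"
    using x cA by (intro sw_cancel_right_left) (auto intro!: lin_intros)
  finally show ?thesis using x cA by simp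
qed

lemma aug_ideal_right: "x \<in> aug_ideal \<Longrightarrow> a \<in> carrier A \<Longrightarrow> x \<otimes>\<^bsub>A\<^esub> a \<in> aug_ideal"
  by (induct rule: aug_ideal_induct)
    (auto simp: A.m_assoc aug_ideal_left coinv_aug_right coinv_augD A.l_distr aug_ideal_carrier aug_ideal_add)

lemma aug_ideal_ideal: "ideal aug_ideal A"
  by (rule idealI)
    (use aug_ideal_submodule in \<open>auto simp: submodule_def aug_ideal_left aug_ideal_right A.ring_axioms\<close>)

lemma aug_ideal_counit: "x \<in> aug_ideal \<Longrightarrow> \<epsilon> x = \<zero>\<^bsub>K\<^esub>"
  by (induct rule: aug_ideal_induct) (auto simp: coinv_augD aug_ideal_carrier)

text \<open>The antipode sends \<open>a c\<close> to \<open>S c S a\<close>, with the coinvariant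
  factor now on the left, so absorption from the right is what closes the argument.\<close>

lemma aug_ideal_antipode: "x \<in> aug_ideal \<Longrightarrow> S x \<in> aug_ideal"
proof (induct rule: aug_ideal_induct)
  case (mult a c)
  have "S c \<in> coinv_aug"
    using mult by (intro coinv_augI) (auto simp: coinv_augD coinv_antipode)
  then show ?case
    using mult by (simp add: antipode_mult coinv_augD coinv_aug_right)
next
  case (add x y)
  then show ?case
    by (simp add: linear_mapsD(2)[OF antipode_linear] aug_ideal_carrier aug_ideal_add)
qed

section \<open>Passage to the quotient by \<open>J\<close>\<close>

abbreviation "J \<equiv> aug_ideal"
abbreviation r :: "'a \<Rightarrow> 'a set" where "r x \<equiv> J +>\<^bsub>A\<^esub> x"
abbreviation "AJ \<equiv> quot_module A J"

lemma mod_AJ [simp, intro]: "module K AJ"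
  by (rule quot_module_is_module[OF aug_ideal_submodule])

lemma r_linear: "r \<in> linear_maps K A AJ"
  by (rule linear_mapsI)
    (simp_all add: quot_module_coset_add quot_module_coset_smult quot_module_coset_closed aug_ideal_submodule)

text \<open>Subtracting \<open>\<epsilon> c\<close> times the unit moves \<open>c\<close> into the
  augmented coinvariants, so modulo \<open>J\<close> a coinvariant acts from the right by its
  counit.\<close>

lemma r_mult_coinv:
  assumes a: "a \<in> carrier A" and c: "c \<in> coinv"
  shows "r (a \<otimes>\<^bsub>A\<^esub> c) = \<epsilon> c \<odot>\<^bsub>AJ\<^esub> r a"
proof -
  have cA: "c \<in> carrier A" using c by simp
  have e1: "\<epsilon> c \<odot>\<^bsub>A\<^esub> \<one>\<^bsub>A\<^esub> \<in> coinv"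
    using submoduleE(4)[OF coinv_submodule _ coinv_one] cA by simp
  have "c \<ominus>\<^bsub>A\<^esub> \<epsilon> c \<odot>\<^bsub>A\<^esub> \<one>\<^bsub>A\<^esub> \<in> coinv_aug"
  proof (rule coinv_augI)
    show "c \<ominus>\<^bsub>A\<^esub> \<epsilon> c \<odot>\<^bsub>A\<^esub> \<one>\<^bsub>A\<^esub> \<in> coinv"
      unfolding a_minus_def
      by (intro submoduleE(5)[OF coinv_submodule] c submoduleE(3)[OF coinv_submodule] e1)
    have "\<ominus>\<^bsub>A\<^esub> (\<epsilon> c \<odot>\<^bsub>A\<^esub> \<one>\<^bsub>A\<^esub>) = (\<ominus>\<^bsub>K\<^esub> \<epsilon> c) \<odot>\<^bsub>A\<^esub> \<one>\<^bsub>A\<^esub>"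
      using cA by (simp add: smult_l_minus)
    moreover have "abelian_group K"
      using field_axioms by (simp add: field_def domain_def cring_def ring_def)
    ultimately show "\<epsilon> (c \<ominus>\<^bsub>A\<^esub> \<epsilon> c \<odot>\<^bsub>A\<^esub> \<one>\<^bsub>A\<^esub>) = \<zero>\<^bsub>K\<^esub>"
      using cA by (simp add: a_minus_def counit_smult abelian_group.r_neg)
  qed
  from aug_ideal_prod[OF a this] have "a \<otimes>\<^bsub>A\<^esub> c \<ominus>\<^bsub>A\<^esub> \<epsilon> c \<odot>\<^bsub>A\<^esub> a \<in> J"
    using a cA by (simp add: a_minus_def A.r_distr A.r_minus smult_mult_right)
  then show ?thesis
    using a cA quot_module_coset_eq_iff[OF aug_ideal_submodule, of "a \<otimes>\<^bsub>A\<^esub> c" "\<epsilon> c \<odot>\<^bsub>A\<^esub> a"]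
    by (simp add: quot_module_coset_smult[OF aug_ideal_submodule])
qed

lemma r_lin [lin_intros]: "f \<in> linear_maps K Z A \<Longrightarrow> (\<lambda>x. r (f x)) \<in> linear_maps K Z AJ"
  by (rule linear_maps_comp[OF _ r_linear])

lemma r_closed [simp]: "x \<in> carrier A \<Longrightarrow> r x \<in> carrier AJ"
  using r_linear by (rule linear_mapsD)

text \<open>For a generator \<open>a c\<close> the coproduct is
  \<open>a\<^sub>1 c\<^sub>1 \<otimes> a\<^sub>2 c\<^sub>2\<close> with both legs of
  \<open>c\<close> coinvariant. Modulo \<open>J\<close> they act by their counits, which multiply to
  \<open>\<epsilon> c = 0\<close>. Inserting \<open>pr\<close> makes the legs visibly coinvariant
  for \<open>r_mult_coinv\<close>.\<close>

lemma aug_ideal_comult: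
  assumes "x \<in> J"
  shows "sw (tensor K AJ AJ) x (\<lambda>a b. pure_tensor K AJ AJ (r a) (r b)) = \<zero>\<^bsub>tensor K AJ AJ\<^esub>"
  using assms
proof (induct rule: aug_ideal_induct)
  case (mult a c)
  let ?T = "tensor K AJ AJ"
  let ?g = "\<lambda>a b. pure_tensor K AJ AJ (r a) (r b)"
  have c: "c \<in> coinv" and cA: "c \<in> carrier A" using mult coinv_augD by auto
  have T [simp]: "module K ?T" by (simp add: tensor_is_module)
  interpret T: module K ?T by simp
  have pure_smult: "pure_tensor K AJ AJ (k \<odot>\<^bsub>AJ\<^esub> u) (l \<odot>\<^bsub>AJ\<^esub> v) =
      l \<odot>\<^bsub>?T\<^esub> (k \<odot>\<^bsub>?T\<^esub> pure_tensor K AJ AJ u v)"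
    if "k \<in> carrier K" "l \<in> carrier K" "u \<in> carrier AJ" "v \<in> carrier AJ" for k l u v
    using that module.smult_closed[OF mod_AJ]
      linear_mapsD(3)[OF bilinear_mapsD(1)[OF pure_tensor_bilinear'[OF mod_AJ mod_AJ]]]
      linear_mapsD(3)[OF bilinear_mapsD(2)[OF pure_tensor_bilinear'[OF mod_AJ mod_AJ]]]
    by simp
  have "sw ?T (a \<otimes>\<^bsub>A\<^esub> c) ?g =
      sw ?T a (\<lambda>a1 a2. sw ?T c (\<lambda>c1 c2. ?g (a1 \<otimes>\<^bsub>A\<^esub> c1) (a2 \<otimes>\<^bsub>A\<^esub> c2)))"
    using mult cA by (intro sw_mult) (auto intro!: lin_intros)
  also have "\<dots> = sw ?T a (\<lambda>a1 a2. sw ?T c (\<lambda>c1 c2. ?g (a1 \<otimes>\<^bsub>A\<^esub> pr c1) (a2 \<otimes>\<^bsub>A\<^esub> pr c2)))"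
    by (rule sweedler_cong[OF refl], rule coinv_pr_both[symmetric]) (use c in \<open>auto intro!: lin_intros\<close>)
  also have "\<dots> = sw ?T a (\<lambda>a1 a2. sw ?T c (\<lambda>c1 c2. \<epsilon> (pr c2) \<odot>\<^bsub>?T\<^esub> (\<epsilon> (pr c1) \<odot>\<^bsub>?T\<^esub> ?g a1 a2)))"
    by (simp add: r_mult_coinv pure_smult)
  also have "\<dots> = sw ?T a (\<lambda>a1 a2. sw ?T c (\<lambda>c1 c2. \<epsilon> c2 \<odot>\<^bsub>?T\<^esub> (\<epsilon> c1 \<odot>\<^bsub>?T\<^esub> ?g a1 a2)))"
    by (rule sweedler_cong[OF refl],
        rule coinv_pr_both[where \<beta> = "\<lambda>c1 c2. \<epsilon> c2 \<odot>\<^bsub>?T\<^esub> (\<epsilon> c1 \<odot>\<^bsub>?T\<^esub> ?g _ _)"])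
      (use c in \<open>auto intro!: lin_intros\<close>)
  also have "\<dots> = sw ?T a (\<lambda>a1 a2. \<epsilon> c \<odot>\<^bsub>?T\<^esub> ?g a1 a2)"
    by (rule sweedler_cong[OF refl], rule sw_counit_right) (use cA in \<open>auto intro!: lin_intros\<close>)
  also have "\<dots> = \<zero>\<^bsub>?T\<^esub>"
    using mult by (simp add: coinv_augD(2) sw_zero)
  finally show ?case .
next
  case (add x y)
  let ?T = "tensor K AJ AJ"
  have T [simp]: "module K ?T" by (simp add: tensor_is_module)
  interpret T: module K ?T by simp
  have "(\<lambda>x. sw ?T x (\<lambda>a b. pure_tensor K AJ AJ (r a) (r b))) \<in> linear_maps K A ?T"
    by (auto intro!: lin_intros)
  from linear_mapsD(2)[OF this] show ?case
    using add by (simp add: aug_ideal_carrier)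
qed

lemma hopf_ideal_J: "hopf_ideal K A J"
  by (intro hopf_ideal.intro hopf_algebra_axioms aug_ideal_ideal hopf_ideal_axioms.intro)
    (auto simp: aug_ideal_smult aug_ideal_comult aug_ideal_counit aug_ideal_antipode)

text \<open>
  Evaluate \<open>x\<^sub>3 \<otimes> r (x\<^sub>1 S x\<^sub>2 x\<^sub>4)\<close> twice: cancelling \<open>x\<^sub>1 S x\<^sub>2\<close> gives \<open>x\<^sub>1 \<otimes> r x\<^sub>2\<close>; replacing the
  coinvariant factor \<open>S x\<^sub>2 x\<^sub>4\<close> by its counit gives \<open>x\<^sub>2 \<otimes> r x\<^sub>1\<close>.
\<close>

lemma r_cocentral:
  assumes P: "module K P" and \<beta>: "\<beta> \<in> bilinear_maps K A AJ P" and x: "x \<in> carrier A"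
  shows "sw P x (\<lambda>a b. \<beta> a (r b)) = sw P x (\<lambda>a b. \<beta> b (r a))"
proof -
  interpret P: module K P by fact
  note l = bilinear_maps_lin[OF \<beta>] bilinear_mapsD(1,2)[OF \<beta>] bilinear_mapsD(3)[OF \<beta>]
  let ?E = "sw P x (\<lambda>u v. sw P v (\<lambda>a b. sw P b (\<lambda>c d. \<beta> c (r (u \<otimes>\<^bsub>A\<^esub> (S a \<otimes>\<^bsub>A\<^esub> d))))))"
  have "?E = sw P x (\<lambda>u v. sw P v (\<lambda>a b. sw P b (\<lambda>c d. \<beta> c (r (u \<otimes>\<^bsub>A\<^esub> S a \<otimes>\<^bsub>A\<^esub> d)))))"
    by (simp add: A.m_assoc)
  also have "\<dots> = sw P x (\<lambda>c d. \<beta> c (r (\<one>\<^bsub>A\<^esub> \<otimes>\<^bsub>A\<^esub> d)))"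
    using x P by (intro sw_cancel_right_left) (auto intro!: lin_intros l)
  finally have 1: "?E = sw P x (\<lambda>a b. \<beta> a (r b))" by simp
  have "?E = sw P x (\<lambda>u v. sw P v (\<lambda>a b. sw P b (\<lambda>c d. \<beta> c (r (u \<otimes>\<^bsub>A\<^esub> pr (S a \<otimes>\<^bsub>A\<^esub> d))))))"
    by (rule sweedler_cong[OF refl], rule coadjoint_pr[symmetric]) (use P in \<open>auto intro!: lin_intros l\<close>)
  also have "\<dots> = sw P x (\<lambda>u v. sw P v (\<lambda>a b. sw P b (\<lambda>c d. \<epsilon> (pr (S a \<otimes>\<^bsub>A\<^esub> d)) \<odot>\<^bsub>P\<^esub> \<beta> c (r u))))"
    by (simp add: r_mult_coinv linear_mapsD(3)[OF bilinear_mapsD(1)[OF \<beta>]])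
  also have "\<dots> = sw P x (\<lambda>u v. sw P v (\<lambda>a b. sw P b (\<lambda>c d. \<epsilon> (S a \<otimes>\<^bsub>A\<^esub> d) \<odot>\<^bsub>P\<^esub> \<beta> c (r u))))"
    by (rule sweedler_cong[OF refl], rule coadjoint_pr) (use P in \<open>auto intro!: lin_intros P.smult_lin l\<close>)
  also have "\<dots> = sw P x (\<lambda>u v. sw P v (\<lambda>a b. sw P b (\<lambda>c d. \<epsilon> d \<odot>\<^bsub>P\<^esub> (\<epsilon> a \<odot>\<^bsub>P\<^esub> \<beta> c (r u)))))"
    by (simp add: P.smult_assoc1[symmetric] m_comm l)
  also have "\<dots> = sw P x (\<lambda>u v. sw P v (\<lambda>a b. \<epsilon> a \<odot>\<^bsub>P\<^esub> \<beta> b (r u)))"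
    by (rule sweedler_cong[OF refl], rule sweedler_cong[OF refl], rule sw_counit_right)
      (use P in \<open>auto intro!: lin_intros P.smult_lin l\<close>)
  also have "\<dots> = sw P x (\<lambda>u v. \<beta> v (r u))"
    by (rule sweedler_cong[OF refl], rule sw_counit_left) (use P in \<open>auto intro!: lin_intros l\<close>)
  finally show ?thesis using 1 by simp
qed

text \<open>On a coinvariant \<open>c\<close> the map \<open>\<pi>\<close> is
  \<open>\<epsilon> c\<close> times the unit, as applying the counit to the second leg of the
  coinvariance equation shows; for augmented coinvariants this is zero.\<close>

lemma aug_ideal_subset_kernel:
  assumes "x \<in> J"
  shows "\<pi> x = \<zero>\<^bsub>Q\<^esub>"
  using assms
proof (induct rule: aug_ideal_induct)
  case (mult a c)
  have c: "c \<in> coinv" and cA: "c \<in> carrier A" using mult coinv_augD by auto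
  have "\<pi> c = sw Q c (\<lambda>a b. \<epsilon> b \<odot>\<^bsub>Q\<^esub> \<pi> a)"
    using cA by (intro sw_counit_right[symmetric] \<pi>_linear) auto
  also have "\<dots> = \<epsilon> c \<odot>\<^bsub>Q\<^esub> \<one>\<^bsub>Q\<^esub>"
    using c by (intro coinv_sw) (auto intro!: lin_intros)
  finally have "\<pi> c = \<zero>\<^bsub>Q\<^esub>" using mult by (simp add: coinv_augD)
  then show ?case using mult cA by (simp add: \<pi>_mult)
next
  case (add x y)
  then show ?case by (simp add: linear_mapsD(2)[OF \<pi>_linear] aug_ideal_carrier)
qed

end

theorem corollary5p4:
  fixes K :: "('k, 'x) ring_scheme"
    and A :: "('k, 'a) hopf"
    and HC :: "('k, 'h) hopf"
    and q :: "'a \<Rightarrow> 'h"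
  assumes "algebraically_closed K"
    and "hopf_algebra K A"
    and "hopf_cocenter K A HC q"
  shows "\<exists>(C :: ('k, 'a) hopf) \<iota>. hopf_exact K C A HC \<iota> q"
proof -
  have q: "hopf_algebra K HC" "q \<in> hopf_hom K A HC" "q ` carrier A = carrier HC" "cocentral K A HC q"
    using assms(3) by (simp_all add: hopf_cocenter_def)
  interpret cocentral_hom K A HC q
    by (intro cocentral_hom.intro cocentral_hom_axioms.intro assms(2) q)
  interpret J: hopf_ideal K A aug_ideal by (rule hopf_ideal_J)
  have "cocentral K A J.B r"
  proof (rule J.cocentral_r)
    \<comment> \<open>\<open>r_cocentral\<close> speaks of the module quotient \<open>AJ\<close>,
      while the claim concerns the Hopf record \<open>J.B\<close>; their module fields coincide, so
      bilinearity transfers.\<close>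
    have "linear_maps K M J.B = linear_maps K M AJ" "linear_maps K J.B N = linear_maps K AJ N"
      for M :: "('k, 'a set) hopf" and N :: "('k, ('k, 'a, 'a set) tensor) module"
      by (simp_all add: linear_maps_def J.B_fields)
    then have "pure_tensor K A J.B \<in> bilinear_maps K A AJ (tensor K A J.B)"
      using pure_tensor_bilinear'[OF mod_A J.mod_B] by (simp add: bilinear_maps_def J.B_fields)
    then show "x \<in> carrier A \<Longrightarrow> sw (tensor K A J.B) x (\<lambda>a b. pure_tensor K A J.B a (r b)) =
        sw (tensor K A J.B) x (\<lambda>a b. pure_tensor K A J.B b (r a))" for x
      by (intro r_cocentral) auto
  qed
  \<comment> \<open>The test objects have elements of type \<open>'a set\<close>, which is the type
    of the cosets that make up \<open>J.B\<close>.\<close>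
  moreover have "\<exists>!g. g \<in> (carrier HC \<rightarrow>\<^sub>E carrier B) \<inter> hopf_hom K HC B \<and> (\<forall>x \<in> carrier A. g (q x) = f x)"
    if "hopf_algebra K B" "f \<in> hopf_hom K A B" "cocentral K A B f" for B :: "('k, 'a set) hopf" and f
    using assms(3) that unfolding hopf_cocenter_def by blast
  ultimately obtain g where g: "g \<in> hopf_hom K HC J.B" "\<And>x. x \<in> carrier A \<Longrightarrow> g (q x) = r x"
    using J.hopf_algebra_B J.r_hopf_hom by (metis IntE)
  \<comment> \<open>As \<open>r\<close> factors through \<open>q\<close> by the linear map
    \<open>g\<close>, an element killed by \<open>q\<close> has the zero coset, which is
    \<open>J\<close> itself.\<close>
  have "x \<in> aug_ideal" if x: "x \<in> carrier A" "q x = \<zero>\<^bsub>HC\<^esub>" for x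
  proof -
    have "g \<zero>\<^bsub>HC\<^esub> = \<zero>\<^bsub>J.B\<^esub>"
      using g(1) by (intro linear_map_zero[OF Q.mod_A J.mod_B]) (simp add: hopf_hom_def)
    then have "r x = aug_ideal" using g(2)[OF x(1)] x(2) by (simp add: J.quot_hopf_def)
    then show ?thesis using J.I.a_rcos_self[OF x(1)] by simp
  qed
  then have ker: "a_kernel A HC q = aug_ideal"
    using aug_ideal_subset_kernel aug_ideal_carrier unfolding a_kernel_def' by blast
  have "hopf_exact K C A HC (\<lambda>x. x) q"
    unfolding hopf_exact_def
  proof (intro conjI)
    show "a_kernel A HC q = carrier A \<cdot>\<^bsub>A\<^esub> ((\<lambda>x. x) ` carrier C \<inter> {x \<in> carrier A. \<epsilon> x = \<zero>\<^bsub>K\<^esub>})"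
      unfolding image_ident ker aug_ideal_def coinv_aug_def C_fields ..
    show "(\<lambda>x. x) ` carrier C = {x \<in> carrier A. tensor_map K HC A q (\<lambda>y. y) (comult A x) =
        pure_tensor K HC A \<one>\<^bsub>HC\<^esub> x}"
      unfolding image_ident C_fields coinv_def ..
  qed (rule assms(2) q hopf_algebra_C inclusion_hopf_hom inj_on_id2)+
  then show ?thesis by blast
qed

end
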